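(* Let $X=\mathbb P^m$, $G=SL_{m+1}$. For a given $\delta\in\mathbb C[\partial]$ of degree $d$, $$\mathcal N(\delta)=\{b\in B\mid \mathrm{rk}\,M_d(b)=\mathrm{rk}\,[M_d(b)\,|\,\Theta]\}.$$ Therefore $\mathcal N(\delta)$ is an algebraic variety defined by this rank condition. In particular, $\mathcal N(\delta)$ has a natural stratification given by $\mathrm{rk}\,M_d(b)$ (the strata being the subsets of $\mathcal N(\delta)$ on which $\mathrm{rk}\,M_d(b)$ takes a fixed value).
   Context: $R$ is the subring of $\mathbb C[x_0,\dots,x_m]$ generated by the monomials of degree $m+1$, graded so that these monomials have degree $1$. $V^\vee=\Gamma(\mathbb P^m,\mathcal O(m+1))$ is the degree-one part of $R$; let $\{a_i^\vee\}$ be its monomial basis and $\{a_i\}$ the dual linear coordinates on $V^\vee$, $\partial_i=\partial/\partial a_i$, $f=\sum_ia_ia_i^\vee$ the universal section, $f(b)=\sum_i b_ia_i^\vee$ for $b\in V^\vee$. $B\subset V^\vee$ is the set of forms defining a smooth hypersurface in $\mathbb P^m$. $\mathbb C[\partial]$ is the ring of constant coefficient differential operators on $V^\vee$. The tautological system $\tau$: its solution sheaf $\mathrm{sol}(\tau)$ consists of holomorphic functions $s$ on $V^\vee$ such that $P(\partial)s=0$ for every polynomial $P$ in the variables $a_i^\vee$ that vanishes in $R$; $s$ is annihilated by the vector fields of the natural $\mathfrak{sl}_{m+1}$-action on $V^\vee$; and $(\sum_ia_i\partial_i+1)s=0$. For $\delta\in\mathbb C[\partial]$, $\mathcal N(\delta)=\{b\in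 B\mid\delta s(b)=0\ \ \forall s\in\mathrm{sol}(\tau)_b\}$. The operators $Z_i$: let $\{x_i\}$ be a basis of $\hat{\mathfrak g}=\mathfrak{sl}_{m+1}\oplus\mathbb Ce$. For $x\in\mathfrak{sl}_{m+1}$, $Z^\vee(x)$ is the derivation given by the natural action on forms (a trace-free linear vector field in $x_0,\dots,x_m$; all such occur), and $Z^\vee(e)=-(E+1)$ with $E=\frac1{m+1}\sum_ux_u\frac{\partial}{\partial x_u}$. Put $Z_i=Z^\vee(x_i)$, acting on $R[a]e^f$ (with $\theta(re^f)=(\theta(r)+\theta(f)r)e^f$ for a vector field $\theta$ in $x_0,\dots,x_m$). The matrix $M_d$ and vector $\Theta$: let $R_{\le k}$ be the subspace of $R$ of elements of degree $\le k$; fix bases $\{e_j\}_{j\in\mathcal J_{d-1}}$ of $R_{\le d-1}$ and $\{e_j\}_{j\in\mathcal J_d}$ of $R_{\le d}$. For unknowns $\lambda^i_j\in\mathbb C$ put $r_i=\sum_{j\in\mathcal J_{d-1}}\lambda_j^ie_j$. Then $e^{-f}\sum_iZ_i(r_ie^f)$ lies in $R_{\le d}$ with coefficients in the basis $\{e_j\}_{j\in\mathcal J_d}$ that are linear in $\Lambda=(\lambda^i_j)$; $M_d(a)$ is the matrix, with entries in $\mathbb C+\sum_i\mathbb Ca_i$, such that the coefficient vector is $M_d(a)\Lambda$. $M_d(b)$ is its value at $a=b$. For $\delta=p(\partial)$ of degree $d$, $h\in R$ is the class of $p(a^\vee)$ (so $\delta e^f=he^f$), and $\Theta\in\mathbb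 C^{\mathcal J_d}$ is the coordinate vector of $h$ in the basis $\{e_j\}_{j\in\mathcal J_d}$. $[M_d(b)|\Theta]$ is the augmented matrix. *)

theory Defs
  imports
    "HOL-Analysis.Analysis"
    "HOL-Library.Poly_Mapping"
    "HOL-Library.Disjoint_Sets"
    "Jordan_Normal_Form.DL_Rank"
begin

no_notation Matrix.vec_index (infixl "$" 100)

section \<open>Polynomials\<close>

text \<open>Polynomials with coefficients in \<open>'c\<close> and variables indexed by \<open>'i\<close>; an exponent vector is
  a map \<open>'i \<Rightarrow>\<^sub>0 nat\<close>.\<close>

type_synonym ('i, 'c) mpol = "('i \<Rightarrow>\<^sub>0 nat) \<Rightarrow>\<^sub>0 'c"

definition Cst :: "'c::zero \<Rightarrow> ('i, 'c) mpol" where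
  "Cst c = Poly_Mapping.single 0 c"

definition Var :: "'i \<Rightarrow> ('i, 'c::zero_neq_one) mpol" where
  "Var u = Poly_Mapping.single (Poly_Mapping.single u 1) 1"

definition mdeg :: "('i::finite \<Rightarrow>\<^sub>0 nat) \<Rightarrow> nat" where
  "mdeg \<alpha> = (\<Sum>u\<in>UNIV. Poly_Mapping.lookup \<alpha> u)"

text \<open>The total degree; the zero polynomial gets degree \<open>0\<close>.\<close>

definition tdeg :: "('i::finite, 'c::zero) mpol \<Rightarrow> nat" where
  "tdeg p = Max (insert 0 (mdeg ` Poly_Mapping.keys p))"

text \<open>Substitution of \<open>g i\<close> for the variable \<open>i\<close>, the coefficients being mapped by \<open>\<phi>\<close>.\<close>

definition subst :: "('c::zero \<Rightarrow> 'r::comm_semiring_1) \<Rightarrow> ('i::finite \<Rightarrow> 'r) \<Rightarrow> ('i, 'c) mpol \<Rightarrow> 'r" where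
  "subst \<phi> g p = (\<Sum>\<alpha>\<in>Poly_Mapping.keys p.
     \<phi> (Poly_Mapping.lookup p \<alpha>) * (\<Prod>i\<in>UNIV. g i ^ Poly_Mapping.lookup \<alpha> i))"

definition eval :: "('i::finite, complex) mpol \<Rightarrow> complex ^ 'i \<Rightarrow> complex" where
  "eval p b = subst (\<lambda>c. c) (\<lambda>i. b $ i) p"

definition pderivx :: "'i \<Rightarrow> ('i, 'c::comm_semiring_1) mpol \<Rightarrow> ('i, 'c) mpol" where
  "pderivx u p = (\<Sum>\<alpha>\<in>Poly_Mapping.keys p.
     Poly_Mapping.single (\<alpha> - Poly_Mapping.single u 1)
       (of_nat (Poly_Mapping.lookup \<alpha> u) * Poly_Mapping.lookup p \<alpha>))"

definition scale_poly :: "complex \<Rightarrow> ('i, complex) mpol \<Rightarrow> ('i, complex) mpol" where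
  "scale_poly c p = Cst c * p"

lemma vector_space_scale_poly: "vector_space (scale_poly :: complex \<Rightarrow> ('i, complex) mpol \<Rightarrow> _)"
  by unfold_locales
    (simp_all add: scale_poly_def Cst_def distrib_left distrib_right single_add
      Poly_Mapping.mult_single flip: mult.assoc)

text \<open>Finite bases are given as lists, so that they can index rows and columns of matrices.\<close>

definition is_basis :: "('k::field \<Rightarrow> 'v::ab_group_add \<Rightarrow> 'v) \<Rightarrow> 'v set \<Rightarrow> 'v list \<Rightarrow> bool" where
  "is_basis sc W bs \<longleftrightarrow> distinct bs \<and> \<not> Modules.module.dependent sc (set bs)
     \<and> Modules.module.span sc (set bs) = W"


section \<open>The ring \<open>R\<close> and the universal section\<close>

text \<open>Throughout, \<open>m + 1 = CARD('n)\<close>, and the variables \<open>x\<^sub>0, \<dots>, x\<^sub>m\<close> are indexed by \<open>'n\<close>. The type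
  \<open>'n dmon\<close> of exponent vectors of degree \<open>m + 1\<close> indexes the monomial basis \<open>a\<^sub>i\<^sup>\<or>\<close> of
  \<open>V\<^sup>\<or> = \<Gamma>(\<P>\<^sup>m, \<O>(m + 1))\<close>; a form \<open>b \<in> V\<^sup>\<or>\<close> is given by its coordinate vector in
  \<open>complex ^ 'n dmon\<close>.\<close>

typedef (overloaded) 'n dmon = "{\<alpha> :: 'n::finite \<Rightarrow>\<^sub>0 nat. mdeg \<alpha> = CARD('n)}"
  morphisms expo Abs_dmon
proof
  show "Poly_Mapping.single (undefined :: 'n) (CARD('n)) \<in> {\<alpha>. mdeg \<alpha> = CARD('n)}"
    by (simp add: mdeg_def Poly_Mapping.lookup_single when_def)
qed

instance dmon :: (finite) finite
proof
  let ?F = "{f :: 'a \<Rightarrow> nat. \<forall>u. f u \<in> {..CARD('a)}}"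
  have fin: "finite ?F"
    using finite_PiE[of "UNIV :: 'a set" "\<lambda>_. {..CARD('a)}"]
    by (simp add: PiE_def Pi_def extensional_def)
  have "(\<lambda>i :: 'a dmon. Poly_Mapping.lookup (expo i)) ` UNIV \<subseteq> ?F"
  proof clarsimp
    fix i :: "'a dmon" and u :: 'a
    have "Poly_Mapping.lookup (expo i) u \<le> mdeg (expo i)"
      unfolding mdeg_def by (rule member_le_sum) auto
    then show "Poly_Mapping.lookup (expo i) u \<le> CARD('a)"
      using expo[of i] by simp
  qed
  then have "finite ((\<lambda>i :: 'a dmon. Poly_Mapping.lookup (expo i)) ` UNIV)"
    using fin by (rule finite_subset)
  moreover have "inj (\<lambda>i :: 'a dmon. Poly_Mapping.lookup (expo i))"
    by (rule injI) (simp add: expo_inject poly_mapping_eqI)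
  ultimately show "finite (UNIV :: 'a dmon set)"
    by (rule finite_imageD)
qed

definition avee :: "'n::finite dmon \<Rightarrow> ('n, complex) mpol" where
  "avee i = Poly_Mapping.single (expo i) 1"

inductive_set R :: "('n::finite, complex) mpol set" where
  const: "Cst c \<in> R"
| gen: "avee i \<in> R"
| add: "p \<in> R \<Longrightarrow> q \<in> R \<Longrightarrow> p + q \<in> R"
| mult: "p \<in> R \<Longrightarrow> q \<in> R \<Longrightarrow> p * q \<in> R"

text \<open>The grading of \<open>R\<close> is the degree in \<open>x\<close> divided by \<open>m + 1\<close>. The bound is an integer so that
  \<open>R_le (-1)\<close>, needed for operators of order \<open>0\<close>, is the zero space.\<close>

definition R_le :: "int \<Rightarrow> ('n::finite, complex) mpol set" where
  "R_le k = {r \<in> R. \<forall>\<alpha>\<in>Poly_Mapping.keys r. int (mdeg \<alpha>) \<le> k * int CARD('n)}"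

definition form :: "complex ^ ('n::finite dmon) \<Rightarrow> ('n, complex) mpol" where
  "form b = (\<Sum>i\<in>UNIV. Cst (b $ i) * avee i)"

text \<open>\<open>\<complex>[x][a]\<close> is represented as polynomials in \<open>a\<close> with coefficients in \<open>\<complex>[x]\<close>.\<close>

definition univ_section :: "('n::finite dmon, ('n, complex) mpol) mpol" where
  "univ_section = (\<Sum>i\<in>UNIV. Var i * Cst (avee i))"

definition smooth_forms :: "(complex ^ ('n::finite dmon)) set" where
  "smooth_forms = {b. \<forall>x :: complex ^ 'n. x \<noteq> 0 \<longrightarrow> eval (form b) x = 0
     \<longrightarrow> (\<exists>u. eval (pderivx u (form b)) x \<noteq> 0)}"


section \<open>The Lie algebra and its action\<close>

definition sl :: "(complex ^ 'n ^ 'n::finite) set" where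
  "sl = {A. trace A = 0}"

text \<open>The derivation by which \<open>A\<close> acts on forms on \<open>\<complex>\<^sup>m\<^sup>+\<^sup>1\<close>, the derivative of
  \<open>p \<mapsto> p \<circ> exp (- t A)\<close> at \<open>t = 0\<close>.\<close>

definition lin_vf :: "complex ^ 'n ^ 'n::finite \<Rightarrow> ('n, complex) mpol \<Rightarrow> ('n, complex) mpol" where
  "lin_vf A p = - (\<Sum>u\<in>UNIV. \<Sum>v\<in>UNIV. Cst (A $ u $ v) * Var v * pderivx u p)"

definition euler :: "('n::finite, complex) mpol \<Rightarrow> ('n, complex) mpol" where
  "euler p = Cst (1 / of_nat CARD('n)) * (\<Sum>u\<in>UNIV. Var u * pderivx u p)"

text \<open>An element \<open>x + t e\<close> of \<open>sl \<oplus> \<complex> e\<close> is represented as the pair \<open>(x, t)\<close>.\<close>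

definition ghat :: "((complex ^ 'n ^ 'n::finite) \<times> complex) set" where
  "ghat = sl \<times> UNIV"

definition scale_ghat ::
  "complex \<Rightarrow> (complex ^ 'n ^ 'n::finite) \<times> complex \<Rightarrow> (complex ^ 'n ^ 'n) \<times> complex" where
  "scale_ghat c = (\<lambda>(A, t). ((\<chi> u v. c * A $ u $ v), c * t))"

lemma vector_space_scale_ghat:
  "vector_space (scale_ghat :: complex \<Rightarrow> (complex ^ 'n ^ 'n::finite) \<times> complex \<Rightarrow> _)"
  by unfold_locales
    (auto simp: scale_ghat_def Finite_Cartesian_Product.vec_eq_iff algebra_simps
      case_prod_beta prod_eq_iff)

text \<open>\<open>twist \<theta> r\<close> is \<open>e\<^sup>-\<^sup>f \<theta> (r e\<^sup>f)\<close> for a derivation \<open>\<theta>\<close> of \<open>\<complex>[x]\<close>, extended \<open>a\<close>-linearly to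
  \<open>\<complex>[x][a]\<close>.\<close>

definition twist :: "(('n::finite, complex) mpol \<Rightarrow> ('n, complex) mpol)
    \<Rightarrow> ('n dmon, ('n, complex) mpol) mpol \<Rightarrow> ('n dmon, ('n, complex) mpol) mpol" where
  "twist \<theta> r = Poly_Mapping.map \<theta> r + Poly_Mapping.map \<theta> univ_section * r"

text \<open>\<open>Zvee (x, t) r\<close> is \<open>e\<^sup>-\<^sup>f (Z\<^sup>\<or>(x) - t (E + 1)) (r e\<^sup>f)\<close>.\<close>

definition Zvee :: "(complex ^ 'n ^ 'n::finite) \<times> complex
    \<Rightarrow> ('n dmon, ('n, complex) mpol) mpol \<Rightarrow> ('n dmon, ('n, complex) mpol) mpol" where
  "Zvee = (\<lambda>(A, t) r. twist (lin_vf A) r - Cst (Cst t) * (twist euler r + r))"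


section \<open>The tautological system\<close>

definition holo_on :: "(complex ^ 'i::finite) set \<Rightarrow> (complex ^ 'i \<Rightarrow> complex) \<Rightarrow> bool" where
  "holo_on U s \<longleftrightarrow> (\<forall>b\<in>U. \<exists>D. (s has_derivative D) (at b) \<and> (\<forall>c v. D (c *s v) = c * D v))"

definition pd :: "'i::finite \<Rightarrow> (complex ^ 'i \<Rightarrow> complex) \<Rightarrow> complex ^ 'i \<Rightarrow> complex" where
  "pd i s b = deriv (\<lambda>z. s (b + z *s axis i 1)) 0"

text \<open>The iterated partial derivative is taken in some fixed order of the coordinates; the order is
  irrelevant for holomorphic functions.\<close>

definition pd_mon ::
  "('i::finite \<Rightarrow>\<^sub>0 nat) \<Rightarrow> (complex ^ 'i \<Rightarrow> complex) \<Rightarrow> complex ^ 'i \<Rightarrow> complex" where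
  "pd_mon \<alpha> s = foldr (\<lambda>i. pd i ^^ Poly_Mapping.lookup \<alpha> i)
     (SOME is. distinct is \<and> set is = UNIV) s"

definition diffop ::
  "('i::finite, complex) mpol \<Rightarrow> (complex ^ 'i \<Rightarrow> complex) \<Rightarrow> complex ^ 'i \<Rightarrow> complex" where
  "diffop p s b = (\<Sum>\<alpha>\<in>Poly_Mapping.keys p. Poly_Mapping.lookup p \<alpha> * pd_mon \<alpha> s b)"

text \<open>The class in \<open>R\<close> of a polynomial in the \<open>a\<^sub>i\<^sup>\<or>\<close>.\<close>

definition to_R :: "('n::finite dmon, complex) mpol \<Rightarrow> ('n, complex) mpol" where
  "to_R p = subst Cst avee p"

text \<open>The vector field of \<open>A \<in> sl\<close> on \<open>V\<^sup>\<or>\<close> has the value \<open>A \<cdot> f(b)\<close> at \<open>b\<close>.\<close>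

definition sol :: "(complex ^ ('n::finite dmon)) set \<Rightarrow> (complex ^ 'n dmon \<Rightarrow> complex) set" where
  "sol U = {s. holo_on U s
     \<and> (\<forall>P. to_R P = 0 \<longrightarrow> (\<forall>b\<in>U. diffop P s b = 0))
     \<and> (\<forall>A\<in>sl. \<forall>b\<in>U.
          (\<Sum>i\<in>UNIV. Poly_Mapping.lookup (lin_vf A (form b)) (expo i) * pd i s b) = 0)
     \<and> (\<forall>b\<in>U. (\<Sum>i\<in>UNIV. b $ i * pd i s b) + s b = 0)}"

text \<open>Germs at \<open>b\<close> are represented by sections over open neighbourhoods of \<open>b\<close>.\<close>

definition NN :: "('n::finite dmon, complex) mpol \<Rightarrow> (complex ^ ('n dmon)) set" where
  "NN \<delta> = {b \<in> smooth_forms. \<forall>U s. open U \<longrightarrow> b \<in> U \<longrightarrow> s \<in> sol U \<longrightarrow> diffop \<delta> s b = 0}"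


section \<open>The matrices\<close>

text \<open>Entry \<open>j\<close> is the coefficient in \<open>\<complex>[a]\<close> of \<open>es ! j\<close> in \<open>q \<in> R[a]\<close>.\<close>

definition coords_a ::
  "('n::finite, complex) mpol list \<Rightarrow> ('n dmon, ('n, complex) mpol) mpol
    \<Rightarrow> ('n dmon, complex) mpol Matrix.vec" where
  "coords_a es q = Matrix.vec (length es)
     (\<lambda>j. Poly_Mapping.map (\<lambda>r. Modules.module.representation scale_poly (set es) r (es ! j)) q)"

text \<open>Here \<open>xs\<close> lists a basis of \<open>sl \<oplus> \<complex> e\<close>, \<open>es'\<close> one of \<open>R_le (d - 1)\<close> and \<open>es\<close> one of
  \<open>R_le d\<close>. The column of the unknown \<open>\<lambda>\<^sup>i\<^sub>j\<close> is the coordinate vector of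
  \<open>e\<^sup>-\<^sup>f Z\<^sub>i (e\<^sub>j e\<^sup>f)\<close>.\<close>

definition M_mat :: "((complex ^ 'n ^ 'n::finite) \<times> complex) list
    \<Rightarrow> ('n, complex) mpol list \<Rightarrow> ('n, complex) mpol list
    \<Rightarrow> ('n dmon, complex) mpol Matrix.mat" where
  "M_mat xs es' es = mat_of_cols (length es) [coords_a es (Zvee x (Cst e)). x \<leftarrow> xs, e \<leftarrow> es']"

definition M_at :: "((complex ^ 'n ^ 'n::finite) \<times> complex) list
    \<Rightarrow> ('n, complex) mpol list \<Rightarrow> ('n, complex) mpol list
    \<Rightarrow> complex ^ ('n dmon) \<Rightarrow> complex Matrix.mat" where
  "M_at xs es' es b = map_mat (\<lambda>p. eval p b) (M_mat xs es' es)"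

definition Theta :: "('n::finite, complex) mpol list \<Rightarrow> ('n dmon, complex) mpol
    \<Rightarrow> complex Matrix.vec" where
  "Theta es \<delta> = Matrix.vec (length es)
     (\<lambda>j. Modules.module.representation scale_poly (set es) (to_R \<delta>) (es ! j))"

definition augment :: "'c Matrix.mat \<Rightarrow> 'c Matrix.vec \<Rightarrow> 'c Matrix.mat" where
  "augment A v = mat_of_cols (dim_row A) (cols A @ [v])"

definition rk :: "complex Matrix.mat \<Rightarrow> nat" where
  "rk A = vec_space.rank (dim_row A) A"


section \<open>Algebraic sets and stratifications\<close>

definition zariski_closed :: "(complex ^ 'i::finite) set \<Rightarrow> bool" where
  "zariski_closed C \<longleftrightarrow> (\<exists>P. C = {b. \<forall>p\<in>P. eval p b = 0})"

definition zariski_closed_in :: "(complex ^ 'i::finite) set \<Rightarrow> (complex ^ 'i) set \<Rightarrow> bool" where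
  "zariski_closed_in W N \<longleftrightarrow> (\<exists>C. zariski_closed C \<and> N = W \<inter> C)"

text \<open>A (possibly reducible) quasi-affine variety: a Zariski locally closed subset of affine space.\<close>

definition quasi_affine_variety :: "(complex ^ 'i::finite) set \<Rightarrow> bool" where
  "quasi_affine_variety N \<longleftrightarrow> (\<exists>C D. zariski_closed C \<and> zariski_closed D \<and> N = C - D)"

text \<open>A finite partition into locally closed pieces, ordered by their indices so that the closure
  (in \<open>N\<close>) of a stratum only meets strata of smaller or equal index.\<close>

definition stratification :: "(complex ^ 'i::finite) set \<Rightarrow> (nat \<Rightarrow> (complex ^ 'i) set) \<Rightarrow> bool" where
  "stratification N S \<longleftrightarrow>
     finite {k. S k \<noteq> {}} \<and> disjoint_family S \<and> (\<Union>k. S k) = N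
     \<and> (\<forall>k. quasi_affine_variety (S k))
     \<and> (\<forall>k. zariski_closed_in N (\<Union>j\<le>k. S j))"

end

theory Submission
  imports Defs "HOL-Complex_Analysis.Complex_Analysis"
    "HOL-Computational_Algebra.Fundamental_Theorem_Algebra"
begin

text \<open>
  Write \<open>f = f(b)\<close> and \<open>D\<^sub>u r = \<partial>\<^sub>u r + (\<partial>\<^sub>u f) r\<close>. As vector fields, the \<open>Z\<^sub>i\<close> span the operators \<open>\<partial>\<^sub>u \<circ> x\<^sub>v\<close>;
  the shift in \<open>- (E + 1)\<close> makes this work for the trace part. Hence the column space of \<open>M\<^sub>d(b)\<close> is the
  space of all \<open>\<Sum>\<^sub>u D\<^sub>u s\<^sub>u\<close> with \<open>s\<^sub>u\<close> of bounded degree, and the rank condition says that \<open>h\<close> lies in it.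

  For smooth \<open>b\<close> the partial derivatives \<open>\<partial>\<^sub>u f\<close> have no common zero besides the origin, so by the
  Nullstellensatz their Koszul complex is exact. This has two consequences: the degree
  bound on \<open>s\<close> is harmless (an element of \<open>R\<^sub>\<le>\<^sub>d\<close> in the image of the \<open>D\<^sub>u\<close> is already in the
  image with the bound), and the relations between the generators of the image are the trivial ones,
  which deform polynomially with \<open>b\<close>, so that the condition on \<open>h\<close> is Zariski closed.

  A solution \<open>s\<close> at \<open>b\<close> gives the functional \<open>r \<mapsto> r(\<partial>) s (b)\<close> on \<open>R\<close>, which kills the image of the \<open>Z\<^sub>i\<close>.
  Conversely, if \<open>h\<close> is not in the image, some functional \<open>\<phi>\<close> kills the image but not \<open>h\<close>, and
  \<open>s(a) = \<Sum>\<^sub>k \<phi>((f(a) - f(b))\<^sup>k) / k!\<close> converges near \<open>b\<close> to a solution with \<open>\<delta> s (b) = \<phi>(h) \<noteq> 0\<close>.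
\<close>

section \<open>Koszul complexes\<close>

text \<open>Equality of the two ranks is by itself not a closed condition: at a point where
  \<open>rk M\<close> drops, \<open>h\<close> may fall out of the column space although it lies in
  it at all nearby points. This is why the relations between the columns matter and not only
  solvability.

  The degree bound matters because the series evaluates the functional at arbitrarily high powers of
  a form, so the functional has to kill the image of the \<open>D\<^sub>u\<close> in all degrees,
  while the matrix sees only degrees up to \<open>d\<close>. A general functional has no growth
  control; killing the image is also what bounds it on monomials by a multiple of
  \<open>C\<^sup>k k!\<close>, which the factor \<open>1 / k!\<close> absorbs on a small ball.

  That the partial derivatives form a regular sequence would call for the theory of Cohen-Macaulay
  rings. Koszul homology is more flexible: it survives adding and removing generators with a
  controlled shift of degree, so the powers of the variables, where regularity is visible on
  exponents, can be exchanged for the partial derivatives.\<close>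

text \<open>A list \<open>l\<close> of booleans marks a subset of the positions of \<open>fs\<close>, and
  \<open>w l\<close> is the component of the chain \<open>w\<close> at the corresponding exterior monomial.\<close>

primrec kd :: "'a::comm_ring_1 list \<Rightarrow> (bool list \<Rightarrow> 'a) \<Rightarrow> bool list \<Rightarrow> 'a" where
  "kd [] w l = 0"
| "kd (f # fs) w l = (case l of [] \<Rightarrow> 0
     | False # l' \<Rightarrow> kd fs (\<lambda>k. w (False # k)) l' + f * w (True # l')
     | True # l' \<Rightarrow> - kd fs (\<lambda>k. w (True # k)) l')"

text \<open>Homogeneous chains of exterior degree \<open>j\<close>. Chains are total functions on
  lists, so values at lists of the wrong length or weight must be forced to zero for
  \<open>kd fs v = w\<close> to be an equation of chains.\<close>

definition khom :: "nat \<Rightarrow> nat \<Rightarrow> (bool list \<Rightarrow> 'a::zero) \<Rightarrow> bool" where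
  "khom n j w \<longleftrightarrow> (\<forall>l. w l \<noteq> 0 \<longrightarrow> length l = n \<and> count_list l True = j)"

text \<open>Vanishing of the Koszul homology in degree \<open>j\<close>.\<close>

definition kexact :: "'a::comm_ring_1 list \<Rightarrow> nat \<Rightarrow> bool" where
  "kexact fs j \<longleftrightarrow> (\<forall>w. khom (length fs) j w \<longrightarrow> kd fs w = (\<lambda>_. 0) \<longrightarrow>
     (\<exists>v. khom (length fs) (Suc j) v \<and> kd fs v = w))"

lemma khomD: "khom n j w \<Longrightarrow> length l \<noteq> n \<or> count_list l True \<noteq> j \<Longrightarrow> w l = 0"
  unfolding khom_def by blast

lemma khomI: "(\<And>l. length l \<noteq> n \<or> count_list l True \<noteq> j \<Longrightarrow> w l = 0) \<Longrightarrow> khom n j w"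
  unfolding khom_def by blast

lemma kd_add: "kd fs (\<lambda>l. v l + w l) l = kd fs v l + kd fs w l"
  by (induction fs arbitrary: v w l) (auto simp: algebra_simps split: list.split bool.split)

lemma kd_smult: "kd fs (\<lambda>l. c * w l) l = c * kd fs w l"
  by (induction fs arbitrary: w l) (auto simp: algebra_simps split: list.split bool.split)

lemma kd_zero: "kd fs (\<lambda>l. 0) l = 0"
  using kd_smult[of fs 0 "\<lambda>_. 0" l] by simp

lemma kd_uminus: "kd fs (\<lambda>l. - w l) l = - kd fs w l"
  using kd_smult[of fs "-1" w l] by simp

text \<open>Writing the degree as \<open>Suc (count_list l True) = j\<close> avoids subtraction and,
  for \<open>j = 0\<close>, says that the differential vanishes.\<close>

lemma khom_kd:
  assumes "khom (length fs) j w" "kd fs w l \<noteq> 0"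
  shows "length l = length fs \<and> Suc (count_list l True) = j"
  using assms
proof (induction fs arbitrary: w l j)
  case Nil
  then show ?case by simp
next
  case (Cons f fs)
  from Cons.prems(2) obtain x l' where l: "l = x # l'"
    by (cases l) auto
  show ?case
  proof (cases x)
    case True
    show ?thesis
    proof (cases j)
      case 0
      then have "(\<lambda>k. w (True # k)) = (\<lambda>_. 0)"
        using Cons.prems(1) by (auto simp: khom_def fun_eq_iff)
      then have "w (True # k) = 0" for k by meson
      then show ?thesis using Cons.prems(2) l True by (simp add: kd_zero)
    next
      case (Suc i)
      have "khom (length fs) i (\<lambda>k. w (True # k))"
        using Cons.prems(1) Suc by (auto simp: khom_def)
      moreover have "kd fs (\<lambda>k. w (True # k)) l' \<noteq> 0"
        using Cons.prems(2) l True by simp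
      ultimately show ?thesis using Cons.IH Suc l True by fastforce
    qed
  next
    case False
    have h: "khom (length fs) j (\<lambda>k. w (False # k))"
      using Cons.prems(1) by (auto simp: khom_def)
    consider "kd fs (\<lambda>k. w (False # k)) l' \<noteq> 0" | "w (True # l') \<noteq> 0"
      using Cons.prems(2) l False by fastforce
    then show ?thesis
    proof cases
      case 1
      then show ?thesis using Cons.IH[OF h] l False by simp
    next
      case 2
      then show ?thesis using Cons.prems(1) l False by (auto simp: khom_def)
    qed
  qed
qed

text \<open>The recursion of \<open>kd\<close> splits off the first generator; splitting off the
  last one costs the sign of moving its basis element past the others. This exhibits the complex of
  \<open>gs @ [f]\<close> as the mapping cone of \<open>f\<close>.\<close>

lemma kd_snoc_False:
  "length l = length gs \<Longrightarrow> kd (gs @ [f]) w (l @ [False]) =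
     kd gs (\<lambda>k. w (k @ [False])) l + (-1) ^ count_list l True * f * w (l @ [True])"
  by (induction gs arbitrary: w l)
    (auto simp: algebra_simps length_Suc_conv split: list.split bool.split)

lemma kd_snoc_True:
  "length l = length gs \<Longrightarrow> kd (gs @ [f]) w (l @ [True]) = kd gs (\<lambda>k. w (k @ [True])) l"
  by (induction gs arbitrary: w l)
    (auto simp: algebra_simps length_Suc_conv split: list.split bool.split)

lemma kd_sum: "kd fs (\<lambda>l. \<Sum>k\<in>A. w k l) l = (\<Sum>k\<in>A. kd fs (w k) l)"
  by (induction A rule: infinite_finite_induct) (auto simp: kd_zero kd_add)

text \<open>Up to sign, exterior multiplication by the \<open>k\<close>-th basis element.\<close>

primrec kh :: "nat \<Rightarrow> (bool list \<Rightarrow> 'a::comm_ring_1) \<Rightarrow> bool list \<Rightarrow> 'a" where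
  "kh 0 w l = (case l of True # l' \<Rightarrow> w (False # l') | _ \<Rightarrow> 0)"
| "kh (Suc k) w l = (case l of [] \<Rightarrow> 0 | False # l' \<Rightarrow> kh k (\<lambda>m. w (False # m)) l'
     | True # l' \<Rightarrow> - kh k (\<lambda>m. w (True # m)) l')"

lemma kh_add: "kh k (\<lambda>l. v l + w l) l = kh k v l + kh k w l"
  by (induction k arbitrary: v w l) (auto split: list.split bool.split)

lemma kh_smult: "kh k (\<lambda>l. c * w l) l = c * kh k w l"
  by (induction k arbitrary: w l) (auto split: list.split bool.split)

lemma kh_zero: "kh k (\<lambda>l. 0) l = 0"
  using kh_smult[of k 0 "\<lambda>_. 0" l] by simp

lemma kh_uminus: "kh k (\<lambda>l. - w l) l = - kh k w l"
  using kh_smult[of k "-1" w l] by simp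

text \<open>Contraction with \<open>fs\<close> and multiplication by a basis element anticommute up
  to the pairing of the two, which is \<open>fs ! k\<close>. Multiplication by each generator is
  thus homotopic to zero.\<close>

lemma kh_homotopy:
  "k < length fs \<Longrightarrow> length l = length fs \<Longrightarrow>
     kd fs (kh k w) l + kh k (kd fs w) l = fs ! k * w l"
proof (induction fs arbitrary: k w l)
  case (Cons f fs)
  obtain x l' where l: "l = x # l'" "length l' = length fs"
    using Cons.prems(2) by (cases l) auto
  show ?case
  proof (cases k)
    case 0
    then show ?thesis
      using l by (cases x) (auto simp: kd_zero algebra_simps)
  next
    case (Suc i)
    then have i: "i < length fs" using Cons.prems(1) by simp
    show ?thesis
    proof (cases x)
      case True
      then show ?thesis
        using Cons.IH[OF i l(2), of "\<lambda>m. w (True # m)"] l Suc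
        by (simp add: kd_uminus kh_uminus)
    next
      case False
      then show ?thesis
        using Cons.IH[OF i l(2), of "\<lambda>m. w (False # m)"] l Suc
        by (simp add: kh_add kh_smult algebra_simps)
    qed
  qed
qed simp

lemma khom_kh:
  assumes "khom n j w"
  shows "khom n (Suc j) (kh k w)"
  unfolding khom_def
proof (intro allI impI)
  fix l assume "kh k w l \<noteq> 0"
  then show "length l = n \<and> count_list l True = Suc j"
    using assms
  proof (induction k arbitrary: n j w l)
    case 0
    then obtain x l' where l: "l = x # l'" by (cases l) auto
    with 0 show ?case by (cases x) (auto simp: khom_def)
  next
    case (Suc k)
    then obtain x l' where l: "l = x # l'" by (cases l) auto
    have n: "n = Suc (n - 1)"
    proof (rule ccontr)
      assume "n \<noteq> Suc (n - 1)"
      then have "w (x # m) = 0" for m using Suc.prems(2) by (fastforce simp: khom_def)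
      then show False using Suc.prems(1) l by (cases x) (auto simp: kh_zero)
    qed
    show ?case
    proof (cases x)
      case True
      have nz: "kh k (\<lambda>m. w (True # m)) l' \<noteq> 0" using Suc.prems(1) l True by simp
      have j: "j = Suc (j - 1)"
      proof (rule ccontr)
        assume "j \<noteq> Suc (j - 1)"
        then have "w (True # m) = 0" for m using Suc.prems(2) by (fastforce simp: khom_def)
        then show False using nz by (auto simp: kh_zero)
      qed
      have "khom (n - 1) (j - 1) (\<lambda>m. w (True # m))"
        using Suc.prems(2) by (fastforce simp: khom_def)
      from Suc.IH[OF nz this] show ?thesis using l True n j by simp
    next
      case False
      have nz: "kh k (\<lambda>m. w (False # m)) l' \<noteq> 0" using Suc.prems(1) l False by simp
      have "khom (n - 1) j (\<lambda>m. w (False # m))"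
        using Suc.prems(2) by (fastforce simp: khom_def)
      from Suc.IH[OF nz this] show ?thesis using l False n by simp
    qed
  qed
qed

lemma khom_sum:
  fixes c :: "'k \<Rightarrow> 'a::comm_ring_1"
  assumes "\<And>k. k \<in> A \<Longrightarrow> khom n j (w k)"
  shows "khom n j (\<lambda>l. \<Sum>k\<in>A. c k * w k l)"
proof (rule khomI, rule sum.neutral, rule ballI)
  fix l k assume "length l \<noteq> n \<or> count_list l True \<noteq> j" "k \<in> A"
  then have "w k l = 0" using khomD[OF assms] by blast
  then show "c k * w k l = 0" by simp
qed

lemma kd_homotopy_cycle:
  assumes "khom (length fs) i b" "kd fs b = (\<lambda>_. 0)"
  shows "khom (length fs) (Suc i) (\<lambda>l. \<Sum>k<length fs. c k * kh k b l)"
    and "kd fs (\<lambda>l. \<Sum>k<length fs. c k * kh k b l) = (\<lambda>l. (\<Sum>k<length fs. c k * fs ! k) * b l)"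
proof -
  show h: "khom (length fs) (Suc i) (\<lambda>l. \<Sum>k<length fs. c k * kh k b l)"
    by (intro khom_sum khom_kh assms)
  show "kd fs (\<lambda>l. \<Sum>k<length fs. c k * kh k b l) = (\<lambda>l. (\<Sum>k<length fs. c k * fs ! k) * b l)"
  proof
    fix l
    show "kd fs (\<lambda>l. \<Sum>k<length fs. c k * kh k b l) l = (\<Sum>k<length fs. c k * fs ! k) * b l"
    proof (cases "length l = length fs")
      case True
      have "kd fs (kh k b) l = fs ! k * b l" if "k < length fs" for k
        using kh_homotopy[OF that True, of b] by (simp add: assms(2) kh_zero)
      then show ?thesis
        by (simp add: kd_sum kd_smult sum_distrib_right mult.assoc)
    next
      case False
      then show ?thesis
        using khom_kd[OF h, of l] khomD[OF assms(1), of l] by auto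
    qed
  qed
qed

text \<open>Multiplication by an element of the ideal is null-homotopic, so adjoining such an element
  shifts the homology up by one degree.\<close>

lemma kexact_ConsD:
  assumes g: "g = (\<Sum>k<length fs. c k * fs ! k)" and ex: "kexact (g # fs) (Suc i)"
  shows "kexact fs i"
  unfolding kexact_def
proof (intro allI impI)
  fix b assume b: "khom (length fs) i b" "kd fs b = (\<lambda>_. 0)"
  define C where "C = (\<lambda>l. \<Sum>k<length fs. c k * kh k b l)"
  have C: "khom (length fs) (Suc i) C" "kd fs C l = g * b l" for l
    using kd_homotopy_cycle[OF b, of c] unfolding C_def g by auto
  \<comment> \<open>\<open>- C\<close> cancels the term \<open>g * b\<close>, so \<open>w\<close> is
    a cycle one degree higher. In a preimage of \<open>w\<close> the component at \<open>g\<close>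
    bounds \<open>b\<close> up to sign.\<close>
  define w where "w l = (case l of [] \<Rightarrow> 0 | False # l' \<Rightarrow> - C l' | True # l' \<Rightarrow> b l')" for l
  have "khom (length (g # fs)) (Suc i) w"
    unfolding khom_def w_def
    using b(1) C(1) by (auto simp: khom_def split: list.splits bool.splits)
  moreover have "kd (g # fs) w l = 0" for l
    using C(2) b(2) by (auto simp: w_def kd_uminus split: list.split bool.split)
  ultimately obtain v where v: "khom (length (g # fs)) (Suc (Suc i)) v" "kd (g # fs) v = w"
    using ex unfolding kexact_def by (metis ext)
  have "khom (length fs) (Suc i) (\<lambda>l. - v (True # l))"
    using v(1) by (auto simp: khom_def)
  moreover have "kd fs (\<lambda>l. - v (True # l)) l = b l" for l
    using fun_cong[OF v(2), of "True # l"] by (simp add: w_def kd_uminus)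
  ultimately show "\<exists>v. khom (length fs) (Suc i) v \<and> kd fs v = b" by blast
qed

text \<open>Iterates the removal of a redundant generator. Each removal lowers the degree by one,
  which the summand \<open>length gs\<close> in the hypothesis pays for.\<close>

lemma kexact_append_ideal:
  assumes "\<And>g. g \<in> set gs \<Longrightarrow> \<exists>c. g = (\<Sum>k<length fs. c k * fs ! k)"
    and "kexact (gs @ fs) (length gs + i)"
  shows "kexact fs i"
  using assms
proof (induction gs)
  case (Cons g gs)
  obtain c where c: "g = (\<Sum>k<length fs. c k * fs ! k)" using Cons.prems(1) by auto
  define c' where "c' k = (if k < length gs then 0 else c (k - length gs))" for k
  have "(\<Sum>k<length gs + length fs. c' k * (gs @ fs) ! k) =
      (\<Sum>k\<in>{length gs..<length gs + length fs}. c' k * (gs @ fs) ! k)"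
    by (rule sum.mono_neutral_right) (auto simp: c'_def)
  also have "\<dots> = (\<Sum>k<length fs. c' (k + length gs) * (gs @ fs) ! (k + length gs))"
    using sum.shift_bounds_nat_ivl[of "\<lambda>k. c' k * (gs @ fs) ! k" 0 "length gs" "length fs"]
    by (simp add: atLeast0LessThan add.commute)
  also have "\<dots> = g" unfolding c by (simp add: c'_def nth_append)
  finally have "g = (\<Sum>k<length (gs @ fs). c' k * (gs @ fs) ! k)" by simp
  then have "kexact (gs @ fs) (length gs + i)"
    by (rule kexact_ConsD) (use Cons.prems(2) in simp)
  then show ?case using Cons.IH Cons.prems(1) by simp
qed simp

text \<open>The long exact sequence of the mapping cone of \<open>f\<close> at one spot: the
  homology of \<open>gs\<close> vanishes in degree \<open>Suc j\<close>, and \<open>bd\<close> says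
  that \<open>f\<close> acts injectively on the homology in degree \<open>j\<close>, with
  \<open>a\<close> as the witness that \<open>f * b\<close> is a boundary.\<close>

lemma kexact_snoc:
  assumes ex: "kexact gs (Suc j)"
    and bd: "\<And>a b. khom (length gs) j b \<Longrightarrow> kd gs b = (\<lambda>_. 0) \<Longrightarrow> khom (length gs) (Suc j) a \<Longrightarrow>
        (\<And>l. kd gs a l + (-1) ^ j * f * b l = 0) \<Longrightarrow>
        \<exists>v. khom (length gs) (Suc j) v \<and> kd gs v = b"
  shows "kexact (gs @ [f]) (Suc j)"
  unfolding kexact_def
proof (intro allI impI)
  let ?n = "length gs"
  fix w assume w: "khom (length (gs @ [f])) (Suc j) w" "kd (gs @ [f]) w = (\<lambda>_. 0)"
  define a where "a = (\<lambda>k. w (k @ [False]))"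
  define b where "b = (\<lambda>k. w (k @ [True]))"
  have ha: "khom ?n (Suc j) a" and hb: "khom ?n j b"
    using khomD[OF w(1)] unfolding a_def b_def by (intro khomI; force)+
  have db: "kd gs b = (\<lambda>_. 0)"
  proof
    fix l show "kd gs b l = 0"
      using kd_snoc_True[of l gs f w] khom_kd[OF hb, of l] w(2) unfolding b_def
      by (cases "length l = length gs") auto
  qed
  have sgn: "(-1) ^ count_list l True * f * b l = (-1) ^ j * f * b l" for l
    using hb by (cases "b l = 0") (auto simp: khom_def)
  have da: "kd gs a l + (-1) ^ j * f * b l = 0" for l
  proof (cases "length l = ?n")
    case True
    then show ?thesis
      using kd_snoc_False[OF True, of f w] w(2) sgn[of l] unfolding a_def b_def by simp
  next
    case False
    then show ?thesis using khom_kd[OF ha, of l] khomD[OF hb, of l] by auto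
  qed
  obtain b' where b': "khom ?n (Suc j) b'" "kd gs b' = b"
    using bd[OF hb db ha da] by blast
  \<comment> \<open>As \<open>b'\<close> bounds \<open>b\<close>, this multiple of \<open>b'\<close>
    turns \<open>a\<close> into a cycle; a preimage of that cycle together with \<open>b'\<close>
    makes up the preimage of \<open>w\<close>.\<close>
  define z where "z = (\<lambda>l. a l + ((-1) ^ j * f) * b' l)"
  have "khom ?n (Suc j) z"
    using khomD[OF ha] khomD[OF b'(1)] unfolding z_def by (intro khomI) simp
  moreover have "kd gs z = (\<lambda>_. 0)"
    unfolding z_def kd_add kd_smult b'(2) using da by (simp add: fun_eq_iff)
  ultimately obtain a' where a': "khom ?n (Suc (Suc j)) a'" "kd gs a' = z"
    using ex unfolding kexact_def by blast
  define v where "v l = (if l = [] then 0 else if last l then b' (butlast l) else a' (butlast l))" for l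
  have v_simps: "v (l @ [True]) = b' l" "v (l @ [False]) = a' l" for l
    by (simp_all add: v_def)
  have hv: "khom (length (gs @ [f])) (Suc (Suc j)) v"
    unfolding khom_def
  proof (intro allI impI)
    fix l assume nz: "v l \<noteq> 0"
    then obtain l' x where l: "l = l' @ [x]" by (cases l rule: rev_cases) (auto simp: v_def)
    show "length l = length (gs @ [f]) \<and> count_list l True = Suc (Suc j)"
      using nz a'(1) b'(1) by (cases x) (auto simp: l v_simps khom_def)
  qed
  moreover have "kd (gs @ [f]) v = w"
  proof
    fix l
    show "kd (gs @ [f]) v l = w l"
    proof (cases "length l = Suc ?n")
      case False
      then show ?thesis using khom_kd[OF hv, of l] khomD[OF w(1), of l] by auto
    next
      case True
      then obtain l' x where l: "l = l' @ [x]" "length l' = ?n" by (cases l rule: rev_cases) auto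
      show ?thesis
      proof (cases x)
        case True
        then show ?thesis
          using kd_snoc_True[OF l(2), of f v] b'(2) by (simp add: v_simps l b_def)
      next
        case False
        \<comment> \<open>\<open>b'\<close> lives one degree above \<open>b\<close>, so the sign in
          the cone is opposite to the one used in \<open>z\<close>.\<close>
        have "(-1) ^ count_list l' True * f * b' l' = - ((-1) ^ j * f * b' l')"
          using b'(1) by (cases "b' l' = 0") (auto simp: khom_def)
        then show ?thesis
          using kd_snoc_False[OF l(2), of f v] a'(2) False by (simp add: v_simps l z_def a_def)
      qed
    qed
  qed
  ultimately show "\<exists>v. khom (length (gs @ [f])) (Suc (Suc j)) v \<and> kd (gs @ [f]) v = w" by blast
qed

text \<open>Beyond the raised bound the homology on which a new generator has to act injectively is
  already zero, so nothing has to be known about the generator.\<close>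

lemma kexact_append:
  assumes "\<And>j. j > i \<Longrightarrow> kexact gs j" "j > i + length fs"
  shows "kexact (gs @ fs) j"
  using assms(2)
proof (induction fs arbitrary: j rule: rev_induct)
  case Nil
  then show ?case using assms(1) by simp
next
  case (snoc f fs)
  obtain j' where j': "j = Suc j'" "j' > i + length fs" using snoc.prems by (cases j) auto
  have "kexact ((gs @ fs) @ [f]) (Suc j')"
  proof (rule kexact_snoc)
    show "kexact (gs @ fs) (Suc j')" using snoc.IH j' by simp
    fix b assume "khom (length (gs @ fs)) j' b" "kd (gs @ fs) b = (\<lambda>_. 0)"
    then show "\<exists>v. khom (length (gs @ fs)) (Suc j') v \<and> kd (gs @ fs) v = b"
      using snoc.IH j' unfolding kexact_def by blast
  qed
  then show ?case using j' by simp
qed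

section \<open>Ideals, regular elements and syzygies in low Koszul degrees\<close>

definition lideal :: "'a::comm_ring_1 list \<Rightarrow> 'a set" where
  "lideal fs = {p. \<exists>c. p = (\<Sum>k<length fs. c k * fs ! k)}"

abbreviation fvec :: "nat \<Rightarrow> bool list" where
  "fvec n \<equiv> replicate n False"

definition kone :: "nat \<Rightarrow> bool list \<Rightarrow> 'a::comm_ring_1" where
  "kone n l = (if l = fvec n then 1 else 0)"

lemma count_list_fvec: "count_list (fvec n) True = 0"
  by (induction n) auto

lemma count_list_eq_0_fvec: "count_list l True = 0 \<Longrightarrow> l = fvec (length l)"
  by (induction l) (auto split: if_splits)

lemma khom_kone: "khom n 0 (kone n)"
  by (auto simp: khom_def kone_def count_list_fvec)

lemma kd_khom_0: "khom (length fs) 0 b \<Longrightarrow> kd fs b = (\<lambda>_. 0)"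
  using khom_kd by blast

lemma khom_0_eq:
  fixes b :: "bool list \<Rightarrow> 'a::comm_ring_1"
  assumes "khom n 0 b"
  shows "b l = b (fvec n) * kone n l"
  using assms count_list_eq_0_fvec[of l] by (cases "b l = 0") (auto simp: khom_def kone_def)

lemma kd_fvec:
  "kd fs v (fvec (length fs)) = (\<Sum>k<length fs. v ((fvec (length fs))[k := True]) * fs ! k)"
proof (induction fs arbitrary: v)
  case (Cons f fs)
  then show ?case
    by (simp add: sum.lessThan_Suc_shift mult.commute add.commute del: sum.lessThan_Suc)
qed simp

text \<open>Homology in degree zero is the quotient by the ideal, \<open>kone\<close> being the
  generator of the chains in that degree.\<close>

lemma lideal_iff_boundary:
  "p \<in> lideal fs \<longleftrightarrow> (\<exists>v. khom (length fs) (Suc 0) v \<and> kd fs v = (\<lambda>l. p * kone (length fs) l))"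
proof
  assume "p \<in> lideal fs"
  then obtain c where c: "p = (\<Sum>k<length fs. c k * fs ! k)" by (auto simp: lideal_def)
  show "\<exists>v. khom (length fs) (Suc 0) v \<and> kd fs v = (\<lambda>l. p * kone (length fs) l)"
    using kd_homotopy_cycle[OF khom_kone kd_khom_0[OF khom_kone], where fs=fs and c=c] c by blast
next
  assume "\<exists>v. khom (length fs) (Suc 0) v \<and> kd fs v = (\<lambda>l. p * kone (length fs) l)"
  then obtain v where "kd fs v = (\<lambda>l. p * kone (length fs) l)" by blast
  then have "p = kd fs v (fvec (length fs))" by (simp add: kone_def)
  then show "p \<in> lideal fs" unfolding kd_fvec lideal_def by (intro CollectI exI)
qed

text \<open>Regularity enters in degree one, where the cone involves the homology of degree zero,
  that is, the quotient by \<open>lideal gs\<close>, which need not vanish. Higher degrees follow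
  from \<open>kexact_append\<close>.\<close>

lemma kexact_regular_snoc:
  assumes ex: "\<And>j. j > 0 \<Longrightarrow> kexact gs j"
    and reg: "\<And>p. f * p \<in> lideal gs \<Longrightarrow> p \<in> lideal gs"
    and "j > 0"
  shows "kexact (gs @ [f]) j"
proof (cases "j = 1")
  case False
  then show ?thesis using kexact_append[of 0 gs "[f]" j] ex \<open>j > 0\<close> by simp
next
  case True
  have "kexact (gs @ [f]) (Suc 0)"
  proof (rule kexact_snoc)
    let ?n = "length gs"
    show "kexact gs (Suc 0)" using ex by simp
    fix a b assume a: "khom ?n (Suc 0) a" and b: "khom ?n 0 b"
      and ab: "\<And>l. kd gs a l + (-1) ^ 0 * f * b l = 0"
    have fb: "kd gs (\<lambda>l. - a l) l = f * b l" for l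
      using ab[of l] by (simp add: kd_uminus add_eq_0_iff)
    have "kd gs (\<lambda>l. - a l) = (\<lambda>l. (f * b (fvec ?n)) * kone ?n l)"
    proof
      fix l
      show "kd gs (\<lambda>l. - a l) l = (f * b (fvec ?n)) * kone ?n l"
        unfolding fb mult.assoc khom_0_eq[OF b, of l, symmetric] ..
    qed
    moreover have "khom ?n (Suc 0) (\<lambda>l. - a l)" using a by (simp add: khom_def)
    ultimately have "f * b (fvec ?n) \<in> lideal gs" unfolding lideal_iff_boundary by blast
    then have "b (fvec ?n) \<in> lideal gs" by (rule reg)
    then show "\<exists>v. khom ?n (Suc 0) v \<and> kd gs v = b"
      unfolding lideal_iff_boundary by (simp flip: khom_0_eq[OF b])
  qed
  then show ?thesis using True by simp
qed

lemma kexact_Nil: "j > 0 \<Longrightarrow> kexact [] j"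
  unfolding kexact_def khom_def
  by (intro allI impI exI[of _ "\<lambda>_. 0"]) (fastforce simp: fun_eq_iff)

lemma kh_kone: "i < n \<Longrightarrow> k < n \<Longrightarrow> kh k (kone n) ((fvec n)[i := True]) = (if i = k then 1 else 0)"
proof (induction n arbitrary: i k)
  case (Suc n)
  have f: "(\<lambda>m. kone (Suc n) (False # m)) = kone n" and t: "(\<lambda>m. kone (Suc n) (True # m)) = (\<lambda>_. 0)"
    by (auto simp: kone_def fun_eq_iff)
  show ?case
    using Suc by (cases i; cases k) (auto simp: f t kh_zero, auto simp: kone_def)
qed simp

text \<open>A chain of degree two is an antisymmetric matrix: its component at a pair of positions
  contributes to the two corresponding rows with opposite signs.\<close>

lemma kd_antisym:
  "\<exists>t. (\<forall>i j. t i j = - t j i) \<and>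
     (\<forall>i<length fs. kd fs v ((fvec (length fs))[i := True]) = (\<Sum>j<length fs. t i j * fs ! j))"
proof (induction fs arbitrary: v)
  case Nil
  show ?case by (rule exI[of _ "\<lambda>_ _. 0"]) simp
next
  case (Cons f fs)
  let ?n = "length fs"
  obtain t where t: "\<And>i j. t i j = - t j i"
    "\<And>i. i < ?n \<Longrightarrow> kd fs (\<lambda>l. v (False # l)) ((fvec ?n)[i := True]) = (\<Sum>j<?n. t i j * fs ! j)"
    using Cons.IH[of "\<lambda>l. v (False # l)"] by blast
  define b where "b j = v (True # (fvec ?n)[j := True])" for j
  \<comment> \<open>Row and column \<open>0\<close> come from the components that contain the new
    first position; the diagonal entry is set to zero.\<close>
  define t' where "t' i j = (case i of 0 \<Rightarrow> (case j of 0 \<Rightarrow> 0 | Suc j' \<Rightarrow> - b j')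
    | Suc i' \<Rightarrow> (case j of 0 \<Rightarrow> b i' | Suc j' \<Rightarrow> t i' j'))" for i j
  have "t' i j = - t' j i" for i j
    by (cases i; cases j) (simp_all add: t'_def, rule t(1))
  moreover have "kd (f # fs) v ((fvec (length (f # fs)))[i := True]) =
      (\<Sum>j<length (f # fs). t' i j * (f # fs) ! j)" if "i < length (f # fs)" for i
  proof (cases i)
    case 0
    then show ?thesis
      by (simp add: sum.lessThan_Suc_shift kd_fvec b_def t'_def sum_negf del: sum.lessThan_Suc)
  next
    case (Suc i')
    then show ?thesis
      using that t(2)[of i']
      by (simp add: sum.lessThan_Suc_shift b_def t'_def algebra_simps del: sum.lessThan_Suc)
  qed
  ultimately show ?case by (intro exI[of _ t'] conjI allI impI)
qed

lemma kexact_syzygy: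
  assumes ex: "kexact fs (Suc 0)" and s: "(\<Sum>k<length fs. \<sigma> k * fs ! k) = 0"
  obtains t where "\<And>i j. t i j = - t j i"
    "\<And>i. i < length fs \<Longrightarrow> \<sigma> i = (\<Sum>j<length fs. t i j * fs ! j)"
proof -
  let ?n = "length fs"
  \<comment> \<open>The chain of degree one with coefficients \<open>\<sigma>\<close>:
    \<open>kh k\<close> moves the unit chain to the \<open>k\<close>-th basis element. Being a cycle
    is exactly the relation \<open>s\<close>.\<close>
  define w where "w = (\<lambda>l. \<Sum>k<?n. \<sigma> k * kh k (kone ?n) l)"
  have "khom ?n (Suc 0) w" "kd fs w = (\<lambda>_. 0)"
    using kd_homotopy_cycle[OF khom_kone kd_khom_0[OF khom_kone], where fs=fs and c=\<sigma>]
    unfolding w_def s by simp_all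
  then obtain v where v: "kd fs v = w" using ex unfolding kexact_def by blast
  have w: "w ((fvec ?n)[i := True]) = \<sigma> i" if "i < ?n" for i
  proof -
    have "w ((fvec ?n)[i := True]) = (\<Sum>k<?n. if k = i then \<sigma> k else 0)"
      unfolding w_def by (rule sum.cong) (use that in \<open>auto simp: kh_kone\<close>)
    then show ?thesis using that by simp
  qed
  obtain t where t: "\<forall>i j. t i j = - t j i"
    "\<forall>i<?n. kd fs v ((fvec ?n)[i := True]) = (\<Sum>j<?n. t i j * fs ! j)"
    using kd_antisym[of fs v] by blast
  show thesis
  proof (rule that)
    show "t i j = - t j i" for i j using t(1) by blast
    show "\<sigma> i = (\<Sum>j<?n. t i j * fs ! j)" if "i < ?n" for i
      using t(2) w[OF that] that v by simp
  qed
qed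

section \<open>Polynomials\<close>

abbreviation coef :: "('a \<Rightarrow>\<^sub>0 'b::zero) \<Rightarrow> 'a \<Rightarrow> 'b" where
  "coef \<equiv> Poly_Mapping.lookup"

abbreviation xmon :: "('i \<Rightarrow>\<^sub>0 nat) \<Rightarrow> ('i, complex) mpol" where
  "xmon \<alpha> \<equiv> Poly_Mapping.single \<alpha> 1"

abbreviation ee :: "'i \<Rightarrow> 'i \<Rightarrow>\<^sub>0 nat" where
  "ee u \<equiv> Poly_Mapping.single u 1"

lemma Cst_add: "Cst (a + b) = Cst a + Cst b"
  and Cst_minus: "Cst (- c) = - Cst (c :: 'c :: ab_group_add)"
  and Cst_0 [simp]: "Cst 0 = 0"
  by (simp_all add: Cst_def single_add single_uminus)

lemma Cst_1 [simp]: "Cst 1 = 1"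
  by (simp add: Cst_def)

lemma Cst_mult: "Cst (a * b) = Cst a * (Cst b :: ('i, 'c::comm_ring_1) mpol)"
  by (simp add: Cst_def Poly_Mapping.mult_single)

lemma Cst_sum: "Cst (sum f A) = (\<Sum>x\<in>A. Cst (f x :: 'c :: comm_ring_1))"
  by (induction A rule: infinite_finite_induct) (auto simp: Cst_add)

lemma Cst_power: "Cst (a ^ k) = (Cst a :: ('i, 'c::comm_ring_1) mpol) ^ k"
  by (induction k) (auto simp: Cst_mult)

lemma Cst_of_nat: "Cst (of_nat k :: 'c::comm_ring_1) = of_nat k"
  by (induction k) (auto simp: Cst_add)

lemma coef_Cst_mult: "coef (Cst c * p) \<alpha> = (c :: 'c :: comm_ring_1) * coef p \<alpha>"
proof -
  have "Cst c * p = Poly_Mapping.map ((*) c) p"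
    by (simp add: Cst_def mult_map_scale_conv_mult)
  then show ?thesis by (simp add: Poly_Mapping.map.rep_eq when_def)
qed

lemma mpol_expand: "p = (\<Sum>\<alpha>\<in>Poly_Mapping.keys p. Poly_Mapping.single \<alpha> (coef p \<alpha>))"
proof (rule poly_mapping_eqI)
  fix \<beta>
  show "coef p \<beta> = coef (\<Sum>\<alpha>\<in>Poly_Mapping.keys p. Poly_Mapping.single \<alpha> (coef p \<alpha>)) \<beta>"
    by (auto simp: lookup_sum lookup_single when_def in_keys_iff)
qed

lemma mpol_expand_finite:
  "finite K \<Longrightarrow> Poly_Mapping.keys p \<subseteq> K \<Longrightarrow> p = (\<Sum>\<alpha>\<in>K. Poly_Mapping.single \<alpha> (coef p \<alpha>))"
  by (subst mpol_expand, rule sum.mono_neutral_left) (auto simp: in_keys_iff)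

lemma mpol_single_induct [case_names single add]:
  assumes "\<And>\<alpha> c. P (Poly_Mapping.single \<alpha> c)" "\<And>p q. P p \<Longrightarrow> P q \<Longrightarrow> P (p + q)"
  shows "P (p :: ('i, 'c::comm_monoid_add) mpol)"
proof -
  have "P (\<Sum>\<alpha>\<in>A. Poly_Mapping.single \<alpha> (coef p \<alpha>))" for A
  proof (induction A rule: infinite_finite_induct)
    case (insert x F)
    then show ?case by (simp add: assms)
  qed (use assms(1)[of 0 0] in \<open>simp_all add: single_zero\<close>)
  then show ?thesis by (subst mpol_expand)
qed

lemma mdeg_add: "mdeg (\<alpha> + \<beta>) = mdeg \<alpha> + mdeg \<beta>"
  by (simp add: mdeg_def lookup_add sum.distrib)

lemma mdeg_0 [simp]: "mdeg 0 = 0"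
  by (simp add: mdeg_def)

lemma mdeg_single [simp]: "mdeg (Poly_Mapping.single u k) = k"
  by (simp add: mdeg_def lookup_single when_def)

lemma mdeg_eq_0_iff: "mdeg \<alpha> = 0 \<longleftrightarrow> \<alpha> = 0"
  by (auto simp: mdeg_def poly_mapping_eq_iff fun_eq_iff)

lemma expo_split:
  assumes "coef \<alpha> u > 0"
  shows "\<alpha> = ee u + (\<alpha> - ee u)"
  using assms by (intro poly_mapping_eqI) (auto simp: lookup_add lookup_minus lookup_single when_def)

lemma Var_single: "Var u * Poly_Mapping.single \<alpha> c = Poly_Mapping.single (ee u + \<alpha>) (c :: 'c::comm_ring_1)"
  by (simp add: Var_def Poly_Mapping.mult_single)

text \<open>Suited to statements in which multiplication by a variable is again a known operation,
  such as one more derivative of a solution or a reduction modulo an ideal.\<close>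

lemma mpol_Var_induct [case_names Cst add Var]:
  fixes p :: "('i::finite, 'c::comm_ring_1) mpol"
  assumes "\<And>c. P (Cst c)" "\<And>p q. P p \<Longrightarrow> P q \<Longrightarrow> P (p + q)" "\<And>p u. P p \<Longrightarrow> P (Var u * p)"
  shows "P p"
proof (induction p rule: mpol_single_induct)
  case (single \<alpha> c)
  show ?case
  proof (induction "mdeg \<alpha>" arbitrary: \<alpha>)
    case 0
    then show ?case using assms(1)[of c] by (simp add: mdeg_eq_0_iff Cst_def)
  next
    case (Suc k)
    then obtain u where u: "coef \<alpha> u > 0"
      by (metis mdeg_eq_0_iff lookup_zero poly_mapping_eqI gr0I nat.distinct(1))
    have "mdeg \<alpha> = 1 + mdeg (\<alpha> - ee u)"
      by (subst expo_split[OF u]) (simp add: mdeg_add)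
    then have "P (Poly_Mapping.single (\<alpha> - ee u) c)" using Suc by simp
    then have "P (Var u * Poly_Mapping.single (\<alpha> - ee u) c)" by (rule assms(3))
    then show ?case unfolding Var_single using expo_split[OF u] by simp
  qed
qed (rule assms(2))

text \<open>The subtraction \<open>\<beta> - ee u\<close> is truncated, but the exponents where the
  truncation bites carry the factor zero.\<close>

lemma coef_pderivx:
  "coef (pderivx u p) \<alpha> = of_nat (Suc (coef \<alpha> u)) * coef p (\<alpha> + ee u)"
proof -
  have "coef (pderivx u p) \<alpha> = (\<Sum>\<beta>\<in>Poly_Mapping.keys p.
      (of_nat (coef \<beta> u) * coef p \<beta> when \<beta> - ee u = \<alpha>))"
    by (simp add: pderivx_def lookup_sum lookup_single)
  also have "\<dots> = (\<Sum>\<beta>\<in>Poly_Mapping.keys p.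
      (if \<beta> = \<alpha> + ee u then of_nat (coef \<beta> u) * coef p \<beta> else 0))"
  proof (rule sum.cong[OF refl])
    fix \<beta>
    show "(of_nat (coef \<beta> u) * coef p \<beta> when \<beta> - ee u = \<alpha>) =
        (if \<beta> = \<alpha> + ee u then of_nat (coef \<beta> u) * coef p \<beta> else 0)"
      using expo_split[of \<beta> u]
      by (cases "coef \<beta> u = 0") (auto simp: when_def lookup_add add.commute)
  qed
  also have "\<dots> = of_nat (Suc (coef \<alpha> u)) * coef p (\<alpha> + ee u)"
    by (auto simp: in_keys_iff lookup_add)
  finally show ?thesis .
qed

lemma pderivx_add: "pderivx u (p + q) = pderivx u p + pderivx u q"
  by (rule poly_mapping_eqI) (simp add: coef_pderivx lookup_add algebra_simps)

lemma pderivx_0 [simp]: "pderivx u 0 = 0"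
  by (rule poly_mapping_eqI) (simp add: coef_pderivx)

lemma pderivx_Cst_mult: "pderivx u (Cst c * p) = Cst (c :: 'c :: comm_ring_1) * pderivx u p"
  by (rule poly_mapping_eqI) (simp add: coef_pderivx coef_Cst_mult mult.left_commute del: of_nat_Suc)

lemma pderivx_minus: "pderivx u (- p) = - pderivx u (p :: ('i, 'c :: comm_ring_1) mpol)"
  by (rule poly_mapping_eqI) (simp add: coef_pderivx)

lemma pderivx_commute: "pderivx u (pderivx v p) = pderivx v (pderivx u p)"
  by (rule poly_mapping_eqI)
    (cases "u = v", simp_all add: coef_pderivx lookup_add lookup_single add_ac mult_ac)

lemma pderivx_single:
  "pderivx u (Poly_Mapping.single \<alpha> c) = Poly_Mapping.single (\<alpha> - ee u) (of_nat (coef \<alpha> u) * c)"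
  by (cases "c = 0") (simp_all add: pderivx_def)

lemma pderivx_mult:
  "pderivx u (p * q) = pderivx u p * q + p * pderivx u (q :: ('i, 'c :: comm_ring_1) mpol)"
proof (induction p rule: mpol_single_induct)
  case (single \<alpha> c)
  show ?case
  proof (induction q rule: mpol_single_induct)
    case (single \<beta> d)
    have 1: "\<alpha> + \<beta> - ee u = (\<alpha> - ee u) + \<beta>" if "coef \<alpha> u > 0"
      using that by (intro poly_mapping_eqI) (auto simp: lookup_add lookup_minus lookup_single when_def)
    have 2: "\<alpha> + \<beta> - ee u = \<alpha> + (\<beta> - ee u)" if "coef \<beta> u > 0"
      using that by (intro poly_mapping_eqI) (auto simp: lookup_add lookup_minus lookup_single when_def)
    show ?case
      using 1 2 by (cases "coef \<alpha> u = 0"; cases "coef \<beta> u = 0")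
        (auto simp: pderivx_single Poly_Mapping.mult_single lookup_add algebra_simps simp flip: single_add)
  qed (simp add: pderivx_add distrib_left add_ac)
qed (simp add: pderivx_add distrib_right add_ac)

lemma mpol_eq_minus_self: "p = - p \<Longrightarrow> p = (0 :: ('i, complex) mpol)"
proof (rule poly_mapping_eqI)
  fix \<alpha> assume "p = - p"
  then have "coef p \<alpha> = - coef p \<alpha>" by (metis lookup_uminus)
  then show "coef p \<alpha> = coef 0 \<alpha>" by simp
qed

lemma pderivx_Cst [simp]: "pderivx u (Cst c) = 0"
  by (simp add: Cst_def pderivx_single)

lemma pderivx_Var: "pderivx u (Var v) = (if u = v then 1 else (0 :: ('i, 'c :: comm_ring_1) mpol))"
  by (auto simp: Var_def pderivx_single lookup_single when_def)

section \<open>Substitution and evaluation\<close>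

lemma subst_superset:
  assumes "\<phi> 0 = 0" "finite K" "Poly_Mapping.keys p \<subseteq> K"
  shows "subst \<phi> g p = (\<Sum>\<alpha>\<in>K. \<phi> (coef p \<alpha>) * (\<Prod>i\<in>UNIV. g i ^ coef \<alpha> i))"
  unfolding subst_def by (rule sum.mono_neutral_left) (use assms in \<open>auto simp: in_keys_iff\<close>)

lemma subst_add:
  assumes "\<phi> 0 = 0" "\<And>a b. \<phi> (a + b) = \<phi> a + \<phi> b"
  shows "subst \<phi> g (p + q) = subst \<phi> g p + subst \<phi> g q"
proof -
  let ?K = "Poly_Mapping.keys p \<union> Poly_Mapping.keys q"
  have "Poly_Mapping.keys (p + q) \<subseteq> ?K" by (rule Poly_Mapping.keys_add)
  then show ?thesis
    using subst_superset[of \<phi> ?K p g] subst_superset[of \<phi> ?K q g]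
      subst_superset[of \<phi> ?K "p + q" g] assms(1)
    by (simp add: lookup_add assms(2) distrib_right sum.distrib)
qed

lemma subst_single:
  "\<phi> 0 = 0 \<Longrightarrow> subst \<phi> g (Poly_Mapping.single \<alpha> c) = \<phi> c * (\<Prod>i\<in>UNIV. g i ^ coef \<alpha> i)"
  by (cases "c = 0") (simp_all add: subst_def)

lemma subst_mult:
  assumes "\<phi> 0 = 0" "\<And>a b. \<phi> (a + b) = \<phi> a + \<phi> b" "\<And>a b. \<phi> (a * b) = \<phi> a * \<phi> b"
  shows "subst \<phi> g (p * q) = subst \<phi> g p * subst \<phi> g (q :: ('i::finite, 'c::comm_ring_1) mpol)"
proof (induction p rule: mpol_single_induct)
  case (single \<alpha> c)
  show ?case
  proof (induction q rule: mpol_single_induct)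
    case (single \<beta> d)
    show ?case
      by (simp add: Poly_Mapping.mult_single subst_single assms lookup_add power_add prod.distrib mult_ac)
  qed (simp add: subst_add[OF assms(1,2)] distrib_left)
qed (simp add: subst_add[OF assms(1,2)] distrib_right)

lemma eval_add: "eval (p + q) b = eval p b + eval q b"
  and eval_mult: "eval (p * q) b = eval p b * eval q b"
  unfolding eval_def by (rule subst_add subst_mult; simp)+

lemma eval_single: "eval (Poly_Mapping.single \<alpha> c) b = c * (\<Prod>i\<in>UNIV. (b $ i) ^ coef \<alpha> i)"
  by (simp add: eval_def subst_single)

lemma eval_Cst [simp]: "eval (Cst c) b = c"
  by (simp add: Cst_def eval_single)

lemma eval_0 [simp]: "eval 0 b = 0" and eval_1 [simp]: "eval 1 b = 1"
  using eval_Cst[of 0 b] eval_Cst[of 1 b] by simp_all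

lemma eval_minus: "eval (- p) b = - eval p b"
  using eval_add[of p "- p" b] by (simp add: eq_neg_iff_add_eq_0 add.commute)

lemma eval_diff: "eval (p - q) b = eval p b - eval q b"
  using eval_add[of p "- q" b] by (simp add: eval_minus)

lemma eval_sum: "eval (sum f A) b = (\<Sum>x\<in>A. eval (f x) b)"
  by (induction A rule: infinite_finite_induct) (auto simp: eval_add)

lemma eval_power: "eval (p ^ k) b = eval p b ^ k"
  by (induction k) (auto simp: eval_mult)

lemma eval_Var [simp]: "eval (Var u) b = b $ u"
proof -
  have "(\<Prod>i\<in>UNIV. (b $ i) ^ coef (ee u) i) = (\<Prod>i\<in>UNIV. if i = u then b $ i else 1)"
    by (rule prod.cong) (auto simp: lookup_single when_def)
  then show ?thesis by (simp add: Var_def eval_single)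
qed

lemma to_R_add: "to_R (p + q) = to_R p + to_R q"
  and to_R_mult: "to_R (p * q) = to_R p * to_R q"
  unfolding to_R_def by (rule subst_add subst_mult; simp add: Cst_add Cst_mult)+

lemma to_R_Cst [simp]: "to_R (Cst c) = Cst c"
  by (simp add: to_R_def Cst_def[where 'i="'a dmon"] subst_single)

lemma to_R_Var [simp]: "to_R (Var i) = avee i"
proof -
  have "(\<Prod>j\<in>UNIV. avee j ^ coef (ee i) j) = (\<Prod>j\<in>UNIV. if j = i then avee j else 1)"
    by (rule prod.cong) (auto simp: lookup_single when_def)
  then show ?thesis by (simp add: to_R_def Var_def subst_single)
qed

text \<open>A set of admissible degrees covers homogeneity, degree bounds and membership in
  \<open>R\<close> by one notion.\<close>

definition degs :: "nat set \<Rightarrow> ('i::finite, 'c::zero) mpol \<Rightarrow> bool" where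
  "degs A p \<longleftrightarrow> (\<forall>\<alpha>. coef p \<alpha> \<noteq> 0 \<longrightarrow> mdeg \<alpha> \<in> A)"

lemma degs_0 [simp]: "degs A 0"
  by (simp add: degs_def)

lemma degs_mono: "degs A p \<Longrightarrow> A \<subseteq> B \<Longrightarrow> degs B p"
  by (auto simp: degs_def)

lemma degs_empty: "degs {} p \<Longrightarrow> p = 0"
  by (auto simp: degs_def intro: poly_mapping_eqI)

lemma degs_add: "degs A p \<Longrightarrow> degs A q \<Longrightarrow> degs A (p + q)"
  unfolding degs_def lookup_add by (metis add_0)

lemma degs_minus: "degs A p \<Longrightarrow> degs A (- (p :: ('i::finite, 'c::ab_group_add) mpol))"
  by (simp add: degs_def)

lemma degs_diff: "degs A p \<Longrightarrow> degs A q \<Longrightarrow> degs A (p - (q :: ('i::finite, 'c::ab_group_add) mpol))"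
  using degs_add[of A p "- q"] degs_minus[of A q] by simp

lemma degs_sum: "(\<And>x. x \<in> X \<Longrightarrow> degs A (f x)) \<Longrightarrow> degs A (\<Sum>x\<in>X. f x)"
  by (induction X rule: infinite_finite_induct) (auto intro: degs_add)

lemma degs_single: "mdeg \<alpha> \<in> A \<Longrightarrow> degs A (Poly_Mapping.single \<alpha> c)"
  by (auto simp: degs_def lookup_single when_def)

lemma degs_Cst: "0 \<in> A \<Longrightarrow> degs A (Cst c)"
  by (simp add: Cst_def degs_single)

lemma degs_Cst_mult: "degs A p \<Longrightarrow> degs A (Cst c * (p :: ('i::finite, 'c::comm_ring_1) mpol))"
  unfolding degs_def coef_Cst_mult by (metis mult_zero_right)

lemma degs_mult:
  assumes "degs A p" "degs B q" "\<And>a b. a \<in> A \<Longrightarrow> b \<in> B \<Longrightarrow> a + b \<in> C"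
  shows "degs C (p * (q :: ('i::finite, 'c::comm_ring_1) mpol))"
  unfolding degs_def
proof (intro allI impI)
  fix \<alpha> assume "coef (p * q) \<alpha> \<noteq> 0"
  then have "\<alpha> \<in> Poly_Mapping.keys (p * q)" by (simp add: in_keys_iff)
  then obtain a b where "a \<in> Poly_Mapping.keys p" "b \<in> Poly_Mapping.keys q" "\<alpha> = a + b"
    using keys_mult[of p q] by blast
  then show "mdeg \<alpha> \<in> C" using assms by (auto simp: degs_def in_keys_iff mdeg_add)
qed

lemma degs_pderivx: "degs A p \<Longrightarrow> (\<And>k. Suc k \<in> A \<Longrightarrow> k \<in> B) \<Longrightarrow> degs B (pderivx u p)"
  unfolding degs_def coef_pderivx by (metis Suc_eq_plus1 mdeg_add mdeg_single mult_zero_right)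

lemma degs_induct [consumes 1, case_names zero single add]:
  fixes p :: "('i::finite, 'c::comm_monoid_add) mpol"
  assumes "degs A p" "P 0"
    "\<And>\<alpha> c. mdeg \<alpha> \<in> A \<Longrightarrow> P (Poly_Mapping.single \<alpha> c)" "\<And>p q. P p \<Longrightarrow> P q \<Longrightarrow> P (p + q)"
  shows "P p"
proof -
  have "P (\<Sum>\<alpha>\<in>X. Poly_Mapping.single \<alpha> (coef p \<alpha>))" if "\<And>\<alpha>. \<alpha> \<in> X \<Longrightarrow> mdeg \<alpha> \<in> A" for X
    using that by (induction X rule: infinite_finite_induct) (auto simp: assms)
  then show ?thesis using assms(1) by (subst mpol_expand) (auto simp: degs_def in_keys_iff)
qed

section \<open>Homogeneous components\<close>

lift_definition hcomp :: "nat \<Rightarrow> ('i::finite, 'c::zero) mpol \<Rightarrow> ('i, 'c) mpol" is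
  "\<lambda>k p \<alpha>. if mdeg \<alpha> = k then p \<alpha> else 0"
  by (rule finite_subset) auto

lemma coef_hcomp: "coef (hcomp k p) \<alpha> = (if mdeg \<alpha> = k then coef p \<alpha> else 0)"
  by transfer simp

lemma hcomp_add: "hcomp k (p + q) = hcomp k p + hcomp k q"
  by (rule poly_mapping_eqI) (simp add: coef_hcomp lookup_add)

lemma hcomp_minus: "hcomp k (- p) = - hcomp k (p :: ('i::finite, 'c::ab_group_add) mpol)"
  by (rule poly_mapping_eqI) (simp add: coef_hcomp)

lemma hcomp_diff: "hcomp k (p - q) = hcomp k p - hcomp k (q :: ('i::finite, 'c::ab_group_add) mpol)"
  by (rule poly_mapping_eqI) (simp add: coef_hcomp lookup_minus)

lemma hcomp_0 [simp]: "hcomp k 0 = 0"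
  by (rule poly_mapping_eqI) (simp add: coef_hcomp)

lemma hcomp_sum: "hcomp k (sum f A) = (\<Sum>x\<in>A. hcomp k (f x))"
  by (induction A rule: infinite_finite_induct) (auto simp: hcomp_add)

lemma degs_hcomp: "degs {k} (hcomp k p)"
  by (auto simp: degs_def coef_hcomp)

lemma hcomp_eq: "degs {k} p \<Longrightarrow> hcomp k p = p"
  by (rule poly_mapping_eqI) (auto simp: degs_def coef_hcomp)

lemma hcomp_eq_0: "degs A p \<Longrightarrow> k \<notin> A \<Longrightarrow> hcomp k p = 0"
  by (rule poly_mapping_eqI) (auto simp: degs_def coef_hcomp)

lemma hcomp_mult_homog:
  assumes "degs {m} q"
  shows "hcomp k (p * q) = (if m \<le> k then hcomp (k - m) p * q else (0 :: ('i::finite, 'c::comm_ring_1) mpol))"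
proof (induction p rule: mpol_single_induct)
  case (single \<alpha> c)
  have 1: "degs {mdeg \<alpha> + m} (Poly_Mapping.single \<alpha> c * q)"
    by (rule degs_mult[OF degs_single assms]) auto
  have 2: "hcomp (k - m) (Poly_Mapping.single \<alpha> c) =
      (if mdeg \<alpha> = k - m then Poly_Mapping.single \<alpha> c else 0)"
    by (rule poly_mapping_eqI) (auto simp: coef_hcomp lookup_single when_def)
  show ?case
    using hcomp_eq[OF 1] hcomp_eq_0[OF 1, of k] 2 by (cases "mdeg \<alpha> + m = k") auto
qed (auto simp: hcomp_add distrib_right)

lemma finite_mdeg: "finite {\<alpha> :: 'i::finite \<Rightarrow>\<^sub>0 nat. mdeg \<alpha> \<le> k}"
proof -
  let ?F = "{f :: 'i \<Rightarrow> nat. \<forall>u. f u \<in> {..k}}"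
  have fin: "finite ?F"
    using finite_PiE[of "UNIV :: 'i set" "\<lambda>_. {..k}"]
    by (simp add: PiE_def Pi_def extensional_def)
  have "coef ` {\<alpha> :: 'i \<Rightarrow>\<^sub>0 nat. mdeg \<alpha> \<le> k} \<subseteq> ?F"
  proof clarsimp
    fix \<alpha> :: "'i \<Rightarrow>\<^sub>0 nat" and u assume "mdeg \<alpha> \<le> k"
    moreover have "coef \<alpha> u \<le> mdeg \<alpha>" unfolding mdeg_def by (rule member_le_sum) auto
    ultimately show "coef \<alpha> u \<le> k" by simp
  qed
  then have "finite (coef ` {\<alpha> :: 'i \<Rightarrow>\<^sub>0 nat. mdeg \<alpha> \<le> k})" using fin by (rule finite_subset)
  then show ?thesis by (rule finite_imageD) (auto simp: inj_on_def poly_mapping_eqI)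
qed

lemma degs_bound_exists: "\<exists>N. degs {..N} p"
proof
  show "degs {..Max (insert 0 (mdeg ` Poly_Mapping.keys p))} p"
    by (auto simp: degs_def in_keys_iff intro!: Max_ge)
qed

lemma euler_identity:
  assumes "degs {k} p"
  shows "(\<Sum>u\<in>UNIV. Var u * pderivx u p) = of_nat k * (p :: ('i::finite, 'c::comm_ring_1) mpol)"
  using assms
proof (induction p rule: degs_induct)
  case (single \<alpha> c)
  have "Var u * pderivx u (Poly_Mapping.single \<alpha> c) = Poly_Mapping.single \<alpha> (of_nat (coef \<alpha> u) * c)" for u
    by (cases "coef \<alpha> u = 0") (use expo_split[of \<alpha> u] in \<open>auto simp: pderivx_single Var_single\<close>)
  then have "(\<Sum>u\<in>UNIV. Var u * pderivx u (Poly_Mapping.single \<alpha> c)) =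
      Poly_Mapping.single \<alpha> ((\<Sum>u\<in>UNIV. of_nat (coef \<alpha> u)) * c)"
    by (intro poly_mapping_eqI) (auto simp: lookup_sum lookup_single when_def sum_distrib_right)
  also have "(\<Sum>u\<in>UNIV. of_nat (coef \<alpha> u) :: 'c) = of_nat k"
    using single by (simp add: mdeg_def flip: of_nat_sum)
  also have "Poly_Mapping.single \<alpha> (of_nat k * c) = of_nat k * Poly_Mapping.single \<alpha> c"
    by (metis Cst_of_nat Cst_def Poly_Mapping.mult_single add_0)
  finally show ?case .
next
  case (add p q)
  then show ?case by (simp add: pderivx_add distrib_left sum.distrib)
qed simp

text \<open>Elimination of one coordinate at a time, for an indexed family, so that repeated vectors
  count as dependent.\<close>

lemma linear_system_nontrivial:
  fixes a :: "'j \<Rightarrow> 'k \<Rightarrow> 'c::field"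
  assumes "finite K" "finite F" "card K < card F"
  shows "\<exists>\<nu>. (\<exists>j\<in>F. \<nu> j \<noteq> 0) \<and> (\<forall>\<alpha>\<in>K. (\<Sum>j\<in>F. \<nu> j * a j \<alpha>) = 0)"
  using assms
proof (induction K arbitrary: F a rule: finite_induct)
  case empty
  then obtain j where "j \<in> F" by fastforce
  then show ?case by (intro exI[of _ "\<lambda>_. 1"]) auto
next
  case (insert \<beta> K)
  show ?case
  proof (cases "\<forall>j\<in>F. a j \<beta> = 0")
    case True
    have "card K < card F" using insert.prems(2) insert.hyps by simp
    then obtain \<nu> where "\<exists>j\<in>F. \<nu> j \<noteq> 0" "\<forall>\<alpha>\<in>K. (\<Sum>j\<in>F. \<nu> j * a j \<alpha>) = 0"
      using insert.IH[OF insert.prems(1), of a] by blast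
    then show ?thesis using True by (intro exI[of _ \<nu>]) simp
  next
    case False
    then obtain j0 where j0: "j0 \<in> F" "a j0 \<beta> \<noteq> 0" by blast
    define a' where "a' j \<alpha> = a j \<alpha> - a j \<beta> / a j0 \<beta> * a j0 \<alpha>" for j \<alpha>
    have "card K < card (F - {j0})" using insert.prems insert.hyps j0 by simp
    then obtain \<nu> where l: "\<exists>j\<in>F - {j0}. \<nu> j \<noteq> 0" "\<And>\<alpha>. \<alpha> \<in> K \<Longrightarrow> (\<Sum>j\<in>F - {j0}. \<nu> j * a' j \<alpha>) = 0"
      using insert.IH[of "F - {j0}" a'] insert.prems(1) by auto
    \<comment> \<open>The coefficient of the pivot vector that makes up for what was subtracted from
      the others.\<close>
    define \<mu> where "\<mu> = - (\<Sum>j\<in>F - {j0}. \<nu> j * a j \<beta> / a j0 \<beta>)"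
    have eq: "(\<Sum>j\<in>F. (\<nu>(j0 := \<mu>)) j * a j \<alpha>) = (\<Sum>j\<in>F - {j0}. \<nu> j * a' j \<alpha>)" for \<alpha>
    proof -
      have "(\<Sum>j\<in>F. (\<nu>(j0 := \<mu>)) j * a j \<alpha>) = \<mu> * a j0 \<alpha> + (\<Sum>j\<in>F - {j0}. \<nu> j * a j \<alpha>)"
        using sum.remove[OF insert.prems(1) j0(1), of "\<lambda>j. (\<nu>(j0 := \<mu>)) j * a j \<alpha>"] by simp
      then show ?thesis
        by (simp add: a'_def \<mu>_def right_diff_distrib sum_subtractf sum_distrib_right mult.assoc)
    qed
    have "a' j \<beta> = 0" for j using j0(2) by (simp add: a'_def)
    then have "\<forall>\<alpha>\<in>insert \<beta> K. (\<Sum>j\<in>F. (\<nu>(j0 := \<mu>)) j * a j \<alpha>) = 0"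
      unfolding eq using l(2) by auto
    moreover have "\<exists>j\<in>F. (\<nu>(j0 := \<mu>)) j \<noteq> 0" using l(1) by auto
    ultimately show ?thesis by (intro exI[of _ "\<nu>(j0 := \<mu>)"] conjI)
  qed
qed

section \<open>The Nullstellensatz\<close>

definition is_ideal :: "'a::comm_ring_1 set \<Rightarrow> bool" where
  "is_ideal I \<longleftrightarrow> 0 \<in> I \<and> (\<forall>p\<in>I. \<forall>q\<in>I. p + q \<in> I) \<and> (\<forall>p. \<forall>q\<in>I. p * q \<in> I)"

lemma is_idealD:
  assumes "is_ideal I"
  shows "0 \<in> I" "p \<in> I \<Longrightarrow> q \<in> I \<Longrightarrow> p + q \<in> I" "q \<in> I \<Longrightarrow> p * q \<in> I" "q \<in> I \<Longrightarrow> q * p \<in> I"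
    "q \<in> I \<Longrightarrow> - q \<in> I" "p \<in> I \<Longrightarrow> q \<in> I \<Longrightarrow> p - q \<in> I"
proof -
  show 1: "0 \<in> I" "\<And>p q. p \<in> I \<Longrightarrow> q \<in> I \<Longrightarrow> p + q \<in> I" "\<And>p q. q \<in> I \<Longrightarrow> p * q \<in> I"
    using assms by (auto simp: is_ideal_def)
  show "q \<in> I \<Longrightarrow> q * p \<in> I" using 1(3)[of q p] by (simp add: mult.commute)
  show 2: "- q \<in> I" if "q \<in> I" for q using 1(3)[of q "-1"] that by simp
  show "p \<in> I \<Longrightarrow> q \<in> I \<Longrightarrow> p - q \<in> I" using 1(2)[of p "- q"] 2 by simp
qed

lemma is_ideal_sum: "is_ideal I \<Longrightarrow> (\<And>x. x \<in> A \<Longrightarrow> f x \<in> I) \<Longrightarrow> (\<Sum>x\<in>A. f x) \<in> I"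
  by (induction A rule: infinite_finite_induct) (auto intro: is_idealD)

lemma is_ideal_adjoin:
  assumes "is_ideal I"
  shows "is_ideal {i + q * a | i q. i \<in> I}"
proof -
  note I = is_idealD[OF assms]
  have J: "i + q * a \<in> {i + q * a | i q. i \<in> I}" if "i \<in> I" for i q using that by blast
  show ?thesis
    unfolding is_ideal_def
  proof (intro conjI ballI allI)
    show "0 \<in> {i + q * a | i q. i \<in> I}" using J[OF I(1), of 0] by simp
    fix x y assume "y \<in> {i + q * a | i q. i \<in> I}"
    then obtain i q where y: "y = i + q * a" "i \<in> I" by blast
    show "x * y \<in> {i + q * a | i q. i \<in> I}"
      using J[OF I(3)[OF y(2), of x], of "x * q"] by (simp add: y(1) algebra_simps)
    assume "x \<in> {i + q * a | i q. i \<in> I}"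
    then obtain i' q' where x: "x = i' + q' * a" "i' \<in> I" by blast
    show "x + y \<in> {i + q * a | i q. i \<in> I}"
      using J[OF I(2)[OF x(2) y(2)], of "q' + q"] by (simp add: x(1) y(1) algebra_simps)
  qed
qed

lemma maximal_ideal_exists:
  assumes "is_ideal I" "1 \<notin> I"
  obtains M where "is_ideal M" "I \<subseteq> M" "1 \<notin> M" "\<And>a. a \<notin> M \<Longrightarrow> \<exists>q. q * a - 1 \<in> M"
proof -
  let ?A = "{J. is_ideal J \<and> I \<subseteq> J \<and> 1 \<notin> J}"
  have "\<exists>M\<in>?A. \<forall>X\<in>?A. M \<subseteq> X \<longrightarrow> X = M"
  proof (rule subset_Zorn_nonempty)
    show "?A \<noteq> {}" using assms by blast
    fix C assume C: "C \<noteq> {}" "subset.chain ?A C"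
    then have sub: "\<And>J. J \<in> C \<Longrightarrow> is_ideal J \<and> I \<subseteq> J \<and> 1 \<notin> J"
      and chain: "\<And>X Y. X \<in> C \<Longrightarrow> Y \<in> C \<Longrightarrow> X \<subseteq> Y \<or> Y \<subseteq> X"
      by (auto simp: subset.chain_def)
    have "is_ideal (\<Union>C)"
      unfolding is_ideal_def
    proof (intro conjI ballI allI)
      show "0 \<in> \<Union>C" using C(1) sub by (auto simp: is_ideal_def)
      show "p * q \<in> \<Union>C" if "q \<in> \<Union>C" for p q
        using that sub by (auto intro: is_idealD)
      fix p q assume "p \<in> \<Union>C" "q \<in> \<Union>C"
      then obtain X Y where "X \<in> C" "p \<in> X" "Y \<in> C" "q \<in> Y" by blast
      then show "p + q \<in> \<Union>C"
        using chain[of X Y] sub is_idealD(2)[of X p q] is_idealD(2)[of Y p q] by blast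
    qed
    then show "\<Union>C \<in> ?A" using C(1) sub by blast
  qed
  then obtain M where M: "is_ideal M" "I \<subseteq> M" "1 \<notin> M"
    and max: "\<And>X. is_ideal X \<Longrightarrow> I \<subseteq> X \<Longrightarrow> 1 \<notin> X \<Longrightarrow> M \<subseteq> X \<Longrightarrow> X = M" by auto
  show thesis
  proof (rule that[OF M])
    fix a assume a: "a \<notin> M"
    let ?X = "{i + q * a | i q. i \<in> M}"
    have "i \<in> ?X" if "i \<in> M" for i
      using that by (intro CollectI exI[of _ i] exI[of _ 0]) simp
    then have "M \<subseteq> ?X" by blast
    moreover have "a \<in> ?X"
      using is_idealD(1)[OF M(1)] by (intro CollectI exI[of _ 0] exI[of _ 1]) simp
    ultimately have "1 \<in> ?X"
      using max[OF is_ideal_adjoin[OF M(1), of a]] M(2) a by blast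
    then obtain i q where iq: "1 = i + q * a" "i \<in> M" by blast
    have "q * a - 1 = - i" by (subst iq(1)) simp
    then show "\<exists>q. q * a - 1 \<in> M"
      using is_idealD(5)[OF M(1) iq(2)] by (intro exI[of _ q]) simp
  qed
qed

definition poly_at :: "('i, complex) mpol \<Rightarrow> complex poly \<Rightarrow> ('i, complex) mpol" where
  "poly_at X g = poly (map_poly Cst g) X"

lemma poly_at_pCons: "poly_at X (pCons a g) = Cst a + X * poly_at X g"
  by (simp add: poly_at_def map_poly_pCons)

lemma poly_at_0 [simp]: "poly_at X 0 = 0"
  by (simp add: poly_at_def)

lemma poly_at_add: "poly_at X (g + h) = poly_at X g + poly_at X h"
  by (induction g h rule: poly_induct2) (auto simp: poly_at_pCons Cst_add algebra_simps)

lemma poly_at_smult: "poly_at X (Polynomial.smult c g) = Cst c * poly_at X g"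
  by (induction g) (auto simp: poly_at_pCons Cst_mult algebra_simps)

lemma poly_at_sum: "poly_at X (sum g A) = (\<Sum>x\<in>A. poly_at X (g x))"
  by (induction A rule: infinite_finite_induct) (auto simp: poly_at_add)

lemma poly_at_linear_mult: "poly_at X ([:- c, 1:] * g) = (X - Cst c) * poly_at X g"
proof -
  have "[:- c, 1:] * g = Polynomial.smult (- c) g + pCons 0 g" by simp
  then show ?thesis
    by (simp only: poly_at_add poly_at_smult poly_at_pCons) (simp add: Cst_minus algebra_simps)
qed

lemma poly_at_prod: "poly_at X (\<Prod>c\<in>A. [:- c, 1:]) = (\<Prod>c\<in>A. X - Cst c)"
proof (induction A rule: infinite_finite_induct)
  case (insert c A)
  then show ?case using poly_at_linear_mult[of X c "\<Prod>c\<in>A. [:- c, 1:]"] by simp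
qed (simp_all add: one_pCons poly_at_pCons)

text \<open>Algebraic closedness splits off one linear factor at a time. Primality puts that factor
  or its cofactor into \<open>M\<close>, and a nonzero constant cannot remain, being a unit.\<close>

lemma prime_ideal_linear_factor:
  assumes M: "is_ideal M" "1 \<notin> M" "\<And>p q. p * q \<in> M \<Longrightarrow> p \<in> M \<or> q \<in> M"
    and "g \<noteq> 0" "poly_at X g \<in> M"
  shows "\<exists>c. X - Cst c \<in> M"
  using assms(4,5)
proof (induction "degree g" arbitrary: g)
  case 0
  then obtain a where a: "g = [:a:]" "a \<noteq> 0" by (metis degree_eq_zeroE pCons_0_0)
  then have "Cst a \<in> M" using 0 by (simp add: poly_at_pCons)
  then have "Cst (1 / a) * Cst a \<in> M" by (rule is_idealD(3)[OF M(1)])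
  then show ?case using a M(2) by (simp flip: Cst_mult)
next
  case (Suc k)
  then obtain z where "poly g z = 0"
    using alg_closed_imp_poly_has_root[of g] by auto
  then obtain h where h: "g = [:- z, 1:] * h" by (auto simp: poly_eq_0_iff_dvd dvd_def)
  then have "h \<noteq> 0" using Suc.prems(1) by auto
  moreover have "k = degree h" using Suc.hyps(2) \<open>h \<noteq> 0\<close> unfolding h by (subst (asm) degree_mult_eq) auto
  moreover have "X - Cst z \<in> M \<or> poly_at X h \<in> M"
    using Suc.prems(2) M(3) unfolding h poly_at_linear_mult by blast
  ultimately show ?case using Suc.hyps(1) by blast
qed

text \<open>If no \<open>X - c\<close> lies in the maximal ideal, the inverses of the \<open>X - c\<close> modulo it form an
  uncountable family in a space of countable dimension; a linear relation between finitely many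
  of them yields a nonzero one-variable polynomial in the ideal.\<close>

lemma maximal_ideal_linear:
  fixes X :: "('i::finite, complex) mpol"
  assumes M: "is_ideal M" "1 \<notin> M" "\<And>a. a \<notin> M \<Longrightarrow> \<exists>q. q * a - 1 \<in> M"
  shows "\<exists>c. X - Cst c \<in> M"
proof (rule ccontr)
  note I = is_idealD[OF M(1)]
  assume neg: "\<nexists>c. X - Cst c \<in> M"
  have prime: "p \<in> M \<or> q \<in> M" if pq: "p * q \<in> M" for p q
  proof (rule ccontr)
    assume "\<not> (p \<in> M \<or> q \<in> M)"
    then obtain r where r: "r * p - 1 \<in> M" using M(3) by blast
    have "r * (p * q) - q * (r * p - 1) \<in> M" by (rule I(6)[OF I(3)[OF pq] I(3)[OF r]])
    then have "q \<in> M" by (simp add: algebra_simps)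
    then show False using \<open>\<not> (p \<in> M \<or> q \<in> M)\<close> by blast
  qed
  have "\<forall>c. \<exists>q. q * (X - Cst c) - 1 \<in> M" using neg M(3) by blast
  then obtain q where q: "\<And>c. q c * (X - Cst c) - 1 \<in> M" by (auto dest!: choice)
  have "\<forall>c. \<exists>N. degs {..N} (q c)" using degs_bound_exists by blast
  then obtain N where N: "\<And>c. degs {..N c} (q c)" by (auto dest!: choice)
  \<comment> \<open>Uncountably many \<open>c\<close> share countably many degree bounds; a common
    bound puts infinitely many inverses into one finite-dimensional space.\<close>
  have "\<exists>k. infinite {c. N c = k}"
  proof (rule ccontr)
    assume "\<not> (\<exists>k. infinite {c. N c = k})"
    then have "countable (\<Union>k. {c. N c = k})" by (intro countable_UN) (auto intro: countable_finite)
    moreover have "(\<Union>k. {c. N c = k}) = UNIV" by auto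
    ultimately show False using uncountable_UNIV_complex by simp
  qed
  then obtain k where k: "infinite {c. N c = k}" by blast
  let ?K = "{\<alpha> :: 'i \<Rightarrow>\<^sub>0 nat. mdeg \<alpha> \<le> k}"
  obtain F where F: "F \<subseteq> {c. N c = k}" "finite F" "card F = Suc (card ?K)"
    using infinite_arbitrarily_large[OF k] by blast
  obtain \<nu> c0 where c0: "c0 \<in> F" "\<nu> c0 \<noteq> 0"
    and l: "\<And>\<alpha>. \<alpha> \<in> ?K \<Longrightarrow> (\<Sum>c\<in>F. \<nu> c * coef (q c) \<alpha>) = 0"
    using linear_system_nontrivial[OF finite_mdeg F(2), of k "\<lambda>c. coef (q c)"] F(3) by auto
  have rel: "(\<Sum>c\<in>F. Cst (\<nu> c) * q c) = 0"
  proof (rule poly_mapping_eqI)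
    fix \<alpha>
    have "coef (q c) \<alpha> = 0" if "c \<in> F" "\<alpha> \<notin> ?K" for c
      using N[of c] F(1) that by (auto simp: degs_def)
    then show "coef (\<Sum>c\<in>F. Cst (\<nu> c) * q c) \<alpha> = coef 0 \<alpha>"
      using l[of \<alpha>] by (cases "\<alpha> \<in> ?K") (simp_all add: lookup_sum coef_Cst_mult)
  qed
  define P where "P = (\<lambda>c. \<Prod>c'\<in>F - {c}. X - Cst c')"
  have "(\<Prod>c\<in>F. X - Cst c) = (X - Cst c) * P c" if "c \<in> F" for c
    unfolding P_def using F(2) that by (simp add: prod.remove)
  \<comment> \<open>Multiplying the relation by all \<open>X - Cst c\<close> and using that
    \<open>q c\<close> inverts \<open>X - Cst c\<close> modulo \<open>M\<close> leaves a polynomial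
    in \<open>X\<close> alone.\<close>
  then have "(\<Sum>c\<in>F. Cst (\<nu> c) * q c) * (\<Prod>c\<in>F. X - Cst c) = (\<Sum>c\<in>F. Cst (\<nu> c) * q c * ((X - Cst c) * P c))"
    by (simp add: sum_distrib_right)
  then have "(\<Sum>c\<in>F. Cst (\<nu> c) * P c) = - (\<Sum>c\<in>F. (Cst (\<nu> c) * P c) * (q c * (X - Cst c) - 1))"
    unfolding rel by (simp add: algebra_simps sum_subtractf)
  also have "\<dots> \<in> M" by (intro I(5) is_ideal_sum[OF M(1)] I(3) q)
  finally have "(\<Sum>c\<in>F. Cst (\<nu> c) * P c) \<in> M" .
  define g where "g = (\<Sum>c\<in>F. Polynomial.smult (\<nu> c) (\<Prod>c'\<in>F - {c}. [:- c', 1:]))"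
  have "poly_at X g \<in> M"
    unfolding g_def poly_at_sum poly_at_smult poly_at_prod
    using \<open>(\<Sum>c\<in>F. Cst (\<nu> c) * P c) \<in> M\<close> by (simp add: P_def)
  \<comment> \<open>As in Lagrange interpolation, only the summand of \<open>c0\<close> survives at
    \<open>c0\<close>.\<close>
  moreover have "poly g c0 \<noteq> 0"
  proof -
    have "poly g c0 = (\<Sum>c\<in>F. if c = c0 then \<nu> c * (\<Prod>c'\<in>F - {c}. c0 - c') else 0)"
      unfolding g_def poly_sum
    proof (rule sum.cong[OF refl])
      fix c assume "c \<in> F"
      show "poly (Polynomial.smult (\<nu> c) (\<Prod>c'\<in>F - {c}. [:- c', 1:])) c0 =
          (if c = c0 then \<nu> c * (\<Prod>c'\<in>F - {c}. c0 - c') else 0)"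
        using F(2) c0(1) by (auto simp: poly_prod intro!: prod_zero)
    qed
    also have "\<dots> = \<nu> c0 * (\<Prod>c'\<in>F - {c0}. c0 - c')" using F(2) c0(1) by simp
    also have "\<dots> \<noteq> 0" using F(2) c0 by auto
    finally show ?thesis .
  qed
  ultimately have "\<exists>c. X - Cst c \<in> M"
    by (intro prime_ideal_linear_factor[OF M(1,2) prime]) auto
  then show False using neg by blast
qed

text \<open>The variables are congruent to constants modulo a maximal ideal containing
  \<open>I\<close>; these constants are the coordinates of the common zero.\<close>

theorem weak_nullstellensatz:
  fixes I :: "('n::finite, complex) mpol set"
  assumes "is_ideal I" "1 \<notin> I"
  obtains c :: "complex ^ 'n" where "\<And>p. p \<in> I \<Longrightarrow> eval p c = 0"
proof -
  obtain M where M: "is_ideal M" "I \<subseteq> M" "1 \<notin> M" "\<And>a. a \<notin> M \<Longrightarrow> \<exists>q. q * a - 1 \<in> M"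
    using maximal_ideal_exists[OF assms] by blast
  note ID = is_idealD[OF M(1)]
  have "\<exists>c. Var u - Cst c \<in> M" for u by (rule maximal_ideal_linear[OF M(1,3,4)])
  then obtain c where c: "\<And>u. Var u - Cst (c u) \<in> M" by metis
  define x :: "complex ^ 'n" where "x = (\<chi> u. c u)"
  have red: "p - Cst (eval p x) \<in> M" for p
  proof (induction p rule: mpol_Var_induct)
    case (Cst c)
    then show ?case using ID(1) by simp
  next
    case (add p q)
    then show ?case using ID(2)[of "p - Cst (eval p x)" "q - Cst (eval q x)"]
      by (simp add: eval_add Cst_add algebra_simps)
  next
    case (Var p u)
    have "Var u * (p - Cst (eval p x)) + Cst (eval p x) * (Var u - Cst (c u)) \<in> M"
      by (intro ID(2,3) Var c)
    then show ?case by (simp add: eval_mult Cst_mult x_def algebra_simps)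
  qed
  show thesis
  proof (rule that[of x], rule ccontr)
    fix p assume "p \<in> I" and nz: "eval p x \<noteq> 0"
    then have "p \<in> M" using M(2) by blast
    then have "p - (p - Cst (eval p x)) \<in> M" using red by (rule ID(6))
    then have "Cst (1 / eval p x) * Cst (eval p x) \<in> M" by (intro ID(3)) simp
    then show False using M(3) nz by (simp flip: Cst_mult)
  qed
qed

text \<open>The ideal of a family over a finite index type; \<open>lideal\<close> is the counterpart
  for lists, whose positions index the Koszul complex.\<close>

definition ispan :: "('u::finite \<Rightarrow> 'a::comm_ring_1) \<Rightarrow> 'a set" where
  "ispan f = {p. \<exists>c. p = (\<Sum>u\<in>UNIV. c u * f u)}"

lemma ispanI: "p = (\<Sum>u\<in>UNIV. c u * f u) \<Longrightarrow> p \<in> ispan f"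
  unfolding ispan_def by blast

lemma ispanE:
  assumes "p \<in> ispan f"
  obtains c where "p = (\<Sum>u\<in>UNIV. c u * f u)"
  using assms unfolding ispan_def by blast

lemma is_ideal_ispan: "is_ideal (ispan f)"
  unfolding is_ideal_def
proof (intro conjI ballI allI)
  show "0 \<in> ispan f" by (rule ispanI[where c="\<lambda>_. 0"]) simp
  show "p + q \<in> ispan f" if p: "p \<in> ispan f" and q: "q \<in> ispan f" for p q
  proof -
    obtain c where "p = (\<Sum>u\<in>UNIV. c u * f u)" using p by (rule ispanE)
    moreover obtain c' where "q = (\<Sum>u\<in>UNIV. c' u * f u)" using q by (rule ispanE)
    ultimately show ?thesis
      by (intro ispanI[where c="\<lambda>u. c u + c' u"]) (simp add: distrib_right sum.distrib)
  qed
  show "p * q \<in> ispan f" if q: "q \<in> ispan f" for p q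
  proof -
    obtain c where "q = (\<Sum>u\<in>UNIV. c u * f u)" using q by (rule ispanE)
    then show ?thesis
      by (intro ispanI[where c="\<lambda>u. p * c u"]) (simp add: sum_distrib_left mult.assoc)
  qed
qed

lemma ispan_generator: "f u \<in> ispan f"
proof -
  have "f u = (\<Sum>v\<in>UNIV. (if v = u then 1 else 0) * f v)"
    by (simp add: if_distrib[of "\<lambda>x. x * _"] cong: if_cong)
  then show ?thesis by (rule ispanI)
qed

lemma hcomp_ispan:
  assumes "\<And>u. degs {m} (f u)" "p \<in> ispan f"
  shows "hcomp k p \<in> ispan (f :: 'u::finite \<Rightarrow> ('i::finite, 'c::comm_ring_1) mpol)"
proof -
  obtain c where "p = (\<Sum>u\<in>UNIV. c u * f u)" using assms(2) by (rule ispanE)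
  then have "hcomp k p = (\<Sum>u\<in>UNIV. (if m \<le> k then hcomp (k - m) (c u) else 0) * f u)"
    by (cases "m \<le> k") (simp_all add: hcomp_sum hcomp_mult_homog[OF assms(1)])
  then show ?thesis by (rule ispanI)
qed

text \<open>Nullstellensatz for \<open>f\<close> and \<open>x\<^sub>u - 1\<close> makes \<open>x\<^sub>u - 1\<close> invertible modulo \<open>f\<close>; the homogeneous
  components of its inverse are \<open>- x\<^sub>u\<^sup>k\<close>, and almost all of them vanish.\<close>

theorem homogeneous_nullstellensatz:
  fixes f :: "'u::finite \<Rightarrow> ('n::finite, complex) mpol"
  assumes hom: "\<And>u. degs {m} (f u)"
    and nz: "\<And>x. (\<And>u. eval (f u) x = 0) \<Longrightarrow> x = 0"
  shows "\<exists>N. \<forall>k\<ge>N. Var v ^ k \<in> ispan f"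
proof -
  note I = is_idealD[OF is_ideal_ispan[of f]]
  let ?J = "{i + q * (Var v - 1) | i q. i \<in> ispan f}"
  have J: "is_ideal ?J" by (rule is_ideal_adjoin[OF is_ideal_ispan])
  have "1 \<in> ?J"
  proof (rule ccontr)
    assume "1 \<notin> ?J"
    then obtain x where x: "\<And>p. p \<in> ?J \<Longrightarrow> eval p x = 0" using weak_nullstellensatz[OF J] by blast
    have "f u \<in> ?J" for u
      using ispan_generator[of f u] by (intro CollectI exI[of _ "f u"] exI[of _ 0]) simp
    then have "x = 0" using nz x by blast
    moreover have "Var v - 1 \<in> ?J" using I(1) by (intro CollectI exI[of _ 0] exI[of _ 1]) simp
    then have "x $ v = 1" using x[of "Var v - 1"] by (simp add: eval_diff)
    ultimately show False by simp
  qed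
  then obtain i q where i: "i \<in> ispan f" and one: "1 = i + q * (Var v - 1)" by blast
  have Var1: "degs {1} (Var v :: ('n, complex) mpol)" unfolding Var_def by (rule degs_single) simp
  \<comment> \<open>Comparing components in \<open>one\<close>, with \<open>ispan f\<close>
    homogeneous, shows that modulo \<open>ispan f\<close> the component \<open>hcomp 0 q\<close> is
    \<open>- 1\<close> and each further one is \<open>Var v\<close> times its predecessor.\<close>
  have "hcomp k q + Var v ^ k \<in> ispan f" for k
  proof (induction k)
    case 0
    have "hcomp 0 1 = hcomp 0 i + hcomp 0 (q * Var v) - hcomp 0 q"
      by (subst one) (simp add: right_diff_distrib hcomp_add hcomp_diff)
    moreover have "hcomp 0 (1 :: ('n, complex) mpol) = 1"
      using degs_Cst[of "{0}" "1::complex"] by (intro hcomp_eq) simp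
    ultimately have "hcomp 0 q + 1 = hcomp 0 i" by (simp add: hcomp_mult_homog[OF Var1] algebra_simps)
    then show ?case using hcomp_ispan[OF hom i, of 0] by simp
  next
    case (Suc k)
    have "hcomp (Suc k) 1 = hcomp (Suc k) i + hcomp (Suc k) (q * Var v) - hcomp (Suc k) q"
      by (subst one) (simp add: right_diff_distrib hcomp_add hcomp_diff)
    moreover have "hcomp (Suc k) (1 :: ('n, complex) mpol) = 0"
      using degs_Cst[of "{0}" "1::complex"] by (intro hcomp_eq_0[of "{0}"]) simp_all
    ultimately have "hcomp (Suc k) q = hcomp (Suc k) i + hcomp k q * Var v"
      by (simp add: hcomp_mult_homog[OF Var1] algebra_simps)
    then have "hcomp (Suc k) q + Var v ^ Suc k = hcomp (Suc k) i + Var v * (hcomp k q + Var v ^ k)"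
      by (simp add: algebra_simps)
    then show ?case using I(2)[OF hcomp_ispan[OF hom i, of "Suc k"] I(3)[OF Suc, of "Var v"]] by simp
  qed
  moreover obtain N where "degs {..N} q" using degs_bound_exists by blast
  then have "hcomp k q = 0" if "k \<ge> Suc N" for k
    by (rule hcomp_eq_0) (use that in auto)
  ultimately have "\<forall>k\<ge>Suc N. Var v ^ k \<in> ispan f" by (metis add_0)
  then show ?thesis by blast
qed

section \<open>Koszul complexes of powers of variables and of forms without common zero\<close>

lemma coef_mono_mult:
  fixes p :: "('i::finite, 'c::comm_ring_1) mpol"
  shows "coef (Poly_Mapping.single (Poly_Mapping.single v N) 1 * p) \<alpha> =
    (if N \<le> coef \<alpha> v then coef p (\<alpha> - Poly_Mapping.single v N) else 0)"
proof (induction p rule: mpol_single_induct)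
  case (single \<beta> c)
  have 1: "Poly_Mapping.single v N + \<beta> = \<alpha> \<longleftrightarrow> N \<le> coef \<alpha> v \<and> \<beta> = \<alpha> - Poly_Mapping.single v N"
    by (auto simp: poly_mapping_eq_iff fun_eq_iff lookup_add lookup_minus lookup_single when_def)
  show ?case by (auto simp: Poly_Mapping.mult_single lookup_single when_def 1)
qed (simp add: lookup_add distrib_left)

lemma Var_power: "(Var v :: ('i, 'c::comm_ring_1) mpol) ^ N = Poly_Mapping.single (Poly_Mapping.single v N) 1"
  by (induction N) (auto simp: Var_single simp flip: single_add)

lemma is_ideal_lideal: "is_ideal (lideal fs)"
  unfolding is_ideal_def lideal_def
proof (intro conjI ballI allI)
  show "0 \<in> {p. \<exists>c. p = (\<Sum>k<length fs. c k * fs ! k)}"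
    by (intro CollectI exI[of _ "\<lambda>_. 0"]) simp
  fix x y assume "y \<in> {p. \<exists>c. p = (\<Sum>k<length fs. c k * fs ! k)}"
  then obtain c where y: "y = (\<Sum>k<length fs. c k * fs ! k)" by blast
  show "x * y \<in> {p. \<exists>c. p = (\<Sum>k<length fs. c k * fs ! k)}"
    by (intro CollectI exI[of _ "\<lambda>k. x * c k"]) (simp add: y sum_distrib_left mult.assoc)
  assume "x \<in> {p. \<exists>c. p = (\<Sum>k<length fs. c k * fs ! k)}"
  then obtain c' where x: "x = (\<Sum>k<length fs. c' k * fs ! k)" by blast
  show "x + y \<in> {p. \<exists>c. p = (\<Sum>k<length fs. c k * fs ! k)}"
    by (intro CollectI exI[of _ "\<lambda>k. c' k + c k"]) (simp add: x y distrib_right sum.distrib)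
qed

lemma lideal_generator: "g \<in> set fs \<Longrightarrow> g \<in> lideal fs"
proof -
  assume "g \<in> set fs"
  then obtain i where i: "i < length fs" "g = fs ! i" by (auto simp: in_set_conv_nth)
  have "(\<Sum>k<length fs. (if k = i then 1 else 0) * fs ! k) = (\<Sum>k<length fs. if k = i then fs ! k else 0)"
    by (rule sum.cong) auto
  then have "g = (\<Sum>k<length fs. (if k = i then 1 else 0) * fs ! k)" using i by simp
  then show ?thesis unfolding lideal_def by (intro CollectI exI)
qed

text \<open>Membership in a monomial ideal is decided monomial by monomial, which turns regularity
  of a power into a statement about exponents.\<close>

lemma lideal_Var_power:
  "p \<in> lideal (map (\<lambda>u. Var u ^ N) us) \<longleftrightarrow>
     (\<forall>\<alpha>. coef (p :: ('i::finite, complex) mpol) \<alpha> \<noteq> 0 \<longrightarrow> (\<exists>v\<in>set us. N \<le> coef \<alpha> v))"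
proof (intro iffI allI impI)
  fix \<alpha> assume "p \<in> lideal (map (\<lambda>u. Var u ^ N) us)" and nz: "coef p \<alpha> \<noteq> 0"
  then obtain c where p: "p = (\<Sum>k<length us. c k * Var (us ! k) ^ N)"
    by (auto simp: lideal_def)
  show "\<exists>v\<in>set us. N \<le> coef \<alpha> v"
  proof (rule ccontr)
    assume neg: "\<not> (\<exists>v\<in>set us. N \<le> coef \<alpha> v)"
    have "coef (c k * Var (us ! k) ^ N) \<alpha> = 0" if "k < length us" for k
      using neg that nth_mem[OF that] by (auto simp: Var_power coef_mono_mult mult.commute[of "c k"])
    then show False using nz unfolding p lookup_sum by simp
  qed
next
  assume a: "\<forall>\<alpha>. coef p \<alpha> \<noteq> 0 \<longrightarrow> (\<exists>v\<in>set us. N \<le> coef \<alpha> v)"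
  have "Poly_Mapping.single \<alpha> (coef p \<alpha>) \<in> lideal (map (\<lambda>u. Var u ^ N) us)"
    if \<alpha>: "\<alpha> \<in> Poly_Mapping.keys p" for \<alpha>
  proof -
    obtain v where v: "v \<in> set us" "N \<le> coef \<alpha> v" using a \<alpha> by (auto simp: in_keys_iff)
    have "\<alpha> = Poly_Mapping.single v N + (\<alpha> - Poly_Mapping.single v N)"
      using v(2) by (auto simp: poly_mapping_eq_iff fun_eq_iff lookup_add lookup_minus lookup_single when_def)
    then have "Poly_Mapping.single \<alpha> (coef p \<alpha>) =
        Poly_Mapping.single (\<alpha> - Poly_Mapping.single v N) (coef p \<alpha>) * Var v ^ N"
      by (simp add: Var_power Poly_Mapping.mult_single add.commute)
    also have "\<dots> \<in> lideal (map (\<lambda>u. Var u ^ N) us)"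
      by (intro is_idealD(3)[OF is_ideal_lideal] lideal_generator) (use v(1) in auto)
    finally show ?thesis .
  qed
  then have "(\<Sum>\<alpha>\<in>Poly_Mapping.keys p. Poly_Mapping.single \<alpha> (coef p \<alpha>)) \<in> lideal (map (\<lambda>u. Var u ^ N) us)"
    by (intro is_ideal_sum[OF is_ideal_lideal])
  then show "p \<in> lideal (map (\<lambda>u. Var u ^ N) us)" using mpol_expand[of p] by simp
qed

text \<open>Multiplication by \<open>Var v ^ N\<close> changes only the exponent of
  \<open>v\<close>, while membership in the ideal of the other powers depends only on the other
  exponents.\<close>

lemma kexact_Var_power:
  assumes "distinct us" "j > 0"
  shows "kexact (map (\<lambda>u. (Var u :: ('i::finite, complex) mpol) ^ N) us) j"
  using assms
proof (induction us arbitrary: j rule: rev_induct)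
  case Nil
  then show ?case by (simp add: kexact_Nil)
next
  case (snoc v us)
  let ?gs = "map (\<lambda>u. (Var u :: ('i, complex) mpol) ^ N) us"
  have "kexact (?gs @ [Var v ^ N]) j"
  proof (rule kexact_regular_snoc)
    show "kexact ?gs i" if "i > 0" for i using snoc that by simp
    show "j > 0" by fact
    fix p assume vp: "Var v ^ N * p \<in> lideal ?gs"
    show "p \<in> lideal ?gs"
      unfolding lideal_Var_power
    proof (intro allI impI)
      fix \<alpha> assume "coef p \<alpha> \<noteq> 0"
      then have "coef (Var v ^ N * p) (\<alpha> + Poly_Mapping.single v N) \<noteq> 0"
        by (simp add: Var_power coef_mono_mult lookup_add)
      then obtain w where w: "w \<in> set us" "N \<le> coef (\<alpha> + Poly_Mapping.single v N) w"
        using vp unfolding lideal_Var_power by blast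
      moreover have "w \<noteq> v" using w(1) snoc.prems(1) by auto
      ultimately show "\<exists>v\<in>set us. N \<le> coef \<alpha> v"
        by (auto simp: lookup_add lookup_single when_def)
    qed
  qed
  then show ?case by simp
qed

text \<open>Both the forms \<open>f\<^sub>u\<close> and the powers \<open>x\<^sub>u\<^sup>N\<close> generate ideals of finite colength. The powers form
  a regular sequence, so the Koszul complex of all of them together is exact above degree \<open>n\<close>;
  removing the \<open>n\<close> redundant powers lowers this bound to \<open>0\<close>.\<close>

lemma kexact_no_common_zero:
  fixes f :: "'n::finite \<Rightarrow> ('n, complex) mpol"
  assumes hom: "\<And>u. degs {m} (f u)"
    and nz: "\<And>x. (\<And>u. eval (f u) x = 0) \<Longrightarrow> x = 0"
    and us: "distinct us" "set us = UNIV" and "j > 0"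
  shows "kexact (map f us) j"
proof -
  have "\<forall>v. \<exists>N. \<forall>k\<ge>N. Var v ^ k \<in> ispan f"
    using homogeneous_nullstellensatz[of m f, OF hom nz] by blast
  then obtain N where N: "\<And>v k. N v \<le> k \<Longrightarrow> Var v ^ k \<in> ispan f" by (auto dest!: choice)
  define M where "M = Max (range N)"
  let ?gs = "map (\<lambda>u. (Var u :: ('n, complex) mpol) ^ M) us"
  show ?thesis
  proof (rule kexact_append_ideal)
    show "kexact (?gs @ map f us) (length ?gs + j)"
      by (rule kexact_append[of 0]) (use kexact_Var_power[OF us(1)] \<open>j > 0\<close> in auto)
    fix g assume "g \<in> set ?gs"
    then obtain v where g: "g = Var v ^ M" by auto
    have "N v \<le> M" unfolding M_def by (rule Max_ge) auto
    then have "g \<in> ispan f" using N g by blast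
    then obtain c where "g = (\<Sum>u\<in>UNIV. c u * f u)" by (rule ispanE)
    also have "\<dots> = (\<Sum>k<length us. c (us ! k) * f (us ! k))"
      using bij_betw_nth[OF us(1), of "{..<length us}" UNIV] us(2)
      by (simp add: sum.reindex_bij_betw[where g="\<lambda>u. c u * f u"])
    finally show "\<exists>c. g = (\<Sum>k<length (map f us). c k * map f us ! k)"
      by (intro exI[of _ "\<lambda>k. c (us ! k)"]) simp
  qed
qed

text \<open>Transfers \<open>kexact_syzygy\<close> from list positions to variables and keeps only
  the component of \<open>t\<close> in the degree that can contribute. For \<open>e < m\<close>
  there is no such degree, and \<open>t\<close> and \<open>\<sigma>\<close> vanish.\<close>

lemma antisym_syzygy:
  fixes f :: "'n::finite \<Rightarrow> ('n, complex) mpol"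
  assumes hom: "\<And>u. degs {m} (f u)"
    and nz: "\<And>x. (\<And>u. eval (f u) x = 0) \<Longrightarrow> x = 0"
    and s: "\<And>u. degs {e} (\<sigma> u)" "(\<Sum>u\<in>UNIV. \<sigma> u * f u) = 0"
  shows "\<exists>t. (\<forall>u w. t u w = - t w u) \<and> (\<forall>u. \<sigma> u = (\<Sum>w\<in>UNIV. t u w * f w)) \<and>
    (\<forall>u w. degs {j. j + m = e} (t u w))"
proof -
  obtain us :: "'n list" where us: "distinct us" "set us = UNIV"
    using finite_distinct_list[OF finite_class.finite_UNIV] by blast
  let ?n = "length us"
  have bij: "bij_betw (nth us) {..<?n} UNIV" using bij_betw_nth[OF us(1), of "{..<?n}" UNIV] us(2) by simp
  have re: "(\<Sum>u\<in>UNIV. g u) = (\<Sum>k<?n. g (us ! k))" for g :: "'n \<Rightarrow> ('n, complex) mpol"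
    using sum.reindex_bij_betw[OF bij, of g] by simp
  have ex: "kexact (map f us) (Suc 0)" by (rule kexact_no_common_zero[of m f, OF hom nz us]) simp_all
  have syz: "(\<Sum>k<length (map f us). \<sigma> (us ! k) * map f us ! k) = 0"
    using s(2) unfolding re by simp
  obtain t where t1: "\<And>i j. t i j = - t j i"
    and t2: "\<And>i. i < length (map f us) \<Longrightarrow> \<sigma> (us ! i) = (\<Sum>j<length (map f us). t i j * map f us ! j)"
    by (rule kexact_syzygy[OF ex syz]) blast
  define idx where "idx = the_inv_into {..<?n} (nth us)"
  have idx: "idx u < ?n" "us ! idx u = u" for u
    using f_the_inv_into_f_bij_betw[OF bij, of u] bij_betwE[OF bij_betw_the_inv_into[OF bij]]
    by (auto simp: idx_def)
  have idx_nth: "idx (us ! k) = k" if "k < ?n" for k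
    unfolding idx_def using bij that by (intro the_inv_into_f_f) (auto simp: bij_betw_def)
  define t' where "t' u w = (if m \<le> e then hcomp (e - m) (t (idx u) (idx w)) else 0)" for u w
  show ?thesis
  proof (intro exI[of _ t'] conjI allI)
    show "t' u w = - t' w u" for u w
      unfolding t'_def by (subst t1) (simp add: hcomp_minus)
    show "degs {j. j + m = e} (t' u w)" for u w
      unfolding t'_def by (auto intro: degs_mono[OF degs_hcomp])
    fix u
    have "\<sigma> u = (\<Sum>w\<in>UNIV. t (idx u) (idx w) * f w)"
      unfolding re using t2[of "idx u"] by (simp add: idx idx_nth)
    then have "hcomp e (\<sigma> u) = (\<Sum>w\<in>UNIV. hcomp e (t (idx u) (idx w) * f w))"
      by (simp add: hcomp_sum)
    then show "\<sigma> u = (\<Sum>w\<in>UNIV. t' u w * f w)"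
      unfolding hcomp_eq[OF s(1)] hcomp_mult_homog[OF hom] t'_def by (cases "m \<le> e") simp_all
  qed
qed

section \<open>Smooth forms\<close>

lemma degs_avee: "degs {CARD('n)} (avee i :: ('n::finite, complex) mpol)"
  unfolding avee_def by (rule degs_single) (use expo[of i] in simp)

lemma degs_form: "degs {CARD('n)} (form b :: ('n::finite, complex) mpol)"
  unfolding form_def by (intro degs_sum degs_Cst_mult degs_avee)

lemma degs_pderivx_form: "degs {CARD('n) - 1} (pderivx u (form b) :: ('n::finite, complex) mpol)"
  by (rule degs_pderivx[OF degs_form]) auto

text \<open>By Euler's identity the form vanishes wherever its partial derivatives do. Smoothness
  thus becomes the hypothesis under which their Koszul complex is exact.\<close>

lemma smooth_iff_no_common_zero:
  "b \<in> smooth_forms \<longleftrightarrow> (\<forall>x. (\<forall>u. eval (pderivx u (form b)) x = 0) \<longrightarrow> x = (0 :: complex ^ 'n::finite))"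
proof -
  have "eval (form b) x = 0" if z: "\<And>u. eval (pderivx u (form b)) x = 0" for x :: "complex ^ 'n"
  proof -
    have "eval (\<Sum>u\<in>UNIV. Var u * pderivx u (form b)) x = eval (Cst (of_nat CARD('n)) * form b) x"
      unfolding euler_identity[OF degs_form] Cst_of_nat by simp
    then show ?thesis by (simp add: eval_sum eval_mult z del: Cst_of_nat)
  qed
  then show ?thesis unfolding smooth_forms_def by blast
qed

section \<open>The twisted differential\<close>

definition dtw :: "complex ^ ('n::finite dmon) \<Rightarrow> 'n \<Rightarrow> ('n, complex) mpol \<Rightarrow> ('n, complex) mpol" where
  "dtw b u p = pderivx u p + pderivx u (form b) * p"

lemma dtw_add: "dtw b u (p + q) = dtw b u p + dtw b u q"
  and dtw_minus: "dtw b u (- p) = - dtw b u p"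
  and dtw_Cst_mult: "dtw b u (Cst c * p) = Cst c * dtw b u p"
  and dtw_0 [simp]: "dtw b u 0 = 0"
  by (simp_all add: dtw_def pderivx_add pderivx_minus pderivx_Cst_mult distrib_left mult.left_commute)

lemma dtw_diff: "dtw b u (p - q) = dtw b u p - dtw b u q"
  using dtw_add[of b u p "- q"] by (simp add: dtw_minus)

lemma dtw_sum: "dtw b u (sum g A) = (\<Sum>x\<in>A. dtw b u (g x))"
  by (induction A rule: infinite_finite_induct) (auto simp: dtw_add)

text \<open>\<open>dtw b u\<close> is the derivative conjugated by the exponential of
  \<open>form b\<close>, so these operators commute as the derivatives do.\<close>

lemma dtw_commute: "dtw b u (dtw b w p) = dtw b w (dtw b u p)"
  by (simp add: dtw_def pderivx_add pderivx_mult pderivx_commute[of u w] algebra_simps)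

lemma dtw_Var_mult: "dtw b u (Var v * r) = (if u = v then r else 0) + Var v * dtw b u r"
  by (simp add: dtw_def pderivx_mult pderivx_Var algebra_simps)

text \<open>Commuting operators are paired with an antisymmetric tensor. The same \<open>t\<close>
  works for every \<open>b\<close>, which is what lets these trivial relations be deformed.\<close>

lemma dtw_antisym:
  assumes "\<And>u w. t u w = - t w u"
  shows "(\<Sum>u\<in>UNIV. dtw b u (\<Sum>w\<in>UNIV. dtw b w (t u w))) = 0"
proof -
  let ?S = "\<Sum>u\<in>UNIV. \<Sum>w\<in>UNIV. dtw b u (dtw b w (t u w))"
  have "?S = (\<Sum>w\<in>UNIV. \<Sum>u\<in>UNIV. dtw b u (dtw b w (t u w)))" by (rule sum.swap)
  also have "\<dots> = (\<Sum>w\<in>UNIV. \<Sum>u\<in>UNIV. - dtw b w (dtw b u (t w u)))"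
    by (intro sum.cong refl) (subst assms, simp add: dtw_minus dtw_commute)
  also have "\<dots> = - ?S" by (simp add: sum_negf)
  finally have "?S = 0" by (rule mpol_eq_minus_self)
  then show ?thesis by (simp add: dtw_sum)
qed

text \<open>The degrees occurring in \<open>s\<close>, and in a tensor \<open>t\<close> with \<open>s\<^sub>u = \<Sum>\<^sub>v D\<^sub>v t\<^sub>u\<^sub>v\<close>. The variables
  all have weight one here, so that \<open>x\<^sub>v R\<close> sits in the degrees \<open>1 + (m + 1) i\<close>.\<close>

definition odeg :: "'n::finite itself \<Rightarrow> nat \<Rightarrow> nat set" where
  "odeg _ k = {1 + CARD('n) * i | i. i < k}"

definition tdegs :: "'n::finite itself \<Rightarrow> nat \<Rightarrow> nat set" where
  "tdegs _ k = {j. \<exists>i<k. j + (CARD('n) - 1) = 1 + CARD('n) * i}"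

text \<open>When the top component of the image cancels, the leading parts of \<open>s\<close> form
  a syzygy of the partial derivatives and come from an antisymmetric \<open>t\<close>. Subtracting
  the trivial relation of \<open>t\<close> leaves the image unchanged and lowers the degree of
  \<open>s\<close>.\<close>

lemma dtw_reduce:
  fixes s :: "'n::finite \<Rightarrow> ('n, complex) mpol"
  assumes sm: "b \<in> smooth_forms"
    and s: "\<And>u. degs (odeg TYPE('n) (Suc k)) (s u)"
    and top: "hcomp (CARD('n) * Suc k) (\<Sum>u\<in>UNIV. dtw b u (s u)) = 0"
  obtains t where "\<And>u w. t u w = - t w u" "\<And>u w. degs (tdegs TYPE('n) (Suc k)) (t u w)"
    "\<And>u. degs (odeg TYPE('n) k) (s u - (\<Sum>w\<in>UNIV. dtw b w (t u w)))"
proof -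
  let ?n = "CARD('n)"
  define f where "f u = pderivx u (form b)" for u
  have hom: "degs {?n - 1} (f u)" for u unfolding f_def by (rule degs_pderivx_form)
  have nz: "x = 0" if "\<And>u. eval (f u) x = 0" for x
    using sm that unfolding smooth_iff_no_common_zero f_def by blast
  have n0: "?n > 0" by simp
  define e where "e = 1 + ?n * k"
  define \<sigma> where "\<sigma> u = hcomp e (s u)" for u
  have "hcomp (?n * Suc k) (dtw b u (s u)) = \<sigma> u * f u" for u
  proof -
    have "degs {..?n * k} (pderivx u (s u))"
      by (rule degs_pderivx[OF s]) (auto simp: odeg_def)
    then have "hcomp (?n * Suc k) (pderivx u (s u)) = 0"
      by (rule hcomp_eq_0) (use n0 in simp)
    moreover have "?n * Suc k - (?n - 1) = e" "?n - 1 \<le> ?n * Suc k"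
      using n0 by (simp_all add: e_def)
    ultimately show ?thesis
      by (simp add: dtw_def hcomp_add mult.commute[of "f u" "s u"] hcomp_mult_homog[OF hom] \<sigma>_def flip: f_def)
  qed
  then have syz: "(\<Sum>u\<in>UNIV. \<sigma> u * f u) = 0" using top by (simp add: hcomp_sum)
  have \<sigma>: "degs {e} (\<sigma> u)" for u unfolding \<sigma>_def by (rule degs_hcomp)
  obtain t where t1: "\<forall>u w. t u w = - t w u" and t2: "\<forall>u. \<sigma> u = (\<Sum>w\<in>UNIV. t u w * f w)"
    and t3: "\<forall>u w. degs {j. j + (?n - 1) = e} (t u w)"
    using antisym_syzygy[of "?n - 1" f e \<sigma>, OF hom nz \<sigma> syz] by blast
  note t = t1[rule_format] t2[rule_format] t3[rule_format]
  \<comment> \<open>Degree count: \<open>t\<close> has degree \<open>e - (?n - 1)\<close>, so its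
    derivative lands at the next lower member of \<open>odeg\<close>. With a single variable the
    count fails for \<open>k = 0\<close>, but there antisymmetry makes \<open>t\<close>
    vanish.\<close>
  have pt: "degs (odeg TYPE('n) k) (pderivx w (t u w))" for u w
  proof (cases "?n = 1")
    case True
    then have uw: "u = w" by (metis card_1_singletonE UNIV_I singletonD)
    have "t u w = 0" unfolding uw by (rule mpol_eq_minus_self) (rule t(1))
    then show ?thesis by simp
  next
    case False
    show ?thesis
    proof (rule degs_pderivx[OF t(3)])
      fix j assume "Suc j \<in> {j. j + (?n - 1) = e}"
      then have j: "j + ?n = 1 + ?n * k" using n0 by (simp add: e_def)
      then obtain k' where k': "k = Suc k'" using False n0 by (cases k) auto
      then have "j = 1 + ?n * k'" using j by simp
      then show "j \<in> odeg TYPE('n) k" using k' by (auto simp: odeg_def)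
    qed
  qed
  have low: "degs (odeg TYPE('n) k) (s u - \<sigma> u)" for u
    unfolding degs_def
  proof (intro allI impI)
    fix \<alpha> assume nz: "coef (s u - \<sigma> u) \<alpha> \<noteq> 0"
    then have "mdeg \<alpha> \<noteq> e" by (auto simp: lookup_minus \<sigma>_def coef_hcomp)
    moreover have "mdeg \<alpha> \<in> odeg TYPE('n) (Suc k)"
      using nz s[of u] by (auto simp: lookup_minus \<sigma>_def coef_hcomp degs_def split: if_splits)
    ultimately show "mdeg \<alpha> \<in> odeg TYPE('n) k"
      by (auto simp: odeg_def e_def less_Suc_eq)
  qed
  show thesis
  proof (rule that[of t])
    show "t u w = - t w u" for u w by (rule t(1))
    show "degs (tdegs TYPE('n) (Suc k)) (t u w)" for u w
      by (rule degs_mono[OF t(3)]) (auto simp: tdegs_def e_def)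
    fix u
    have eq: "s u - (\<Sum>w\<in>UNIV. dtw b w (t u w)) = (s u - \<sigma> u) - (\<Sum>w\<in>UNIV. pderivx w (t u w))"
      by (simp add: t(2) dtw_def sum.distrib mult.commute flip: f_def)
    show "degs (odeg TYPE('n) k) (s u - (\<Sum>w\<in>UNIV. dtw b w (t u w)))"
      unfolding eq by (intro degs_diff low degs_sum pt)
  qed
qed

text \<open>As long as the bound on \<open>s\<close> exceeds the degree of the image, the top
  component of the image is zero and \<open>dtw_reduce\<close> applies.\<close>

lemma dtw_strict:
  fixes s :: "'n::finite \<Rightarrow> ('n, complex) mpol"
  assumes sm: "b \<in> smooth_forms"
    and s: "\<And>u. degs (odeg TYPE('n) k) (s u)"
    and h: "degs {..CARD('n) * d} (\<Sum>u\<in>UNIV. dtw b u (s u))"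
  shows "\<exists>s'. (\<forall>u. degs (odeg TYPE('n) d) (s' u)) \<and>
    (\<Sum>u\<in>UNIV. dtw b u (s' u)) = (\<Sum>u\<in>UNIV. dtw b u (s u))"
  using s h
proof (induction k arbitrary: s)
  case 0
  then have "degs (odeg TYPE('n) d) (s u)" for u
    by (intro degs_mono[OF 0(1)]) (auto simp: odeg_def)
  then show ?case by blast
next
  case (Suc k)
  show ?case
  proof (cases "Suc k \<le> d")
    case True
    then have "degs (odeg TYPE('n) d) (s u)" for u
      by (intro degs_mono[OF Suc.prems(1)]) (auto simp: odeg_def)
    then show ?thesis by blast
  next
    case False
    have "hcomp (CARD('n) * Suc k) (\<Sum>u\<in>UNIV. dtw b u (s u)) = 0"
    proof (rule hcomp_eq_0[OF Suc.prems(2)])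
      have "CARD('n) * d < CARD('n) * Suc k" using False by (intro mult_strict_left_mono) simp_all
      then show "CARD('n) * Suc k \<notin> {..CARD('n) * d}" by simp
    qed
    then obtain t where t: "\<And>u w. t u w = - t w u" "\<And>u w. degs (tdegs TYPE('n) (Suc k)) (t u w)"
      "\<And>u. degs (odeg TYPE('n) k) (s u - (\<Sum>w\<in>UNIV. dtw b w (t u w)))"
      by (rule dtw_reduce[of b k s, OF sm Suc.prems(1)]) blast
    have eq: "(\<Sum>u\<in>UNIV. dtw b u (s u - (\<Sum>w\<in>UNIV. dtw b w (t u w)))) = (\<Sum>u\<in>UNIV. dtw b u (s u))"
      using dtw_antisym[OF t(1), of b] by (simp add: dtw_diff sum_subtractf)
    show ?thesis
      using Suc.IH[of "\<lambda>u. s u - (\<Sum>w\<in>UNIV. dtw b w (t u w))"] t(3) Suc.prems(2) unfolding eq by blast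
  qed
qed

text \<open>The same descent for image zero, run to the bottom with the tensors added up. Their
  degree bound keeps the deformed relations within \<open>odeg\<close> when \<open>b\<close> is
  moved later.\<close>

lemma dtw_exact:
  fixes s :: "'n::finite \<Rightarrow> ('n, complex) mpol"
  assumes sm: "b \<in> smooth_forms"
    and s: "\<And>u. degs (odeg TYPE('n) k) (s u)"
    and h: "(\<Sum>u\<in>UNIV. dtw b u (s u)) = 0"
  shows "\<exists>t. (\<forall>u w. t u w = - t w u) \<and> (\<forall>u w. degs (tdegs TYPE('n) k) (t u w)) \<and>
    (\<forall>u. s u = (\<Sum>w\<in>UNIV. dtw b w (t u w)))"
  using s h
proof (induction k arbitrary: s)
  case 0
  have "s u = 0" for u using 0(1)[of u] by (intro degs_empty) (simp add: odeg_def)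
  then show ?case by (intro exI[of _ "\<lambda>_ _. 0"]) simp
next
  case (Suc k)
  have "hcomp (CARD('n) * Suc k) (\<Sum>u\<in>UNIV. dtw b u (s u)) = 0" by (simp only: Suc.prems(2) hcomp_0)
  then obtain t where t: "\<And>u w. t u w = - t w u" "\<And>u w. degs (tdegs TYPE('n) (Suc k)) (t u w)"
    "\<And>u. degs (odeg TYPE('n) k) (s u - (\<Sum>w\<in>UNIV. dtw b w (t u w)))"
    by (rule dtw_reduce[of b k s, OF sm Suc.prems(1)]) blast
  have "(\<Sum>u\<in>UNIV. dtw b u (s u - (\<Sum>w\<in>UNIV. dtw b w (t u w)))) = 0"
    using dtw_antisym[OF t(1), of b] Suc.prems(2) by (simp add: dtw_diff sum_subtractf)
  then obtain t' where t'0: "\<forall>u w. t' u w = - t' w u" "\<forall>u w. degs (tdegs TYPE('n) k) (t' u w)"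
    "\<forall>u. s u - (\<Sum>w\<in>UNIV. dtw b w (t u w)) = (\<Sum>w\<in>UNIV. dtw b w (t' u w))"
    using Suc.IH[of "\<lambda>u. s u - (\<Sum>w\<in>UNIV. dtw b w (t u w))", OF t(3)] by blast
  note t' = t'0[rule_format]
  show ?case
  proof (intro exI[of _ "\<lambda>u w. t u w + t' u w"] conjI allI)
    show "t u w + t' u w = - (t w u + t' w u)" for u w
      using t(1)[of u w] t'(1)[of u w] by simp
    show "degs (tdegs TYPE('n) (Suc k)) (t u w + t' u w)" for u w
      by (intro degs_add t(2) degs_mono[OF t'(2)]) (auto simp: tdegs_def intro: less_SucI)
    show "s u = (\<Sum>w\<in>UNIV. dtw b w (t u w + t' u w))" for u
      using t'(3)[of u] by (simp add: dtw_add sum.distrib algebra_simps)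
  qed
qed

section \<open>The grading of the ring R\<close>

lemma expo_decomp:
  assumes "k \<le> mdeg (\<alpha> :: 'i::finite \<Rightarrow>\<^sub>0 nat)"
  shows "\<exists>\<beta> \<gamma>. \<alpha> = \<beta> + \<gamma> \<and> mdeg \<beta> = k"
  using assms
proof (induction k)
  case 0
  then show ?case by (intro exI[of _ 0] exI[of _ \<alpha>]) simp
next
  case (Suc k)
  then obtain \<beta> \<gamma> where bg: "\<alpha> = \<beta> + \<gamma>" "mdeg \<beta> = k" by auto
  then have "\<gamma> \<noteq> 0" using Suc.prems by (auto simp: mdeg_add)
  then obtain u where u: "coef \<gamma> u > 0" by (metis lookup_zero poly_mapping_eqI gr0I)
  show ?case
    by (rule exI[of _ "\<beta> + ee u"], rule exI[of _ "\<gamma> - ee u"])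
      (use bg expo_split[OF u] in \<open>simp add: mdeg_add add.assoc\<close>)
qed

text \<open>A monomial whose degree is a multiple of \<open>CARD('n)\<close> splits into factors of
  degree \<open>CARD('n)\<close>. Membership in \<open>R\<close> becomes a condition on degrees
  alone.\<close>

lemma R_iff_degs: "p \<in> R \<longleftrightarrow> degs (range ((*) CARD('n))) (p :: ('n::finite, complex) mpol)"
proof
  assume "p \<in> R"
  then show "degs (range ((*) CARD('n))) p"
  proof induction
    case (const c)
    then show ?case by (intro degs_Cst) (auto intro: image_eqI[of _ _ 0])
  next
    case (gen i)
    then show ?case by (rule degs_mono[OF degs_avee]) (auto intro: image_eqI[of _ _ 1])
  next
    case (mult p q)
    then show ?case by (rule_tac degs_mult) (auto simp flip: distrib_left)
  qed (rule degs_add)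
next
  have m: "xmon \<alpha> \<in> R" if "mdeg \<alpha> = CARD('n) * k" for k and \<alpha> :: "'n \<Rightarrow>\<^sub>0 nat"
    using that
  proof (induction k arbitrary: \<alpha>)
    case 0
    then have "\<alpha> = 0" by (simp add: mdeg_eq_0_iff)
    then show ?case using R.const[of 1] by (simp add: Cst_def)
  next
    case (Suc k)
    then obtain \<beta> \<gamma> where bg: "\<alpha> = \<beta> + \<gamma>" "mdeg \<beta> = CARD('n)"
      using expo_decomp[of "CARD('n)" \<alpha>] by auto
    then have "xmon \<gamma> \<in> R" using Suc by (auto simp: mdeg_add)
    moreover have "xmon \<beta> = avee (Abs_dmon \<beta>)" using bg(2) by (simp add: avee_def Abs_dmon_inverse)
    then have "xmon \<beta> \<in> R" by (simp add: R.gen)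
    ultimately have "xmon \<beta> * xmon \<gamma> \<in> R" by (rule R.mult[rotated])
    then show ?case by (simp add: Poly_Mapping.mult_single bg(1))
  qed
  assume "degs (range ((*) CARD('n))) p"
  then show "p \<in> R"
  proof (induction p rule: degs_induct)
    case zero
    then show ?case using R.const[of 0] by simp
  next
    case (single \<alpha> c)
    then have "Cst c * xmon \<alpha> \<in> R" using m by (intro R.mult R.const) auto
    then show ?case by (simp add: Cst_def Poly_Mapping.mult_single)
  qed (rule R.add)
qed

text \<open>The bound is strict so that \<open>k = 0\<close> gives the zero space, in agreement with
  \<open>R_le (- 1)\<close>.\<close>

definition edeg :: "'n::finite itself \<Rightarrow> nat \<Rightarrow> nat set" where
  "edeg _ k = {CARD('n) * i | i. i < k}"

lemma R_le_iff_degs: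
  "p \<in> R_le (int k - 1) \<longleftrightarrow> degs (edeg TYPE('n) k) (p :: ('n::finite, complex) mpol)"
proof -
  have eq: "int (CARD('n) * i) \<le> (int k - 1) * int CARD('n) \<longleftrightarrow> i < k" for i
  proof -
    have "int (CARD('n) * i) \<le> (int k - 1) * int CARD('n) \<longleftrightarrow> int CARD('n) * int i \<le> int CARD('n) * (int k - 1)"
      unfolding of_nat_mult mult.commute[of "int k - 1"] ..
    also have "\<dots> \<longleftrightarrow> int i \<le> int k - 1" by (rule mult_le_cancel_left_pos) simp
    finally show ?thesis by linarith
  qed
  have "mdeg \<alpha> \<in> edeg TYPE('n) k \<longleftrightarrow>
      mdeg \<alpha> \<in> range ((*) CARD('n)) \<and> int (mdeg \<alpha>) \<le> (int k - 1) * int CARD('n)" for \<alpha> :: "'n \<Rightarrow>\<^sub>0 nat"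
  proof (cases "mdeg \<alpha> \<in> range ((*) CARD('n))")
    case True
    then obtain i where i: "mdeg \<alpha> = CARD('n) * i" by blast
    show ?thesis unfolding edeg_def i eq by auto
  next
    case False
    then show ?thesis by (auto simp: edeg_def)
  qed
  then show ?thesis
    unfolding R_le_def R_iff_degs degs_def Ball_def mem_Collect_eq in_keys_iff by blast
qed

lemma R_le_iff_degs': "p \<in> R_le (int d) \<longleftrightarrow> degs (edeg TYPE('n) (Suc d)) (p :: ('n::finite, complex) mpol)"
  using R_le_iff_degs[of p "Suc d"] by simp

section \<open>Polynomial families of vectors\<close>

text \<open>Linear independence of an indexed family with coordinates in \<open>K\<close>. Indices
  instead of sets of vectors keep the family fixed while its members vary with \<open>b\<close>,
  even if some of them coincide.\<close>

definition indepf :: "'j set \<Rightarrow> ('j \<Rightarrow> 'k \<Rightarrow> complex) \<Rightarrow> 'k set \<Rightarrow> bool" where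
  "indepf J a K \<longleftrightarrow> (\<forall>\<nu>. (\<forall>i\<in>K. (\<Sum>j\<in>J. \<nu> j * a j i) = 0) \<longrightarrow> (\<forall>j\<in>J. \<nu> j = 0))"

lemma indepfD: "indepf J a K \<Longrightarrow> (\<And>i. i \<in> K \<Longrightarrow> (\<Sum>j\<in>J. \<nu> j * a j i) = 0) \<Longrightarrow> j \<in> J \<Longrightarrow> \<nu> j = 0"
  unfolding indepf_def by blast

lemma indepf_subset:
  assumes "indepf J a K" "I \<subseteq> J" "finite J"
  shows "indepf I a K"
  unfolding indepf_def
proof (intro allI impI ballI)
  fix \<nu> j assume z: "\<forall>i\<in>K. (\<Sum>j\<in>I. \<nu> j * a j i) = 0" and j: "j \<in> I"
  have "(\<Sum>j\<in>J. (if j \<in> I then \<nu> j else 0) * a j i) = (\<Sum>j\<in>I. \<nu> j * a j i)" for i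
    using assms(2,3) by (intro sum.mono_neutral_cong_right) auto
  then show "\<nu> j = 0"
    using indepfD[OF assms(1), of "\<lambda>j. if j \<in> I then \<nu> j else 0" j] z j assms(2) by auto
qed

lemma indepf_card_le:
  assumes "indepf J a K" "finite J" "finite K"
  shows "card J \<le> card K"
proof (rule ccontr)
  assume "\<not> card J \<le> card K"
  then obtain \<nu> where "\<exists>j\<in>J. \<nu> j \<noteq> 0" "\<forall>i\<in>K. (\<Sum>j\<in>J. \<nu> j * a j i) = 0"
    using linear_system_nontrivial[OF assms(3,2), of a] by auto
  then show False using indepfD[OF assms(1), of \<nu>] by blast
qed

lemma indepf_insert_solve:
  assumes ind: "indepf J a K" and fin: "finite J" and j0: "j0 \<notin> J"
    and dep: "\<not> indepf (insert j0 J) a K"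
  obtains \<nu> where "\<And>i. i \<in> K \<Longrightarrow> a j0 i = (\<Sum>j\<in>J. \<nu> j * a j i)"
proof -
  obtain \<mu> j where m: "\<And>i. i \<in> K \<Longrightarrow> (\<Sum>j\<in>insert j0 J. \<mu> j * a j i) = 0" "j \<in> insert j0 J" "\<mu> j \<noteq> 0"
    using dep unfolding indepf_def by blast
  have s: "\<mu> j0 * a j0 i + (\<Sum>j\<in>J. \<mu> j * a j i) = 0" if "i \<in> K" for i
    using m(1)[OF that] fin j0 by simp
  have nz: "\<mu> j0 \<noteq> 0"
  proof
    assume "\<mu> j0 = 0"
    then have "\<mu> j = 0" if "j \<in> J" for j using indepfD[OF ind _ that, of \<mu>] s by simp
    then show False using m(2,3) \<open>\<mu> j0 = 0\<close> by auto
  qed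
  show thesis
  proof (rule that[of "\<lambda>j. - \<mu> j / \<mu> j0"])
    fix i assume "i \<in> K"
    then have "a j0 i = - (\<Sum>j\<in>J. \<mu> j * a j i) / \<mu> j0"
      using s[of i] nz by (simp add: field_simps add_eq_0_iff)
    also have "\<dots> = (\<Sum>j\<in>J. - \<mu> j / \<mu> j0 * a j i)"
      by (simp add: sum_divide_distrib sum_negf)
    finally show "a j0 i = (\<Sum>j\<in>J. - \<mu> j / \<mu> j0 * a j i)" .
  qed
qed

lemma indepf_maximal:
  assumes "finite J"
  obtains I where "I \<subseteq> J" "indepf I a K"
    "\<And>j. j \<in> J \<Longrightarrow> \<exists>\<nu>. \<forall>i\<in>K. a j i = (\<Sum>l\<in>I. \<nu> l * a l i)"
proof -
  have "\<exists>I. I \<subseteq> J \<and> indepf I a K \<and> (\<forall>j\<in>J. \<exists>\<nu>. \<forall>i\<in>K. a j i = (\<Sum>l\<in>I. \<nu> l * a l i))"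
    using assms
  proof (induction J rule: finite_induct)
    case empty
    then show ?case by (auto simp: indepf_def)
  next
    case (insert j0 J)
    then obtain I where I: "I \<subseteq> J" "indepf I a K"
      "\<And>j. j \<in> J \<Longrightarrow> \<exists>\<nu>. \<forall>i\<in>K. a j i = (\<Sum>l\<in>I. \<nu> l * a l i)" by blast
    have fin: "finite I" using I(1) insert.hyps(1) by (rule finite_subset)
    have j0: "j0 \<notin> I" using I(1) insert.hyps(2) by blast
    show ?case
    proof (cases "indepf (insert j0 I) a K")
      case True
      show ?thesis
      proof (intro exI[of _ "insert j0 I"] conjI ballI)
        show "insert j0 I \<subseteq> insert j0 J" using I(1) by blast
        show "indepf (insert j0 I) a K" by fact
        fix j assume "j \<in> insert j0 J"
        then consider "j = j0" | "j \<in> J" by blast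
        then show "\<exists>\<nu>. \<forall>i\<in>K. a j i = (\<Sum>l\<in>insert j0 I. \<nu> l * a l i)"
        proof cases
          case 1
          have "(\<Sum>l\<in>I. (if l = j0 then 1 else 0) * a l i) = 0" for i
            using j0 by (intro sum.neutral) auto
          then show ?thesis
            using fin j0 1 by (intro exI[of _ "\<lambda>l. if l = j0 then 1 else 0"]) simp
        next
          case 2
          obtain \<nu> where n: "\<forall>i\<in>K. a j i = (\<Sum>l\<in>I. \<nu> l * a l i)" using I(3)[OF 2] by blast
          have "(\<Sum>l\<in>I. (\<nu>(j0 := 0)) l * a l i) = (\<Sum>l\<in>I. \<nu> l * a l i)" for i
            using j0 by (intro sum.cong) auto
          then show ?thesis
            using fin j0 n by (intro exI[of _ "\<nu>(j0 := 0)"]) simp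
        qed
      qed
    next
      case False
      obtain \<nu> where "\<And>i. i \<in> K \<Longrightarrow> a j0 i = (\<Sum>l\<in>I. \<nu> l * a l i)"
        using indepf_insert_solve[OF I(2) fin j0 False] by blast
      then show ?thesis using I by (intro exI[of _ I]) blast
    qed
  qed
  then show thesis using that by blast
qed

text \<open>Polynomiality as a property of functions lets matrix entries be built up without writing
  down their polynomials.\<close>

definition polyfun :: "(complex ^ 'i::finite \<Rightarrow> complex) \<Rightarrow> bool" where
  "polyfun g \<longleftrightarrow> (\<exists>p. \<forall>b. g b = eval p b)"

lemma polyfun_eval [intro]: "polyfun (eval p)"
  unfolding polyfun_def by blast

lemma polyfun_const [intro]: "polyfun (\<lambda>_. c)"
  unfolding polyfun_def by (intro exI[of _ "Cst c"]) simp

lemma polyfun_coord [intro]: "polyfun (\<lambda>b. b $ i)"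
  unfolding polyfun_def by (intro exI[of _ "Var i"]) simp

lemma polyfun_add [intro]: "polyfun g \<Longrightarrow> polyfun h \<Longrightarrow> polyfun (\<lambda>b. g b + h b)"
  unfolding polyfun_def by (metis eval_add)

lemma polyfun_mult [intro]: "polyfun g \<Longrightarrow> polyfun h \<Longrightarrow> polyfun (\<lambda>b. g b * h b)"
  unfolding polyfun_def by (metis eval_mult)

lemma polyfun_diff [intro]: "polyfun g \<Longrightarrow> polyfun h \<Longrightarrow> polyfun (\<lambda>b. g b - h b)"
  unfolding polyfun_def by (metis eval_diff)

lemma polyfun_sum [intro]: "(\<And>x. x \<in> A \<Longrightarrow> polyfun (g x)) \<Longrightarrow> polyfun (\<lambda>b. \<Sum>x\<in>A. g x b)"
  by (induction A rule: infinite_finite_induct) auto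

text \<open>Gaussian elimination with polynomial entries: the product of the pivots cuts out the locus.\<close>

lemma indepf_open:
  fixes a :: "complex ^ 'i::finite \<Rightarrow> 'j \<Rightarrow> 'k \<Rightarrow> complex"
  assumes "finite J" "\<And>j i. polyfun (\<lambda>b. a b j i)" "indepf J (a b0) K"
  shows "\<exists>p. eval p b0 \<noteq> 0 \<and> (\<forall>b. eval p b \<noteq> 0 \<longrightarrow> indepf J (a b) K)"
  using assms
proof (induction J arbitrary: a rule: finite_induct)
  case empty
  then show ?case by (intro exI[of _ 1]) (auto simp: indepf_def)
next
  case (insert j0 J)
  have S: "(\<Sum>j\<in>insert j0 J. \<nu> j * h j) = \<nu> j0 * h j0 + (\<Sum>j\<in>J. \<nu> j * h j)" for \<nu> h :: "'j \<Rightarrow> complex"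
    using insert.hyps by simp
  obtain i0 where i0: "i0 \<in> K" "a b0 j0 i0 \<noteq> 0"
  proof (rule ccontr)
    assume "\<not> thesis"
    then have "\<forall>i\<in>K. a b0 j0 i = 0" using that by blast
    moreover have "(\<Sum>j\<in>J. (if j = j0 then 1 else 0) * a b0 j i) = 0" for i
      using insert.hyps by (intro sum.neutral) auto
    ultimately show False
      using indepfD[OF insert.prems(2), of "\<lambda>j. if j = j0 then 1 else 0" j0] S by simp
  qed
  obtain q where q: "\<And>b. a b j0 i0 = eval q b" using insert.prems(1) unfolding polyfun_def by blast
  \<comment> \<open>Elimination by cross multiplication instead of division by the pivot, so that
    the entries stay polynomial in \<open>b\<close>.\<close>
  define a' where "a' b j i = a b j0 i0 * a b j i - a b j i0 * a b j0 i" for b j i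
  have a'_sum: "(\<Sum>j\<in>J. \<nu> j * a' b j i) =
      a b j0 i0 * (\<Sum>j\<in>J. \<nu> j * a b j i) - (\<Sum>j\<in>J. \<nu> j * a b j i0) * a b j0 i" for \<nu> b i
    by (simp add: a'_def right_diff_distrib sum_subtractf sum_distrib_left sum_distrib_right mult_ac)
  have "polyfun (\<lambda>b. a' b j i)" for j i
    unfolding a'_def using insert.prems(1) by (intro polyfun_diff polyfun_mult)
  moreover have "indepf J (a' b0) K"
    unfolding indepf_def
  proof (intro allI impI ballI)
    fix \<nu> j assume z: "\<forall>i\<in>K. (\<Sum>j\<in>J. \<nu> j * a' b0 j i) = 0" and j: "j \<in> J"
    \<comment> \<open>Lifts a relation among the reduced vectors to the original ones; the pivot
      entry is nonzero at \<open>b0\<close> and can be cancelled from the conclusion.\<close>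
    define \<mu> where "\<mu> l = (if l = j0 then - (\<Sum>j\<in>J. \<nu> j * a b0 j i0) else a b0 j0 i0 * \<nu> l)" for l
    have "(\<Sum>l\<in>insert j0 J. \<mu> l * a b0 l i) = 0" if "i \<in> K" for i
    proof -
      have "(\<Sum>l\<in>J. \<mu> l * a b0 l i) = (\<Sum>l\<in>J. a b0 j0 i0 * (\<nu> l * a b0 l i))"
        using insert.hyps by (intro sum.cong) (auto simp: \<mu>_def)
      then show ?thesis
        unfolding S using z[rule_format, OF that] unfolding a'_sum
        by (simp add: \<mu>_def flip: sum_distrib_left)
    qed
    then have "\<mu> j = 0" using indepfD[OF insert.prems(2), of \<mu> j] j by blast
    then show "\<nu> j = 0" using i0(2) j insert.hyps by (auto simp: \<mu>_def split: if_splits)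
  qed
  ultimately obtain p where p: "eval p b0 \<noteq> 0" "\<And>b. eval p b \<noteq> 0 \<Longrightarrow> indepf J (a' b) K"
    using insert.IH[of a'] by blast
  show ?case
  proof (intro exI[of _ "q * p"] conjI allI impI)
    show "eval (q * p) b0 \<noteq> 0" using p(1) i0(2) q by (simp add: eval_mult)
    fix b assume "eval (q * p) b \<noteq> 0"
    then have b: "a b j0 i0 \<noteq> 0" "eval p b \<noteq> 0" using q by (auto simp: eval_mult)
    show "indepf (insert j0 J) (a b) K"
      unfolding indepf_def
    proof (intro allI impI)
      fix \<nu> assume "\<forall>i\<in>K. (\<Sum>j\<in>insert j0 J. \<nu> j * a b j i) = 0"
      then have z: "(\<Sum>j\<in>J. \<nu> j * a b j i) = - \<nu> j0 * a b j0 i" if "i \<in> K" for i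
        using that unfolding S by (simp add: eq_neg_iff_add_eq_0 add.commute)
      have "(\<Sum>j\<in>J. \<nu> j * a' b j i) = 0" if "i \<in> K" for i
        unfolding a'_sum z[OF that] z[OF i0(1)] by simp
      then have n: "\<nu> j = 0" if "j \<in> J" for j
        using indepfD[OF p(2)[OF b(2)], of \<nu> j] that by blast
      then have "(\<Sum>j\<in>J. \<nu> j * a b j i0) = 0" by simp
      then have "\<nu> j0 = 0" using z[OF i0(1)] b(1) by simp
      then show "\<forall>j\<in>insert j0 J. \<nu> j = 0" using n by blast
    qed
  qed
qed

text \<open>Each point outside is separated by one polynomial. This pointwise form is what
  statements such as \<open>indepf_open\<close> deliver.\<close>

lemma zariski_closed_iff:
  "zariski_closed C \<longleftrightarrow> (\<forall>b. b \<notin> C \<longrightarrow> (\<exists>p. eval p b \<noteq> 0 \<and> (\<forall>c\<in>C. eval p c = 0)))"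
proof
  assume "zariski_closed C"
  then show "\<forall>b. b \<notin> C \<longrightarrow> (\<exists>p. eval p b \<noteq> 0 \<and> (\<forall>c\<in>C. eval p c = 0))"
    unfolding zariski_closed_def by blast
next
  assume a: "\<forall>b. b \<notin> C \<longrightarrow> (\<exists>p. eval p b \<noteq> 0 \<and> (\<forall>c\<in>C. eval p c = 0))"
  have "C = {b. \<forall>p\<in>{p. \<forall>c\<in>C. eval p c = 0}. eval p b = 0}" using a by blast
  then show "zariski_closed C" unfolding zariski_closed_def by (rule exI)
qed

lemma zariski_closed_Int: "zariski_closed C \<Longrightarrow> zariski_closed D \<Longrightarrow> zariski_closed (C \<inter> D)"
  unfolding zariski_closed_iff by blast

lemma zariski_closed_Un:
  assumes "zariski_closed C" "zariski_closed D"
  shows "zariski_closed (C \<union> D)"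
  unfolding zariski_closed_iff
proof (intro allI impI)
  fix b assume "b \<notin> C \<union> D"
  then obtain p q where p: "eval p b \<noteq> 0" "\<forall>c\<in>C. eval p c = 0" and q: "eval q b \<noteq> 0" "\<forall>c\<in>D. eval q c = 0"
    using assms unfolding zariski_closed_iff by blast
  then show "\<exists>p. eval p b \<noteq> 0 \<and> (\<forall>c\<in>C \<union> D. eval p c = 0)"
    by (intro exI[of _ "p * q"]) (auto simp: eval_mult)
qed

lemma zariski_closed_inI:
  assumes "N \<subseteq> W" "\<And>b. b \<in> W \<Longrightarrow> b \<notin> N \<Longrightarrow> \<exists>p. eval p b \<noteq> 0 \<and> (\<forall>c\<in>N. eval p c = 0)"
  shows "zariski_closed_in W N"
proof -
  let ?C = "{b. \<forall>p\<in>{p. \<forall>c\<in>N. eval p c = 0}. eval p b = 0}"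
  have "zariski_closed ?C" unfolding zariski_closed_def by blast
  moreover have "N = W \<inter> ?C" using assms by blast
  ultimately show ?thesis unfolding zariski_closed_in_def by blast
qed

lemma indepf_Some:
  assumes "indepf J (\<lambda>j. a (Some j)) K"
  shows "indepf (Some ` J) a K"
  unfolding indepf_def
proof (intro allI impI)
  fix \<nu> assume z: "\<forall>i\<in>K. (\<Sum>j\<in>Some ` J. \<nu> j * a j i) = 0"
  have "\<nu> (Some j) = 0" if "j \<in> J" for j
    by (rule indepfD[OF assms, of "\<lambda>j. \<nu> (Some j)"]) (use z that in \<open>auto simp: sum.reindex\<close>)
  then show "\<forall>j\<in>Some ` J. \<nu> j = 0" by blast
qed

text \<open>One vector more than there are coordinates cannot be independent. The option type
  supplies \<open>None\<close> as the index of the additional vector \<open>y\<close>.\<close>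

lemma indepf_square:
  assumes "indepf J r J" "finite J"
  obtains \<mu> where "\<And>k. k \<in> J \<Longrightarrow> y k = (\<Sum>j\<in>J. \<mu> j * r j k)"
proof -
  define a where "a o' k = (case o' of None \<Rightarrow> y k | Some j \<Rightarrow> r j k)" for o' k
  have S: "(\<Sum>o'\<in>Some ` J. \<nu> o' * a o' k) = (\<Sum>j\<in>J. \<nu> (Some j) * r j k)" for \<nu> k
    by (simp add: sum.reindex a_def)
  have "(\<lambda>j. a (Some j)) = r" by (simp add: a_def fun_eq_iff)
  then have ind: "indepf (Some ` J) a J" using assms(1) by (intro indepf_Some) simp
  have dep: "\<not> indepf (insert None (Some ` J)) a J"
  proof
    assume "indepf (insert None (Some ` J)) a J"
    then have "card (insert None (Some ` J)) \<le> card J" using assms(2) by (intro indepf_card_le) auto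
    then show False using assms(2) by (simp add: card_image)
  qed
  have fin: "finite (Some ` J)" and none: "None \<notin> Some ` J" using assms(2) by auto
  obtain \<nu> where "\<And>k. k \<in> J \<Longrightarrow> a None k = (\<Sum>o'\<in>Some ` J. \<nu> o' * a o' k)"
    using indepf_insert_solve[OF ind fin none dep] by blast
  then show thesis by (intro that[of "\<lambda>j. \<nu> (Some j)"]) (simp only: S, simp add: a_def)
qed

lemma polyfun_coef_form: "polyfun (\<lambda>b. coef (form b) \<alpha>)"
  unfolding form_def lookup_sum coef_Cst_mult by (intro polyfun_sum polyfun_mult polyfun_coord polyfun_const)

lemma polyfun_coef_pderivx:
  "(\<And>\<alpha>. polyfun (\<lambda>b. coef (g b) \<alpha>)) \<Longrightarrow> polyfun (\<lambda>b. coef (pderivx u (g b)) \<alpha>)"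
  unfolding coef_pderivx by (intro polyfun_mult polyfun_const)

lemma coef_single_mult:
  fixes p :: "('i::finite, 'c::comm_ring_1) mpol"
  shows "coef (Poly_Mapping.single \<beta> c * p) \<alpha> =
    (if \<exists>\<gamma>. \<alpha> = \<beta> + \<gamma> then c * coef p (THE \<gamma>. \<alpha> = \<beta> + \<gamma>) else 0)"
proof (induction p rule: mpol_single_induct)
  case (single \<delta> d)
  show ?case
  proof (cases "\<exists>\<gamma>. \<alpha> = \<beta> + \<gamma>")
    case True
    then obtain \<gamma> where g: "\<alpha> = \<beta> + \<gamma>" by blast
    then have "(THE \<gamma>. \<alpha> = \<beta> + \<gamma>) = \<gamma>" by (intro the_equality) auto
    then show ?thesis using g by (auto simp: Poly_Mapping.mult_single lookup_single when_def)
  next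
    case False
    then show ?thesis by (auto simp: Poly_Mapping.mult_single lookup_single when_def)
  qed
qed (auto simp: lookup_add distrib_left)

lemma polyfun_coef_mult:
  fixes p :: "('j::finite, complex) mpol"
  assumes "\<And>\<alpha>. polyfun (\<lambda>b. coef (g b) \<alpha>)"
  shows "polyfun (\<lambda>b. coef (g b * p) \<alpha>)"
proof (induction p arbitrary: \<alpha> rule: mpol_single_induct)
  case (single \<beta> c)
  show ?case
    unfolding mult.commute[of _ "Poly_Mapping.single \<beta> c"] coef_single_mult
    using polyfun_mult[OF polyfun_const assms]
    by (cases "\<exists>\<gamma>. \<alpha> = \<beta> + \<gamma>") (simp_all only: if_True if_False polyfun_const)
next
  case (add p q)
  then show ?case by (auto simp: distrib_left lookup_add)
qed

lemma polyfun_coef_dtw: "polyfun (\<lambda>b. coef (dtw b u p) \<alpha>)"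
  unfolding dtw_def lookup_add
  by (intro polyfun_add polyfun_const polyfun_coef_mult polyfun_coef_pderivx polyfun_coef_form)

section \<open>Openness of smoothness\<close>

lemma monos_in_jacobian_ideal:
  assumes "(b :: complex ^ 'n::finite dmon) \<in> smooth_forms"
  obtains D where "\<And>\<alpha>. D \<le> mdeg \<alpha> \<Longrightarrow> xmon \<alpha> \<in> ispan (\<lambda>u. pderivx u (form b))"
proof -
  let ?f = "\<lambda>u. pderivx u (form b)"
  have "\<exists>N. \<forall>k\<ge>N. Var v ^ k \<in> ispan ?f" for v
    by (rule homogeneous_nullstellensatz[OF degs_pderivx_form])
      (use assms in \<open>auto simp: smooth_iff_no_common_zero\<close>)
  then have "\<forall>v. \<exists>N. \<forall>k\<ge>N. Var v ^ k \<in> ispan ?f" by blast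
  then obtain N where N: "\<And>v k. N v \<le> k \<Longrightarrow> Var v ^ k \<in> ispan ?f" by (auto dest!: choice)
  \<comment> \<open>By the pigeonhole principle a monomial of degree above the sum of all
    \<open>N v\<close> contains some \<open>Var v\<close> to the power \<open>N v\<close>.\<close>
  show thesis
  proof (rule that[of "Suc (\<Sum>v\<in>UNIV. N v)"])
    fix \<alpha> :: "'n \<Rightarrow>\<^sub>0 nat" assume a: "Suc (\<Sum>v\<in>UNIV. N v) \<le> mdeg \<alpha>"
    have "\<exists>v. N v \<le> coef \<alpha> v"
    proof (rule ccontr)
      assume "\<not> (\<exists>v. N v \<le> coef \<alpha> v)"
      then have "mdeg \<alpha> \<le> (\<Sum>v\<in>UNIV. N v)" unfolding mdeg_def by (intro sum_mono) (auto simp: not_le intro: less_imp_le)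
      then show False using a by simp
    qed
    then obtain v where v: "N v \<le> coef \<alpha> v" by blast
    have "\<alpha> = Poly_Mapping.single v (N v) + (\<alpha> - Poly_Mapping.single v (N v))"
      using v by (auto simp: poly_mapping_eq_iff fun_eq_iff lookup_add lookup_minus lookup_single when_def)
    then have "xmon \<alpha> = xmon (\<alpha> - Poly_Mapping.single v (N v)) * Var v ^ N v"
      by (simp add: Var_power Poly_Mapping.mult_single add.commute)
    then show "xmon \<alpha> \<in> ispan ?f" using is_idealD(3)[OF is_ideal_ispan N[OF order_refl]] by simp
  qed
qed

lemma smooth_if_powers_in_ideal:
  assumes "\<And>v. Var v ^ k \<in> ispan (\<lambda>u. pderivx u (form b))"
  shows "(b :: complex ^ 'n::finite dmon) \<in> smooth_forms"
  unfolding smooth_iff_no_common_zero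
proof (intro allI impI)
  fix x :: "complex ^ 'n" assume z: "\<forall>u. eval (pderivx u (form b)) x = 0"
  have "x $ v = 0" for v
  proof -
    obtain c where "Var v ^ k = (\<Sum>u\<in>UNIV. c u * pderivx u (form b))" using assms by (rule ispanE)
    then have "eval (Var v ^ k) x = 0" using z by (simp add: eval_sum eval_mult)
    then show ?thesis by (simp add: eval_power)
  qed
  then show "x = 0" by (simp add: Finite_Cartesian_Product.vec_eq_iff)
qed

text \<open>Smoothness says that the partial derivatives generate all monomials of some degree
  \<open>k\<close>. At \<open>b0\<close> this becomes the invertibility of a square matrix with
  entries polynomial in \<open>b\<close>, which persists on a Zariski neighbourhood.\<close>

lemma smooth_forms_open:
  assumes b0: "(b0 :: complex ^ 'n::finite dmon) \<in> smooth_forms"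
  shows "\<exists>p. eval p b0 \<noteq> 0 \<and> (\<forall>b. eval p b \<noteq> 0 \<longrightarrow> b \<in> smooth_forms)"
proof -
  define f where "f = (\<lambda>b u. pderivx u (form (b :: complex ^ 'n dmon)))"
  have hom: "degs {CARD('n) - 1} (f b u)" for b u unfolding f_def by (rule degs_pderivx_form)
  obtain D where D: "\<And>\<alpha>. D \<le> mdeg \<alpha> \<Longrightarrow> xmon \<alpha> \<in> ispan (f b0)"
    using monos_in_jacobian_ideal[OF b0] unfolding f_def by blast
  \<comment> \<open>At least the degree of the partial derivatives, so that
    \<open>k - (CARD('n) - 1)\<close> is not truncated.\<close>
  define k where "k = max D (CARD('n) - 1)"
  define K where "K = {\<alpha> :: 'n \<Rightarrow>\<^sub>0 nat. mdeg \<alpha> = k}"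
  have "finite K" unfolding K_def by (rule finite_subset[OF _ finite_mdeg[of k]]) auto
  have "\<forall>\<alpha>\<in>K. \<exists>c. xmon \<alpha> = (\<Sum>u\<in>UNIV. c u * f b0 u)"
    using D by (auto simp: ispan_def K_def k_def)
  from bchoice[OF this] obtain c where c: "\<And>\<alpha>. \<alpha> \<in> K \<Longrightarrow> xmon \<alpha> = (\<Sum>u\<in>UNIV. c \<alpha> u * f b0 u)"
    by blast
  \<comment> \<open>The cofactors are frozen at \<open>b0\<close> and only the partial derivatives
    vary; at \<open>b0\<close> the coefficient matrix of the \<open>g\<close> is the
    identity.\<close>
  define g where "g b \<alpha> = (\<Sum>u\<in>UNIV. hcomp (k - (CARD('n) - 1)) (c \<alpha> u) * f b u)" for b \<alpha>
  have g_hcomp: "g b \<alpha> = hcomp k (\<Sum>u\<in>UNIV. c \<alpha> u * f b u)" for b \<alpha>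
    by (simp add: g_def hcomp_sum hcomp_mult_homog[OF hom] k_def)
  have g0: "g b0 \<alpha> = xmon \<alpha>" if "\<alpha> \<in> K" for \<alpha>
    using that unfolding g_hcomp c[OF that, symmetric] by (intro hcomp_eq degs_single) (simp add: K_def)
  define a where "a b \<alpha> \<beta> = coef (g b \<alpha>) \<beta>" for b \<alpha> \<beta>
  have pa: "polyfun (\<lambda>b. a b \<alpha> \<beta>)" for \<alpha> \<beta>
    unfolding a_def g_def lookup_sum f_def mult.commute[of "hcomp _ _"]
    by (intro polyfun_sum polyfun_coef_mult polyfun_coef_pderivx polyfun_coef_form)
  have "indepf K (a b0) K"
    unfolding indepf_def
  proof (intro allI impI ballI)
    fix \<nu> \<beta> assume z: "\<forall>i\<in>K. (\<Sum>j\<in>K. \<nu> j * a b0 j i) = 0" and b: "\<beta> \<in> K"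
    have "(\<Sum>j\<in>K. \<nu> j * a b0 j \<beta>) = (\<Sum>j\<in>K. if j = \<beta> then \<nu> j else 0)"
      by (intro sum.cong) (auto simp: a_def g0 lookup_single when_def)
    then show "\<nu> \<beta> = 0" using z b \<open>finite K\<close> by simp
  qed
  then obtain p where p: "eval p b0 \<noteq> 0" "\<And>b. eval p b \<noteq> 0 \<Longrightarrow> indepf K (a b) K"
    using indepf_open[where a=a, OF \<open>finite K\<close> pa] by blast
  have "b \<in> smooth_forms" if pb: "eval p b \<noteq> 0" for b
  proof (rule smooth_if_powers_in_ideal[of k])
    fix v :: 'n
    let ?\<beta> = "Poly_Mapping.single v k"
    obtain \<mu> where m: "\<And>\<alpha>. \<alpha> \<in> K \<Longrightarrow> coef (xmon ?\<beta>) \<alpha> = (\<Sum>j\<in>K. \<mu> j * a b j \<alpha>)"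
      using indepf_square[OF p(2)[OF pb] \<open>finite K\<close>, of "coef (xmon ?\<beta>)"] by blast
    have "xmon ?\<beta> = (\<Sum>j\<in>K. Cst (\<mu> j) * g b j)"
    proof (rule poly_mapping_eqI)
      fix \<alpha>
      show "coef (xmon ?\<beta>) \<alpha> = coef (\<Sum>j\<in>K. Cst (\<mu> j) * g b j) \<alpha>"
      proof (cases "\<alpha> \<in> K")
        case True
        then show ?thesis using m[OF True] by (simp add: lookup_sum coef_Cst_mult a_def)
      next
        case False
        then have "coef (g b j) \<alpha> = 0" for j by (simp add: g_hcomp coef_hcomp K_def)
        moreover have "coef (xmon ?\<beta>) \<alpha> = 0" using False by (auto simp: lookup_single when_def K_def)
        ultimately show ?thesis by (simp add: lookup_sum coef_Cst_mult)
      qed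
    qed
    also have "\<dots> \<in> ispan (f b)"
      unfolding g_def
      by (intro is_ideal_sum[OF is_ideal_ispan] is_idealD(3)[OF is_ideal_ispan] ispan_generator)
    finally show "Var v ^ k \<in> ispan (\<lambda>u. pderivx u (form b))" by (simp add: Var_power f_def)
  qed
  then show ?thesis using p(1) by blast
qed

lemma zariski_closed_singular: "zariski_closed (- smooth_forms :: (complex ^ 'n::finite dmon) set)"
  unfolding zariski_closed_iff 
proof (intro allI impI)
  fix b :: "complex ^ 'n dmon" assume "b \<notin> - smooth_forms"
  then obtain p where "eval p b \<noteq> 0" "\<forall>b. eval p b \<noteq> 0 \<longrightarrow> b \<in> smooth_forms"
    using smooth_forms_open by blast
  then show "\<exists>p. eval p b \<noteq> 0 \<and> (\<forall>c\<in>- smooth_forms. eval p c = 0)" by blast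
qed

section \<open>The twisted image under variation of the form\<close>

definition twisted_image :: "nat \<Rightarrow> complex ^ ('n::finite dmon) \<Rightarrow> ('n, complex) mpol set" where
  "twisted_image d b = {(\<Sum>u\<in>UNIV. dtw b u (s u)) | s. \<forall>u. degs (odeg TYPE('n) d) (s u)}"

text \<open>A degree count valid for every \<open>b\<close>. One variable is again exceptional, and
  there antisymmetry gives \<open>t = 0\<close>.\<close>

lemma degs_dtw_antisym:
  fixes t :: "'n::finite \<Rightarrow> 'n \<Rightarrow> ('n, complex) mpol"
  assumes "\<And>u w. t u w = - t w u" "\<And>u w. degs (tdegs TYPE('n) d) (t u w)"
  shows "degs (odeg TYPE('n) d) (dtw b w (t u w))"
proof (cases "CARD('n) = 1")
  case True
  then have uw: "u = w" by (metis card_1_singletonE UNIV_I singletonD)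
  have "t u w = 0" unfolding uw by (rule mpol_eq_minus_self) (rule assms(1))
  then show ?thesis by simp
next
  case False
  have n0: "CARD('n) > 0" by simp
  have "degs (odeg TYPE('n) d) (pderivx w (t u w))"
  proof (rule degs_pderivx[OF assms(2)])
    fix j assume "Suc j \<in> tdegs TYPE('n) d"
    then obtain i where i: "i < d" "j + CARD('n) = 1 + CARD('n) * i"
      using n0 by (auto simp: tdegs_def)
    then obtain i' where i': "i = Suc i'" using False n0 by (cases i) auto
    then have "j = 1 + CARD('n) * i'" using i by simp
    then show "j \<in> odeg TYPE('n) d" using i i' by (auto simp: odeg_def)
  qed
  moreover have "degs (odeg TYPE('n) d) (pderivx w (form b) * t u w)"
    by (rule degs_mult[OF degs_pderivx_form assms(2)]) (auto simp: tdegs_def odeg_def add.commute)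
  ultimately show ?thesis unfolding dtw_def by (rule degs_add)
qed

text \<open>Near a smooth \<open>b\<^sub>0\<close> the rank of \<open>s \<mapsto> \<Sum>\<^sub>u D\<^sub>u s\<^sub>u\<close> cannot rise: at \<open>b\<^sub>0\<close> all its relations come from
  antisymmetric \<open>t\<close>, and these relations deform polynomially with \<open>b\<close>.\<close>

lemma twisted_image_complement_open:
  fixes h :: "('n::finite, complex) mpol"
  assumes b0: "b0 \<in> smooth_forms" and h: "h \<notin> twisted_image d b0"
  shows "\<exists>p. eval p b0 \<noteq> 0 \<and> (\<forall>b. eval p b \<noteq> 0 \<longrightarrow> h \<notin> twisted_image d b)"
proof -
  define A where "A = {\<alpha> :: 'n \<Rightarrow>\<^sub>0 nat. mdeg \<alpha> \<in> odeg TYPE('n) d}"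
  have "odeg TYPE('n) d \<subseteq> {..1 + CARD('n) * d}" by (auto simp: odeg_def)
  then have "finite A" unfolding A_def by (intro finite_subset[OF _ finite_mdeg[of "1 + CARD('n) * d"]]) auto
  define J where "J = (UNIV :: 'n set) \<times> A"
  have finJ: "finite J" unfolding J_def using \<open>finite A\<close> by simp
  define col where "col b j = dtw b (fst j) (xmon (snd j))" for b :: "complex ^ 'n dmon" and j
  define a where "a b j = coef (col b j)" for b j
  have pa: "polyfun (\<lambda>b. a b j i)" for j i unfolding a_def col_def by (rule polyfun_coef_dtw)
  have dtw_col: "(\<Sum>u\<in>UNIV. dtw b u (s u)) = (\<Sum>j\<in>J. Cst (coef (s (fst j)) (snd j)) * col b j)"
    if "\<And>u. degs (odeg TYPE('n) d) (s u)" for s b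
  proof -
    have ex0: "s u = (\<Sum>\<alpha>\<in>A. Poly_Mapping.single \<alpha> (coef (s u) \<alpha>))" for u
      by (rule mpol_expand_finite[OF \<open>finite A\<close>]) (use that[of u] in \<open>auto simp: degs_def A_def in_keys_iff\<close>)
    have ex: "s u = (\<Sum>\<alpha>\<in>A. Cst (coef (s u) \<alpha>) * xmon \<alpha>)" for u
      by (rule trans[OF ex0]) (simp add: Cst_def Poly_Mapping.mult_single)
    have "dtw b u (s u) = (\<Sum>\<alpha>\<in>A. Cst (coef (s u) \<alpha>) * dtw b u (xmon \<alpha>))" for u
      by (subst ex) (simp only: dtw_sum dtw_Cst_mult)
    then show ?thesis
      by (simp add: J_def col_def sum.cartesian_product case_prod_beta)
  qed
  have in_twisted_image: "(\<Sum>j\<in>I. Cst (\<nu> j) * col b j) \<in> twisted_image d b" if I: "I \<subseteq> J" for I \<nu> b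
  proof -
    define s where "s u = (\<Sum>\<alpha>\<in>A. Poly_Mapping.single \<alpha> (if (u, \<alpha>) \<in> I then \<nu> (u, \<alpha>) else 0))" for u
    have cs: "coef (s u) \<alpha> = (if (u, \<alpha>) \<in> I then \<nu> (u, \<alpha>) else 0)" if "\<alpha> \<in> A" for u \<alpha>
      using that \<open>finite A\<close> by (simp add: s_def lookup_sum lookup_single when_def)
    have ds: "degs (odeg TYPE('n) d) (s u)" for u
      unfolding s_def by (intro degs_sum degs_single) (auto simp: A_def)
    have "(\<Sum>u\<in>UNIV. dtw b u (s u)) = (\<Sum>j\<in>J. Cst (if j \<in> I then \<nu> j else 0) * col b j)"
      unfolding dtw_col[OF ds] by (intro sum.cong) (auto simp: J_def cs)
    also have "\<dots> = (\<Sum>j\<in>I. Cst (\<nu> j) * col b j)"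
      using that finJ by (intro sum.mono_neutral_cong_right) auto
    finally show ?thesis unfolding twisted_image_def using ds by (intro CollectI exI[of _ s]) simp
  qed
  obtain I where I: "I \<subseteq> J" "indepf I (a b0) UNIV"
    "\<And>j. j \<in> J \<Longrightarrow> \<exists>\<nu>. \<forall>i\<in>UNIV. a b0 j i = (\<Sum>l\<in>I. \<nu> l * a b0 l i)"
    using indepf_maximal[OF finJ, of "a b0" UNIV] by blast
  have finI: "finite I" using I(1) finJ by (rule finite_subset)
  \<comment> \<open>\<open>h\<close> stays independent of the columns in \<open>I\<close>\<close>
  define a1 where "a1 b o' = (case o' of None \<Rightarrow> coef h | Some j \<Rightarrow> a b j)" for b o'
  have S1: "(\<Sum>o'\<in>Some ` I. \<nu> o' * a1 b o' i) = (\<Sum>j\<in>I. \<nu> (Some j) * a b j i)" for \<nu> b i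
    by (simp add: sum.reindex a1_def)
  have pa1: "polyfun (\<lambda>b. a1 b o' i)" for o' i
    unfolding a1_def using pa by (cases o') (simp_all add: polyfun_const)
  have ind1: "indepf (insert None (Some ` I)) (a1 b0) UNIV"
  proof (rule ccontr)
    assume dep: "\<not> indepf (insert None (Some ` I)) (a1 b0) UNIV"
    have "(\<lambda>j. a1 b0 (Some j)) = a b0" by (simp add: a1_def fun_eq_iff)
    then have ind: "indepf (Some ` I) (a1 b0) UNIV" using I(2) by (intro indepf_Some) simp
    have fin: "finite (Some ` I)" and none: "None \<notin> Some ` I" using finI by auto
    obtain \<nu> where "\<And>i. i \<in> UNIV \<Longrightarrow> a1 b0 None i = (\<Sum>o'\<in>Some ` I. \<nu> o' * a1 b0 o' i)"
      using indepf_insert_solve[OF ind fin none dep] by blast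
    then have "coef h i = (\<Sum>j\<in>I. \<nu> (Some j) * a b0 j i)" for i
      unfolding S1 by (simp add: a1_def)
    then have "h = (\<Sum>j\<in>I. Cst (\<nu> (Some j)) * col b0 j)"
      by (intro poly_mapping_eqI) (simp add: lookup_sum coef_Cst_mult a_def)
    then show False using h in_twisted_image[OF I(1)] by simp
  qed
  have fin1: "finite (insert None (Some ` I))" using finI by simp
  obtain p1 where p1: "eval p1 b0 \<noteq> 0"
    "\<And>b. eval p1 b \<noteq> 0 \<Longrightarrow> indepf (insert None (Some ` I)) (a1 b) UNIV"
    using indepf_open[of _ a1, OF fin1 pa1 ind1] by blast
  \<comment> \<open>the other columns stay dependent on those in \<open>I\<close>\<close>
  have "\<forall>j\<in>J. \<exists>\<nu>. \<forall>i. a b0 j i = (\<Sum>l\<in>I. \<nu> l * a b0 l i)"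
    using I(3) by simp
  from bchoice[OF this] obtain \<nu> where \<nu>: "\<And>j i. j \<in> J \<Longrightarrow> a b0 j i = (\<Sum>l\<in>I. \<nu> j l * a b0 l i)"
    by blast
  \<comment> \<open>The coefficients of the relation that expresses column \<open>j\<close> through
    the columns in \<open>I\<close> at \<open>b0\<close>.\<close>
  define s where "s j u = (\<Sum>\<alpha>\<in>A. Poly_Mapping.single \<alpha>
    ((if (u, \<alpha>) = j then 1 else 0) - (if (u, \<alpha>) \<in> I then \<nu> j (u, \<alpha>) else 0)))" for j u
  have cs: "coef (s j u) \<alpha> = (if (u, \<alpha>) = j then 1 else 0) - (if (u, \<alpha>) \<in> I then \<nu> j (u, \<alpha>) else 0)"
    if "\<alpha> \<in> A" for j u \<alpha>
    using that \<open>finite A\<close> by (simp add: s_def lookup_sum lookup_single when_def)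
  have ds: "degs (odeg TYPE('n) d) (s j u)" for j u
    unfolding s_def by (intro degs_sum degs_single) (auto simp: A_def)
  have rel: "(\<Sum>u\<in>UNIV. dtw b0 u (s j u)) = 0" if j: "j \<in> J" for j
  proof -
    have "(\<Sum>u\<in>UNIV. dtw b0 u (s j u)) =
        (\<Sum>k\<in>J. Cst ((if k = j then 1 else 0) - (if k \<in> I then \<nu> j k else 0)) * col b0 k)"
      unfolding dtw_col[OF ds] by (intro sum.cong) (auto simp: J_def cs)
    also have "\<dots> = 0"
    proof (rule poly_mapping_eqI)
      fix i
      have "coef (\<Sum>k\<in>J. Cst ((if k = j then 1 else 0) - (if k \<in> I then \<nu> j k else 0)) * col b0 k) i =
          (\<Sum>k\<in>J. (if k = j then a b0 k i else 0)) - (\<Sum>k\<in>J. (if k \<in> I then \<nu> j k * a b0 k i else 0))"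
        unfolding lookup_sum coef_Cst_mult a_def sum_subtractf[symmetric] by (intro sum.cong) (auto simp: left_diff_distrib)
      also have "(\<Sum>k\<in>J. (if k \<in> I then \<nu> j k * a b0 k i else 0)) = (\<Sum>k\<in>I. \<nu> j k * a b0 k i)"
        using finJ I(1) by (intro sum.mono_neutral_cong_right) auto
      finally show "coef (\<Sum>k\<in>J. Cst ((if k = j then 1 else 0) - (if k \<in> I then \<nu> j k else 0)) * col b0 k) i = coef 0 i"
        using \<nu>[OF j, of i] j finJ by simp
    qed
    finally show ?thesis .
  qed
  have "\<forall>j\<in>J. \<exists>t. (\<forall>u w. t u w = - t w u) \<and> (\<forall>u w. degs (tdegs TYPE('n) d) (t u w)) \<and>
      (\<forall>u. s j u = (\<Sum>w\<in>UNIV. dtw b0 w (t u w)))"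
    using dtw_exact[OF b0 ds rel] by blast
  from bchoice[OF this] obtain t where t: "\<forall>j\<in>J. (\<forall>u w. t j u w = - t j w u) \<and> (\<forall>u w. degs (tdegs TYPE('n) d) (t j u w)) \<and>
      (\<forall>u. s j u = (\<Sum>w\<in>UNIV. dtw b0 w (t j u w)))"
    by blast
  \<comment> \<open>The relation \<open>s j\<close> deformed: the same tensor, applied at
    \<open>b\<close> instead of \<open>b0\<close>.\<close>
  define \<rho> where "\<rho> b j u = (\<Sum>w\<in>UNIV. dtw b w (t j u w))" for b j u
  have d\<rho>: "degs (odeg TYPE('n) d) (\<rho> b j u)" if "j \<in> J" for b j u
    unfolding \<rho>_def using t that by (intro degs_sum degs_dtw_antisym) blast+
  have rel\<rho>: "(\<Sum>u\<in>UNIV. dtw b u (\<rho> b j u)) = 0" if "j \<in> J" for b j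
    unfolding \<rho>_def using t that by (intro dtw_antisym) blast
  have \<rho>0: "\<rho> b0 j u = s j u" if j: "j \<in> J" for j u
  proof -
    have "s j u = (\<Sum>w\<in>UNIV. dtw b0 w (t j u w))" using t j by blast
    then show ?thesis unfolding \<rho>_def by (rule sym)
  qed
  \<comment> \<open>A square change of coordinates: unit vectors for \<open>j\<close> in
    \<open>I\<close>, deformed relations otherwise. At \<open>b0\<close> it is unitriangular with
    respect to \<open>I\<close> and its complement, hence invertible.\<close>
  define r where "r b j k = (if j \<in> I then (if k = j then 1 else 0) else coef (\<rho> b j (fst k)) (snd k))"
    for b j k
  have pr: "polyfun (\<lambda>b. r b j k)" for j k
  proof (cases "j \<in> I")
    case True
    then show ?thesis by (simp add: r_def polyfun_const)
  next
    case False
    then show ?thesis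
      unfolding r_def \<rho>_def lookup_sum by (simp only: if_False) (intro polyfun_sum polyfun_coef_dtw)
  qed
  have "indepf J (r b0) J"
    unfolding indepf_def
  proof (intro allI impI)
    fix \<mu> assume z: "\<forall>k\<in>J. (\<Sum>j\<in>J. \<mu> j * r b0 j k) = 0"
    have r0: "r b0 j k = (if k = j then 1 else 0) - (if j \<notin> I \<and> k \<in> I then \<nu> j k else 0)" if "j \<in> J" "k \<in> J" for j k
      using that by (cases k) (auto simp: r_def \<rho>0 cs J_def)
    have out: "\<mu> k = 0" if k: "k \<in> J" "k \<notin> I" for k
    proof -
      have "(\<Sum>j\<in>J. \<mu> j * r b0 j k) = (\<Sum>j\<in>J. if j = k then \<mu> j else 0)"
        using k by (intro sum.cong) (auto simp: r0)
      then show ?thesis using z k finJ by simp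
    qed
    have "\<mu> k = 0" if k: "k \<in> J" "k \<in> I" for k
    proof -
      have "(\<Sum>j\<in>J. \<mu> j * r b0 j k) = (\<Sum>j\<in>J. if j = k then \<mu> j else 0)"
        using k out by (intro sum.cong) (auto simp: r0)
      then show ?thesis using z k finJ by simp
    qed
    then show "\<forall>j\<in>J. \<mu> j = 0" using out by blast
  qed
  then obtain p2 where p2: "eval p2 b0 \<noteq> 0" "\<And>b. eval p2 b \<noteq> 0 \<Longrightarrow> indepf J (r b) J"
    using indepf_open[where a=r, OF finJ pr] by blast
  have "h \<notin> twisted_image d b" if "eval (p1 * p2) b \<noteq> 0" for b
  proof
    have b: "eval p1 b \<noteq> 0" "eval p2 b \<noteq> 0" using that by (auto simp: eval_mult)
    assume "h \<in> twisted_image d b"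
    then obtain s' where s': "\<And>u. degs (odeg TYPE('n) d) (s' u)" "h = (\<Sum>u\<in>UNIV. dtw b u (s' u))"
      unfolding twisted_image_def by blast
    \<comment> \<open>In terms of the rows of \<open>r b\<close> the coefficients of
      \<open>s'\<close> split into columns from \<open>I\<close> and relations; the latter
      contribute nothing to \<open>h\<close>.\<close>
    obtain \<mu> where m: "\<And>k. k \<in> J \<Longrightarrow> coef (s' (fst k)) (snd k) = (\<Sum>j\<in>J. \<mu> j * r b j k)"
      using indepf_square[OF p2(2)[OF b(2)] finJ, of "\<lambda>k. coef (s' (fst k)) (snd k)"] by blast
    have R: "(\<Sum>k\<in>J. Cst (r b j k) * col b k) = (if j \<in> I then col b j else 0)" if j: "j \<in> J" for j
    proof (cases "j \<in> I")
      case True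
      have "(\<Sum>k\<in>J. Cst (r b j k) * col b k) = (\<Sum>k\<in>J. if k = j then col b k else 0)"
        using True by (intro sum.cong) (auto simp: r_def)
      then show ?thesis using True j finJ by simp
    next
      case False
      then have "(\<Sum>k\<in>J. Cst (r b j k) * col b k) = (\<Sum>u\<in>UNIV. dtw b u (\<rho> b j u))"
        unfolding dtw_col[OF d\<rho>[OF j]] by (simp add: r_def)
      then show ?thesis using rel\<rho>[OF j] False by simp
    qed
    have "h = (\<Sum>k\<in>J. Cst (\<Sum>j\<in>J. \<mu> j * r b j k) * col b k)"
      unfolding s'(2) dtw_col[OF s'(1)] by (intro sum.cong) (auto simp: m)
    also have "\<dots> = (\<Sum>k\<in>J. \<Sum>j\<in>J. Cst (\<mu> j) * (Cst (r b j k) * col b k))"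
      by (simp add: Cst_sum Cst_mult sum_distrib_right mult.assoc)
    also have "\<dots> = (\<Sum>j\<in>J. Cst (\<mu> j) * (\<Sum>k\<in>J. Cst (r b j k) * col b k))"
      unfolding sum_distrib_left by (rule sum.swap)
    also have "\<dots> = (\<Sum>j\<in>J. if j \<in> I then Cst (\<mu> j) * col b j else 0)"
      by (intro sum.cong) (auto simp: R)
    also have "\<dots> = (\<Sum>j\<in>I. Cst (\<mu> j) * col b j)"
      using finJ I(1) by (intro sum.mono_neutral_cong_right) auto
    finally have hI: "coef h i = (\<Sum>j\<in>I. \<mu> j * a b j i)" for i
      by (simp add: lookup_sum coef_Cst_mult a_def)
    define \<kappa> where "\<kappa> o' = (case o' of None \<Rightarrow> - 1 | Some j \<Rightarrow> \<mu> j)" for o'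
    have "(\<Sum>o'\<in>insert None (Some ` I). \<kappa> o' * a1 b o' i) = 0" for i
    proof -
      have "(\<Sum>o'\<in>insert None (Some ` I). \<kappa> o' * a1 b o' i) =
          \<kappa> None * a1 b None i + (\<Sum>o'\<in>Some ` I. \<kappa> o' * a1 b o' i)"
        using finI by (intro sum.insert) auto
      then show ?thesis unfolding S1 using hI[of i] by (simp add: \<kappa>_def a1_def)
    qed
    then have "\<kappa> None = 0" using indepfD[OF p1(2)[OF b(1)], of \<kappa> None] by blast
    then show False by (simp add: \<kappa>_def)
  qed
  then show ?thesis using p1(1) p2(1) by (intro exI[of _ "p1 * p2"]) (auto simp: eval_mult)
qed

section \<open>The operators \<open>Z\<^sub>i\<close>\<close>

text \<open>The vector field part of \<open>(A, t)\<close> as one matrix: \<open>euler\<close> is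
  \<open>1 / CARD('n)\<close> times the identity matrix, so the trace is \<open>t\<close> when
  \<open>A\<close> is in \<open>sl\<close>.\<close>

definition gmat :: "(complex ^ 'n ^ 'n::finite) \<times> complex \<Rightarrow> 'n \<Rightarrow> 'n \<Rightarrow> complex" where
  "gmat x u v = fst x $ u $ v + (if u = v then snd x / of_nat CARD('n) else 0)"

definition zth :: "(complex ^ 'n ^ 'n::finite) \<times> complex \<Rightarrow> ('n, complex) mpol \<Rightarrow> ('n, complex) mpol" where
  "zth x p = - (\<Sum>u\<in>UNIV. \<Sum>v\<in>UNIV. Cst (gmat x u v) * Var v * pderivx u p)"

text \<open>The value at \<open>a = b\<close> of \<open>Zvee x\<close> on an \<open>r\<close> that
  does not involve \<open>a\<close>.\<close>

definition Zb :: "complex ^ ('n::finite dmon) \<Rightarrow> (complex ^ 'n ^ 'n) \<times> complex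
    \<Rightarrow> ('n, complex) mpol \<Rightarrow> ('n, complex) mpol" where
  "Zb b x r = zth x r + zth x (form b) * r - Cst (snd x) * r"

lemma zth_eq: "zth (A, t) p = lin_vf A p - Cst t * euler p"
proof -
  have "(\<Sum>u\<in>UNIV. \<Sum>v\<in>UNIV. Cst (gmat (A, t) u v) * Var v * pderivx u p) =
      (\<Sum>u\<in>UNIV. \<Sum>v\<in>UNIV. Cst (A $ u $ v) * Var v * pderivx u p +
        (if u = v then Cst (t / of_nat CARD('a)) * (Var v * pderivx u p) else 0))"
    by (intro sum.cong refl) (auto simp: gmat_def Cst_add algebra_simps)
  also have "\<dots> = - lin_vf A p + (\<Sum>u\<in>UNIV. Cst (t / of_nat CARD('a)) * (Var u * pderivx u p))"
    by (simp add: sum.distrib lin_vf_def)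
  also have "(\<Sum>u\<in>UNIV. Cst (t / of_nat CARD('a)) * (Var u * pderivx u p)) = Cst t * euler p"
    by (simp add: euler_def sum_distrib_left mult.assoc flip: mult.assoc Cst_mult)
  finally show ?thesis by (simp add: zth_def)
qed

lemma zth_add: "zth x (p + q) = zth x p + zth x q"
  by (simp add: zth_def pderivx_add distrib_left sum.distrib)

lemma zth_Cst_mult: "zth x (Cst c * p) = Cst c * zth x p"
  unfolding zth_def pderivx_Cst_mult by (simp add: sum_distrib_left mult_ac)

lemma zth_Cst [simp]: "zth x (Cst c) = 0"
  by (simp add: zth_def)

lemma zth_0 [simp]: "zth x 0 = 0"
  using zth_Cst[of x 0] by simp

lemma zth_sum: "zth x (sum g A) = (\<Sum>y\<in>A. zth x (g y))"
  by (induction A rule: infinite_finite_induct) (auto simp: zth_add)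

lemma zth_mult: "zth x (p * q) = zth x p * q + p * zth x q"
proof -
  have "Cst (gmat x u v) * Var v * pderivx u (p * q) =
      (Cst (gmat x u v) * Var v * pderivx u p) * q + p * (Cst (gmat x u v) * Var v * pderivx u q)" for u v
    by (simp add: pderivx_mult algebra_simps)
  then show ?thesis by (simp add: zth_def sum.distrib sum_distrib_left sum_distrib_right)
qed

lemma degs_zth:
  assumes "degs A p"
  shows "degs A (zth x p)"
  unfolding zth_def
proof (intro degs_minus degs_sum)
  fix u v
  have "degs {k. Suc k \<in> A} (pderivx u p)" by (rule degs_pderivx[OF assms]) simp
  then have "degs A (Var v * pderivx u p)"
    by (rule degs_mult[of "{1}", rotated]) (auto simp: Var_def intro: degs_single)
  then show "degs A (Cst (gmat x u v) * Var v * pderivx u p)"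
    by (simp add: mult.assoc degs_Cst_mult)
qed

lemma zth_form: "zth x (form b) = (\<Sum>i\<in>UNIV. Cst (b $ i) * zth x (avee i))"
  by (simp add: form_def zth_sum zth_Cst_mult)

lemma Zb_add: "Zb b x (p + q) = Zb b x p + Zb b x q"
  and Zb_Cst_mult: "Zb b x (Cst c * p) = Cst c * Zb b x p"
  unfolding Zb_def zth_add zth_Cst_mult by (simp_all add: algebra_simps)

text \<open>Moving \<open>Var v\<close> past the derivative leaves the diagonal entries of
  \<open>gmat x\<close>. They add up to \<open>snd x\<close>, the \<open>sl\<close> part being
  trace-free, and this is the scalar term of \<open>Zb\<close>.\<close>

lemma Zb_eq_dtw:
  assumes "x \<in> ghat"
  shows "Zb b x r = - (\<Sum>u\<in>UNIV. \<Sum>v\<in>UNIV. Cst (gmat x u v) * dtw b u (Var v * r))"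
proof -
  have tr: "(\<Sum>u\<in>UNIV. gmat x u u) = snd x"
    using assms by (auto simp: gmat_def ghat_def sl_def trace_def sum.distrib)
  have "(\<Sum>u\<in>UNIV. \<Sum>v\<in>UNIV. Cst (gmat x u v) * dtw b u (Var v * r)) =
      (\<Sum>u\<in>UNIV. \<Sum>v\<in>UNIV. (if u = v then Cst (gmat x u v) * r else 0) +
        (Cst (gmat x u v) * Var v * pderivx u r + (Cst (gmat x u v) * Var v * pderivx u (form b)) * r))"
    unfolding dtw_Var_mult unfolding dtw_def by (intro sum.cong refl) (auto simp: algebra_simps)
  also have "\<dots> = (\<Sum>u\<in>UNIV. Cst (gmat x u u) * r) - zth x r - zth x (form b) * r"
    by (simp add: sum.distrib zth_def sum_distrib_right)
  also have "(\<Sum>u\<in>UNIV. Cst (gmat x u u) * r) = Cst (snd x) * r"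
    by (simp add: tr flip: sum_distrib_right Cst_sum)
  finally show ?thesis by (simp add: Zb_def)
qed

text \<open>The element acting as \<open>- x\<^sub>v \<partial>\<^sub>u\<close>.\<close>

definition gunit :: "'n \<Rightarrow> 'n \<Rightarrow> (complex ^ 'n ^ 'n::finite) \<times> complex" where
  "gunit u v = ((\<chi> i j. (if i = u \<and> j = v then 1 else 0) -
     (if u = v \<and> i = j then 1 / of_nat CARD('n) else 0)), if u = v then 1 else 0)"

lemma gmat_gunit: "gmat (gunit u v) i j = (if i = u \<and> j = v then 1 else 0)"
  by (simp add: gmat_def gunit_def)

lemma gunit_ghat: "gunit u v \<in> (ghat :: ((complex ^ 'n ^ 'n::finite) \<times> complex) set)"
proof -
  have "(\<Sum>i\<in>UNIV. (if i = v then 1 else 0) - 1 / of_nat CARD('n) :: complex) = 0"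
    by (simp add: sum_subtractf)
  then show ?thesis by (auto simp: ghat_def gunit_def sl_def trace_def intro!: sum.neutral)
qed

lemma dtw_eq_Zb: "dtw b u (Var v * r) = - Zb b (gunit u v) r"
proof -
  have "(\<Sum>i\<in>UNIV. \<Sum>j\<in>UNIV. Cst (gmat (gunit u v) i j) * dtw b i (Var j * r)) =
      (\<Sum>i\<in>UNIV. \<Sum>j\<in>UNIV. if j = v then (if i = u then dtw b i (Var j * r) else 0) else 0)"
    by (intro sum.cong refl) (auto simp: gmat_gunit)
  then show ?thesis by (simp add: Zb_eq_dtw[OF gunit_ghat])
qed

lemma gmat_linear:
  "gmat (x + y) u v = gmat x u v + gmat y u v"
  "gmat (scale_ghat c x) u v = c * gmat x u v"
  by (auto simp: gmat_def scale_ghat_def case_prod_beta add_divide_distrib distrib_left)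

lemma Zb_linear:
  "Zb b (x + y) r = Zb b x r + Zb b y r"
  "Zb b (scale_ghat c x) r = Cst c * Zb b x r"
proof -
  have a: "zth (x + y) p = zth x p + zth y p" for p
    by (simp add: zth_def gmat_linear Cst_add distrib_right sum.distrib)
  have c: "zth (scale_ghat c x) p = Cst c * zth x p" for p
    by (simp add: zth_def gmat_linear Cst_mult mult.assoc sum_distrib_left)
  show "Zb b (x + y) r = Zb b x r + Zb b y r" by (simp add: Zb_def a Cst_add algebra_simps)
  show "Zb b (scale_ghat c x) r = Cst c * Zb b x r"
    unfolding Zb_def c by (simp add: Cst_mult algebra_simps scale_ghat_def[of c] case_prod_beta)
qed

lemma degs_Zb:
  fixes r :: "('n::finite, complex) mpol"
  assumes "degs (edeg TYPE('n) d) r"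
  shows "degs (edeg TYPE('n) (Suc d)) (Zb b x r)"
proof -
  have "degs (edeg TYPE('n) (Suc d)) (zth x (form b) * r)"
    by (rule degs_mult[OF degs_zth[OF degs_form] assms])
      (auto simp: edeg_def intro: exI[of _ "Suc _"])
  moreover have "degs (edeg TYPE('n) (Suc d)) r"
    by (rule degs_mono[OF assms]) (auto simp: edeg_def intro: less_SucI)
  ultimately show ?thesis unfolding Zb_def by (intro degs_add degs_diff degs_zth degs_Cst_mult)
qed

text \<open>Degrees in \<open>odeg\<close> are positive, so some variable divides the monomial, and
  the quotient lies in \<open>R\<close>. This matches polynomials with degrees in
  \<open>odeg\<close> with sums of products \<open>Var v * r\<close>.\<close>

lemma odeg_mono_split:
  fixes \<alpha> :: "'n::finite \<Rightarrow>\<^sub>0 nat"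
  assumes "mdeg \<alpha> \<in> odeg TYPE('n) d"
  obtains v \<gamma> where "mdeg \<gamma> \<in> edeg TYPE('n) d" "\<And>c. Poly_Mapping.single \<alpha> (c::complex) = Var v * Poly_Mapping.single \<gamma> c"
proof -
  obtain i where i: "i < d" "mdeg \<alpha> = 1 + CARD('n) * i" using assms by (auto simp: odeg_def)
  then have "\<alpha> \<noteq> 0" by auto
  then obtain v where v: "coef \<alpha> v > 0" by (metis lookup_zero poly_mapping_eqI gr0I)
  have "mdeg (\<alpha> - ee v) = CARD('n) * i"
    using i(2) arg_cong[OF expo_split[OF v], of mdeg] by (simp add: mdeg_add)
  then have "mdeg (\<alpha> - ee v) \<in> edeg TYPE('n) d" using i(1) by (auto simp: edeg_def)
  then show thesis
    by (rule that[of _ v]) (use expo_split[OF v] in \<open>simp add: Var_single\<close>)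
qed

interpretation sp: vector_space "scale_poly :: complex \<Rightarrow> ('i, complex) mpol \<Rightarrow> _"
  by (rule vector_space_scale_poly)

interpretation gh: vector_space "scale_ghat :: complex \<Rightarrow> (complex ^ 'n ^ 'n::finite) \<times> complex \<Rightarrow> _"
  by (rule vector_space_scale_ghat)

text \<open>\<open>dtw_eq_Zb\<close> and \<open>Zb_eq_dtw\<close> give the two inclusions; linearity
  of \<open>Zb\<close> in both arguments reduces arbitrary elements to the chosen bases.\<close>

lemma twisted_image_eq_span:
  fixes xs :: "((complex ^ 'n ^ 'n::finite) \<times> complex) list"
  assumes xs: "is_basis scale_ghat ghat xs" and es': "is_basis scale_poly (R_le (int d - 1)) es'"
  shows "twisted_image d b = sp.span {Zb b x e | x e. x \<in> set xs \<and> e \<in> set es'}" (is "_ = sp.span ?G")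
proof
  have Zspan: "Zb b x r \<in> sp.span ?G" if x: "x \<in> ghat" and r: "r \<in> R_le (int d - 1)" for x r
  proof -
    have x': "x \<in> gh.span (set xs)" and r': "r \<in> sp.span (set es')"
      using xs es' x r by (simp_all add: is_basis_def)
    have 1: "Zb b y r \<in> sp.span ?G" if y: "y \<in> set xs" for y
      using r'
    proof (induction rule: sp.span_induct_alt)
      case base
      have "Zb b y 0 = 0" using Zb_Cst_mult[of b y 0 0] by simp
      then show ?case by (simp add: sp.span_zero)
    next
      case (step c e q)
      have eq: "Zb b y (scale_poly c e + q) = scale_poly c (Zb b y e) + Zb b y q"
        by (simp add: Zb_add Zb_Cst_mult scale_poly_def)
      have mem: "Zb b y e \<in> ?G" using y step(1) by blast
      show ?case unfolding eq by (rule sp.span_add[OF sp.span_scale[OF sp.span_base[OF mem]] step(2)])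
    qed
    show ?thesis
      using x'
    proof (induction rule: gh.span_induct_alt)
      case base
      have "Zb b 0 r = 0" using Zb_linear(2)[of b 0 0 r] by simp
      then show ?case by (simp add: sp.span_zero)
    next
      case (step c y z)
      have "Zb b (scale_ghat c y + z) r = scale_poly c (Zb b y r) + Zb b z r"
        by (simp add: Zb_linear scale_poly_def)
      then show ?case using step(2) 1[OF step(1)] by (simp only:) (intro sp.span_add sp.span_scale)
    qed
  qed
  have dtw_span: "dtw b u p \<in> sp.span ?G" if "degs (odeg TYPE('n) d) p" for u p
    using that
  proof (induction p rule: degs_induct)
    case zero
    then show ?case by (simp add: sp.span_zero)
  next
    case (single \<alpha> c)
    then obtain v \<gamma> where g: "mdeg \<gamma> \<in> edeg TYPE('n) d"
      "Poly_Mapping.single \<alpha> c = Var v * Poly_Mapping.single \<gamma> c"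
      by (rule odeg_mono_split) blast
    have "Poly_Mapping.single \<gamma> c \<in> R_le (int d - 1)"
      unfolding R_le_iff_degs by (rule degs_single[OF g(1)])
    then show ?case
      unfolding g(2) dtw_eq_Zb by (intro sp.span_neg Zspan gunit_ghat)
  next
    case (add p q)
    then show ?case by (simp add: dtw_add sp.span_add)
  qed
  show "twisted_image d b \<subseteq> sp.span ?G"
    unfolding twisted_image_def using dtw_span by (auto intro!: sp.span_sum)
  have sub: "sp.subspace (twisted_image d b)"
    unfolding sp.subspace_def
  proof (intro conjI ballI allI)
    show "0 \<in> twisted_image d b" unfolding twisted_image_def by (intro CollectI exI[of _ "\<lambda>_. 0"]) simp
    fix y assume "y \<in> twisted_image d b"
    then obtain s where s: "y = (\<Sum>u\<in>UNIV. dtw b u (s u))" "\<And>u. degs (odeg TYPE('n) d) (s u)"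
      unfolding twisted_image_def by blast
    show "scale_poly c y \<in> twisted_image d b" for c
      unfolding twisted_image_def using s(2)
      by (intro CollectI exI[of _ "\<lambda>u. Cst c * s u"])
        (simp add: s(1) scale_poly_def dtw_Cst_mult sum_distrib_left degs_Cst_mult)
    fix x assume "x \<in> twisted_image d b"
    then obtain s' where s': "x = (\<Sum>u\<in>UNIV. dtw b u (s' u))" "\<And>u. degs (odeg TYPE('n) d) (s' u)"
      unfolding twisted_image_def by blast
    show "x + y \<in> twisted_image d b"
      unfolding twisted_image_def using s(2) s'(2)
      by (intro CollectI exI[of _ "\<lambda>u. s' u + s u"])
        (simp add: s(1) s'(1) dtw_add sum.distrib degs_add)
  qed
  have "Zb b x e \<in> twisted_image d b" if x: "x \<in> set xs" and e: "e \<in> set es'" for x e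
  proof -
    have "x \<in> ghat" using xs x gh.span_superset by (auto simp: is_basis_def)
    have "e \<in> R_le (int d - 1)" using es' e sp.span_superset by (auto simp: is_basis_def)
    then have de: "degs (edeg TYPE('n) d) e" by (simp add: R_le_iff_degs)
    define s where "s u = (\<Sum>v\<in>UNIV. Cst (- gmat x u v) * (Var v * e))" for u
    have "degs (odeg TYPE('n) d) (s u)" for u
      unfolding s_def
    proof (intro degs_sum degs_Cst_mult)
      fix v
      have "degs {1} (Var v :: ('n, complex) mpol)" by (auto simp: Var_def intro: degs_single)
      then show "degs (odeg TYPE('n) d) (Var v * e)"
        by (rule degs_mult[OF _ de]) (auto simp: odeg_def edeg_def)
    qed
    moreover have "Zb b x e = (\<Sum>u\<in>UNIV. dtw b u (s u))"
      unfolding Zb_eq_dtw[OF \<open>x \<in> ghat\<close>]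
      unfolding s_def dtw_sum dtw_Cst_mult by (simp add: Cst_minus sum_negf)
    ultimately show ?thesis unfolding twisted_image_def by blast
  qed
  then have "?G \<subseteq> twisted_image d b" by blast
  then show "sp.span ?G \<subseteq> twisted_image d b" using sub by (rule sp.span_minimal)
qed

section \<open>Holomorphic functions and solutions\<close>

lemma norm_smult_axis: "norm (z *s axis i (1 :: complex) :: complex ^ 'i::finite) = norm z"
proof -
  have "z *s axis i (1 :: complex) = axis i z"
    by (simp add: Finite_Cartesian_Product.vec_eq_iff axis_def)
  moreover have "(\<Sum>j\<in>UNIV. (norm (axis i z $ j))\<^sup>2) = (\<Sum>j\<in>UNIV. if j = i then (norm z)\<^sup>2 else 0)"
    by (rule sum.cong) (auto simp: axis_def)
  ultimately show ?thesis by (simp add: norm_vec_def L2_set_def)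
qed

lemma bounded_linear_smult: "bounded_linear (\<lambda>z. z *s (v :: complex ^ 'i::finite))"
proof (intro linear_conv_bounded_linear[THEN iffD1] linearI)
  show "(x + y) *s v = x *s v + y *s v" for x y by (rule vec.scale_left_distrib)
  show "(r *\<^sub>R x) *s v = r *\<^sub>R (x *s v)" for r x
    by (simp add: Finite_Cartesian_Product.vec_eq_iff)
qed

lemma has_derivative_pd:
  assumes "(s has_derivative D) (at b)" "\<And>c v. D (c *s v) = c * D v"
  shows "((\<lambda>z. s (b + z *s axis i 1)) has_field_derivative D (axis i 1)) (at 0)"
    and "pd i s b = D (axis i 1)"
proof -
  have "((\<lambda>z. b + z *s axis i 1) has_derivative (\<lambda>z. z *s axis i 1)) (at 0)"
    using has_derivative_add[OF has_derivative_const bounded_linear_imp_has_derivative[OF bounded_linear_smult]]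
    by simp
  moreover have "(s has_derivative D) (at (b + 0 *s axis i 1))" using assms(1) by simp
  ultimately have "((\<lambda>z. s (b + z *s axis i 1)) has_derivative (\<lambda>z. D (z *s axis i 1))) (at 0)"
    by (rule has_derivative_compose)
  then show "((\<lambda>z. s (b + z *s axis i 1)) has_field_derivative D (axis i 1)) (at 0)"
    by (simp add: has_field_derivative_def assms(2) mult.commute[of _ "D (axis i 1)"])
  then show "pd i s b = D (axis i 1)" unfolding pd_def by (rule DERIV_imp_deriv)
qed

lemma holo_on_has_derivative:
  assumes "holo_on U s" "b \<in> U"
  shows "(s has_derivative (\<lambda>v. \<Sum>i\<in>UNIV. v $ i * pd i s b)) (at b)"
proof -
  obtain D where D: "(s has_derivative D) (at b)" "\<And>c v. D (c *s v) = c * D v"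
    using assms unfolding holo_on_def by blast
  interpret D: bounded_linear D using D(1) by (rule has_derivative_bounded_linear)
  have "D v = (\<Sum>i\<in>UNIV. v $ i * pd i s b)" for v
  proof -
    have "D v = D (\<Sum>i\<in>UNIV. v $ i *s axis i 1)" by (simp add: basis_expansion)
    also have "\<dots> = (\<Sum>i\<in>UNIV. v $ i * pd i s b)"
      unfolding D.sum D(2) has_derivative_pd(2)[OF D] ..
    finally show ?thesis .
  qed
  then have "D = (\<lambda>v. \<Sum>i\<in>UNIV. v $ i * pd i s b)" by (rule ext)
  then show ?thesis using D(1) by simp
qed

lemma holo_onI:
  assumes "\<And>b. b \<in> U \<Longrightarrow> (s has_derivative (\<lambda>v. \<Sum>i\<in>UNIV. v $ i * g i b)) (at b)"
  shows "holo_on U s" "\<And>b i. b \<in> U \<Longrightarrow> pd i s b = g i b"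
proof -
  have lin: "(\<Sum>i\<in>UNIV. (c *s v) $ i * g i b) = c * (\<Sum>i\<in>UNIV. v $ i * g i b)" for c v b
    by (simp add: sum_distrib_left mult.assoc)
  show "holo_on U s" unfolding holo_on_def using assms lin by blast
  show "pd i s b = g i b" if "b \<in> U" for b i
  proof -
    have "(\<Sum>j\<in>UNIV. axis i 1 $ j * g j b) = (\<Sum>j\<in>UNIV. if j = i then g j b else 0)"
      by (rule sum.cong) (auto simp: axis_def)
    then show ?thesis using has_derivative_pd(2)[OF assms[OF that] lin, of i] by simp
  qed
qed

lemma holo_on_continuous: "holo_on U s \<Longrightarrow> continuous_on U s"
  by (rule continuous_at_imp_continuous_on)
    (use holo_on_has_derivative has_derivative_continuous in blast)

lemma pd_cong:
  assumes "open U" "b \<in> U" "\<And>x. x \<in> U \<Longrightarrow> s x = s' x"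
  shows "pd i s b = pd i s' b"
proof -
  have "open ((\<lambda>z. b + z *s axis i 1) -` U)"
    by (intro open_vimage assms(1) continuous_intros
      linear_continuous_on[OF bounded_linear_smult])
  then have "\<forall>\<^sub>F z in nhds 0. z \<in> (\<lambda>z. b + z *s axis i 1) -` U"
    by (rule eventually_nhds_in_open) (use assms(2) in simp)
  then have "\<forall>\<^sub>F z in nhds 0. s (b + z *s axis i 1) = s' (b + z *s axis i 1)"
    by eventually_elim (use assms(3) in auto)
  then show ?thesis unfolding pd_def by (rule deriv_cong_ev) simp
qed

lemma holo_on_cong:
  assumes "open U" "\<And>x. x \<in> U \<Longrightarrow> s x = s' x" "holo_on U s"
  shows "holo_on U s'"
proof (rule holo_onI(1))
  fix b assume b: "b \<in> U"
  show "(s' has_derivative (\<lambda>v. \<Sum>i\<in>UNIV. v $ i * pd i s b)) (at b)"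
    by (rule has_derivative_transform_within_open[OF holo_on_has_derivative[OF assms(3) b] assms(1) b assms(2)])
qed

section \<open>Cauchy's formula and regularity of partial derivatives\<close>

definition circ :: "real \<Rightarrow> real \<Rightarrow> complex" where
  "circ r t = of_real r * exp (2 * of_real pi * \<i> * of_real t)"

lemma norm_circ: "r > 0 \<Longrightarrow> norm (circ r t) = r"
  by (simp add: circ_def norm_mult)

lemma circ_nonzero: "r > 0 \<Longrightarrow> circ r t \<noteq> 0"
  by (simp add: circ_def)

lemma continuous_on_circ [continuous_intros]:
  "continuous_on A g \<Longrightarrow> continuous_on A (\<lambda>x. circ r (g x))"
  unfolding circ_def by (intro continuous_intros)

text \<open>Cauchy's formula for the derivative on a complex line. The contour is parametrized over
  a fixed interval, so that \<open>b\<close> can be varied under the integral sign.\<close>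

lemma Cauchy_pd:
  assumes s: "holo_on U s" and r: "r > 0" and sub: "cball b r \<subseteq> U"
  shows "pd i s b = integral (cbox 0 1) (\<lambda>t. s (b + circ r t *s axis i 1) / circ r t)"
proof -
  define g where "g z = s (b + z *s axis i 1)" for z
  have inU: "b + z *s axis i 1 \<in> U" if "z \<in> cball 0 r" for z
    using that sub by (auto simp: subset_eq dist_norm norm_smult_axis)
  have der: "(g has_field_derivative pd i s (b + z *s axis i 1)) (at z)" if z: "z \<in> cball 0 r" for z
  proof -
    have "((\<lambda>w. s ((b + z *s axis i 1) + w *s axis i 1)) has_field_derivative pd i s (b + z *s axis i 1)) (at 0)"
    proof -
      obtain D where D: "(s has_derivative D) (at (b + z *s axis i 1))" "\<And>c v. D (c *s v) = c * D v"
        using s inU[OF z] unfolding holo_on_def by blast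
      show ?thesis using has_derivative_pd[OF D, of i] by simp
    qed
    then have "((\<lambda>w. g (z + w)) has_field_derivative pd i s (b + z *s axis i 1)) (at 0)"
      by (simp add: g_def vec.scale_left_distrib add.assoc)
    then show ?thesis using DERIV_at_within_shift[of g _ z 0 UNIV] by simp
  qed
  have "continuous_on (cball 0 r) g"
    by (rule continuous_at_imp_continuous_on) (use der DERIV_isCont in blast)
  moreover have "g holomorphic_on ball 0 r"
    unfolding holomorphic_on_def field_differentiable_def
    using der by (meson ball_subset_cball has_field_derivative_at_within subsetD)
  ultimately have *: "(g has_field_derivative (1 / (2 * of_real pi * \<i>) * contour_integral (circlepath 0 r) (\<lambda>u. g u / (u - 0)^2))) (at 0)"
    by (rule Cauchy_derivative_integral_circlepath) (use r in simp)
  have "pd i s b = 1 / (2 * of_real pi * \<i>) * contour_integral (circlepath 0 r) (\<lambda>u. g u / (u - 0)^2)"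
    using DERIV_unique[OF * der[of 0]] r by simp
  also have "contour_integral (circlepath 0 r) (\<lambda>u. g u / (u - 0)^2) =
      integral {0..1} (\<lambda>t. (2 * of_real pi * \<i>) * (g (circ r t) / circ r t))"
    unfolding contour_integral_integral
  proof (rule integral_cong)
    fix t :: real
    have c: "circlepath 0 r t = circ r t" by (simp add: circlepath circ_def)
    have v: "vector_derivative (circlepath 0 r) (at t) = 2 * of_real pi * \<i> * circ r t"
      by (simp add: vector_derivative_circlepath circ_def)
    show "g (circlepath 0 r t) / (circlepath 0 r t - 0)\<^sup>2 * vector_derivative (circlepath 0 r) (at t) =
        (2 * of_real pi * \<i>) * (g (circ r t) / circ r t)"
      unfolding c v using circ_nonzero[OF r, of t] by (simp add: power2_eq_square field_simps)
  qed
  also have "\<dots> = (2 * of_real pi * \<i>) * integral {0..1} (\<lambda>t. g (circ r t) / circ r t)"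
    by (rule integral_mult_right)
  finally show ?thesis by (simp add: g_def cbox_interval)
qed

lemma continuous_on_shift_circ:
  assumes "continuous_on U s" "\<And>x t. x \<in> V \<Longrightarrow> x + circ r t *s axis i 1 \<in> U" "r > 0"
  shows "continuous_on (V \<times> cbox 0 1) (\<lambda>(x, t). s (x + circ r t *s axis i (1::complex)) / circ r t)"
proof -
  have "continuous_on (V \<times> cbox 0 1) (\<lambda>x. s (fst x + circ r (snd x) *s axis i 1) / circ r (snd x))"
    by (intro continuous_on_divide continuous_on_compose2[OF assms(1)] continuous_intros
        continuous_on_compose2[OF linear_continuous_on[OF bounded_linear_smult, of UNIV]])
      (use assms(2,3) circ_nonzero in auto)
  then show ?thesis by (simp add: case_prod_beta)
qed

text \<open>The factor two leaves room to move the centre by less than \<open>r\<close> and then to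
  go around a circle of radius \<open>r\<close>.\<close>

lemma shift_circ_in:
  assumes "r > 0" "cball b (2 * r) \<subseteq> U" "x \<in> ball b r"
  shows "x + circ r t *s axis i 1 \<in> U" "cball x r \<subseteq> U"
proof -
  show c: "cball x r \<subseteq> U"
  proof
    fix y assume "y \<in> cball x r"
    then have "dist b y \<le> 2 * r" using assms(3) dist_triangle[of b y x] by simp
    then show "y \<in> U" using assms(2) by auto
  qed
  have "x + circ r t *s axis i 1 \<in> cball x r"
    using assms(1) by (simp add: dist_norm norm_smult_axis norm_circ)
  then show "x + circ r t *s axis i 1 \<in> U" using c by blast
qed

lemma open_cball_2:
  assumes "open U" "b \<in> (U :: 'a::metric_space set)"
  obtains r where "r > 0" "cball b (2 * r) \<subseteq> U"
proof -
  obtain e where "e > 0" "cball b e \<subseteq> U" using assms open_contains_cball by blast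
  then show thesis by (intro that[of "e / 2"]) auto
qed

text \<open>\<open>holo_on\<close> asks only for complex differentiability at each point; continuity
  of the derivatives comes from their integral representation.\<close>

lemma continuous_on_pd:
  assumes "holo_on U s" "open U"
  shows "continuous_on U (pd i s)"
  unfolding continuous_on_eq_continuous_at[OF assms(2)]
proof
  fix b assume "b \<in> U"
  then obtain r where r: "r > 0" "cball b (2 * r) \<subseteq> U" using open_cball_2 assms(2) by blast
  have c: "continuous_on (ball b r) (\<lambda>x. integral (cbox 0 1) (\<lambda>t. s (x + circ r t *s axis i 1) / circ r t))"
    by (intro integral_continuous_on_param continuous_on_shift_circ[OF holo_on_continuous[OF assms(1)] _ r(1)]
      shift_circ_in(1)[OF r])
  have "integral (cbox 0 1) (\<lambda>t. s (x + circ r t *s axis i 1) / circ r t) = pd i s x"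
    if "x \<in> ball b r" for x
    by (rule Cauchy_pd[OF assms(1) r(1) shift_circ_in(2)[OF r that], symmetric])
  with c have "continuous_on (ball b r) (pd i s)" by (rule continuous_on_eq)
  then show "isCont (pd i s) b"
    using r(1) by (simp add: continuous_on_eq_continuous_at)
qed

text \<open>The Leibniz rule for the integral of \<open>Cauchy_pd\<close>. The derivative is left in
  integral form because the same formula, read backwards, yields the symmetry of second
  derivatives.\<close>

lemma pd_has_derivative:
  fixes s :: "complex ^ 'i::finite \<Rightarrow> complex"
  assumes s: "holo_on U s" and U: "open U" and b: "b \<in> U" and r: "r > 0" "cball b (2 * r) \<subseteq> U"
  shows "(pd i s has_derivative
    (\<lambda>v. \<Sum>j\<in>UNIV. v $ j * integral (cbox 0 1) (\<lambda>t. pd j s (b + circ r t *s axis i 1) / circ r t))) (at b)"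
proof -
  \<comment> \<open>The derivative of the integrand must be a continuous family of bounded linear
    maps; assembling it from coordinate functionals reduces this to the continuity of
    \<open>pd j s\<close>.\<close>
  define L where "L j = Blinfun (\<lambda>v :: complex ^ 'i. v $ j)" for j
  have L: "blinfun_apply (L j) v = v $ j" for j v
    unfolding L_def by (subst bounded_linear_Blinfun_apply) (auto intro: bounded_linear_vec_nth)
  define c where "c j x t = pd j s (x + circ r t *s axis i 1) / circ r t" for j x t
  define fx where "fx x t = (\<Sum>j\<in>UNIV. blinfun_mult_right (c j x t) o\<^sub>L L j)" for x t
  have fx_apply: "blinfun_apply (fx x t) v = (\<Sum>j\<in>UNIV. c j x t * v $ j)" for x t v
    by (simp add: fx_def blinfun.sum_left L)
  have cc: "continuous_on (ball b r \<times> cbox 0 1) (\<lambda>(x, t). c j x t)" for j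
    unfolding c_def
    by (intro continuous_on_shift_circ[OF continuous_on_pd[OF s U] _ r(1)] shift_circ_in(1)[OF r])
  have cfx: "continuous_on (ball b r \<times> cbox 0 1) (\<lambda>(x, t). fx x t)"
  proof -
    have "continuous_on (ball b r \<times> cbox 0 1) (\<lambda>x. \<Sum>j\<in>UNIV. blinfun_mult_right (c j (fst x) (snd x)) o\<^sub>L L j)"
      by (intro continuous_on_sum bounded_bilinear.continuous_on[OF bounded_bilinear_blinfun_compose]
        bounded_linear.continuous_on[OF bounded_linear_blinfun_mult_right] continuous_on_const)
        (use cc in \<open>simp add: case_prod_beta\<close>)
    then show ?thesis by (simp add: fx_def case_prod_beta)
  qed
  have "((\<lambda>x. integral (cbox 0 1) (\<lambda>t. s (x + circ r t *s axis i 1) / circ r t)) has_derivative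
      blinfun_apply (integral (cbox 0 1) (fx b))) (at b within ball b r)"
  proof (rule leibniz_rule[OF _ _ cfx])
    fix x t assume x: "x \<in> ball b r" and t: "t \<in> cbox 0 (1::real)"
    have "(s has_derivative (\<lambda>v. \<Sum>j\<in>UNIV. v $ j * pd j s (x + circ r t *s axis i 1))) (at (x + circ r t *s axis i 1))"
      by (rule holo_on_has_derivative[OF s shift_circ_in(1)[OF r x]])
    moreover have "((\<lambda>x. x + circ r t *s axis i 1) has_derivative (\<lambda>v. v)) (at x)"
      by (intro derivative_eq_intros | simp)+
    ultimately have "((\<lambda>x. s (x + circ r t *s axis i 1)) has_derivative
        (\<lambda>v. \<Sum>j\<in>UNIV. v $ j * pd j s (x + circ r t *s axis i 1))) (at x)"
      using has_derivative_compose[of "\<lambda>x. x + circ r t *s axis i 1" "\<lambda>v. v" x UNIV s] by simp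
    then have "((\<lambda>x. s (x + circ r t *s axis i 1) * (1 / circ r t)) has_derivative
        (\<lambda>v. (\<Sum>j\<in>UNIV. v $ j * pd j s (x + circ r t *s axis i 1)) * (1 / circ r t))) (at x)"
      by (rule has_derivative_mult_left)
    moreover have "(\<lambda>v. (\<Sum>j\<in>UNIV. v $ j * pd j s (x + circ r t *s axis i 1)) * (1 / circ r t)) =
        blinfun_apply (fx x t)"
      by (simp add: fun_eq_iff fx_apply c_def sum_divide_distrib mult.commute)
    ultimately have "((\<lambda>x. s (x + circ r t *s axis i 1) / circ r t) has_derivative blinfun_apply (fx x t)) (at x)"
      by simp
    then show "((\<lambda>x. s (x + circ r t *s axis i 1) / circ r t) has_derivative blinfun_apply (fx x t)) (at x within ball b r)"
      by (rule has_derivative_at_withinI)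
  next
    fix x assume x: "x \<in> ball b r"
    have "continuous_on (cbox 0 1) (\<lambda>t. (\<lambda>(x, t). s (x + circ r t *s axis i 1) / circ r t) (x, t))"
      by (rule continuous_on_compose2[OF continuous_on_shift_circ[where V="ball b r", OF holo_on_continuous[OF s]
          shift_circ_in(1)[OF r] r(1)]]) (use x in \<open>auto intro!: continuous_intros\<close>)
    then show "(\<lambda>t. s (x + circ r t *s axis i 1) / circ r t) integrable_on cbox 0 1"
      by (intro integrable_continuous) simp
  qed (use r in auto)
  then have "((\<lambda>x. integral (cbox 0 1) (\<lambda>t. s (x + circ r t *s axis i 1) / circ r t)) has_derivative
      blinfun_apply (integral (cbox 0 1) (fx b))) (at b)"
    using r(1) by (simp add: at_within_ball)
  then have D: "(pd i s has_derivative blinfun_apply (integral (cbox 0 1) (fx b))) (at b)"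
    by (rule has_derivative_transform_within_open[OF _ open_ball[of b r]])
      (use r Cauchy_pd[OF s r(1) shift_circ_in(2)[OF r], of _ i] in simp_all)
  have ccb: "continuous_on (cbox 0 1) (c j b)" for j
  proof -
    have "continuous_on (cbox 0 1) (\<lambda>t. (\<lambda>(x, t). c j x t) (b, t))"
      by (rule continuous_on_compose2[OF cc]) (use r in \<open>auto intro!: continuous_intros\<close>)
    then show ?thesis by simp
  qed
  have "continuous_on (cbox 0 1) (\<lambda>t. (\<lambda>(x, t). fx x t) (b, t))"
    by (rule continuous_on_compose2[OF cfx]) (use r in \<open>auto intro!: continuous_intros\<close>)
  then have int: "fx b integrable_on cbox 0 1" by (intro integrable_continuous) simp
  have "blinfun_apply (integral (cbox 0 1) (fx b)) v =
      (\<Sum>j\<in>UNIV. v $ j * integral (cbox 0 1) (c j b))" for v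
  proof -
    have "blinfun_apply (integral (cbox 0 1) (fx b)) v = integral (cbox 0 1) (\<lambda>t. \<Sum>j\<in>UNIV. c j b t * v $ j)"
      by (subst blinfun_apply_integral[OF int]) (simp only: fx_apply)
    also have "\<dots> = (\<Sum>j\<in>UNIV. integral (cbox 0 1) (\<lambda>t. c j b t * v $ j))"
      by (intro integral_sum integrable_continuous continuous_intros ccb) auto
    also have "\<dots> = (\<Sum>j\<in>UNIV. v $ j * integral (cbox 0 1) (c j b))"
      by (simp add: mult.commute)
    finally show ?thesis .
  qed
  then have "blinfun_apply (integral (cbox 0 1) (fx b)) =
      (\<lambda>v. \<Sum>j\<in>UNIV. v $ j * integral (cbox 0 1) (c j b))" by (rule ext)
  then show ?thesis using D by (simp only: c_def[abs_def])
qed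

lemma holo_on_pd:
  assumes "holo_on U s" "open U"
  shows "holo_on U (pd i s)"
  unfolding holo_on_def
proof
  fix b assume b: "b \<in> U"
  then obtain r where r: "r > 0" "cball b (2 * r) \<subseteq> U" using open_cball_2 assms(2) by blast
  let ?D = "\<lambda>v. \<Sum>j\<in>UNIV. v $ j * integral (cbox 0 1) (\<lambda>t. pd j s (b + circ r t *s axis i 1) / circ r t)"
  have "?D (c *s v) = c * ?D v" for c v by (simp add: sum_distrib_left mult.assoc)
  then show "\<exists>D. (pd i s has_derivative D) (at b) \<and> (\<forall>c v. D (c *s v) = c * D v)"
    using pd_has_derivative[OF assms b r, of i] by blast
qed

text \<open>Both sides are the Cauchy integral of \<open>pd j s\<close> in direction
  \<open>i\<close>.\<close>

lemma pd_commute: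
  assumes "holo_on U s" "open U" "b \<in> U"
  shows "pd j (pd i s) b = pd i (pd j s) b"
proof -
  obtain r where r: "r > 0" "cball b (2 * r) \<subseteq> U" using open_cball_2 assms(2,3) by blast
  have "pd j (pd i s) b = integral (cbox 0 1) (\<lambda>t. pd j s (b + circ r t *s axis i 1) / circ r t)"
    by (rule holo_onI(2)[where U="{b}"]) (use pd_has_derivative[OF assms r, of i] in auto)
  also have "\<dots> = pd i (pd j s) b"
    by (rule Cauchy_pd[OF holo_on_pd[OF assms(1,2)] r(1), symmetric])
      (use shift_circ_in(2)[OF r, of b] r in simp)
  finally show ?thesis .
qed

lemma holo_on_add:
  assumes "holo_on U f" "holo_on U g"
  shows "holo_on U (\<lambda>b. f b + g b)" "b \<in> U \<Longrightarrow> pd i (\<lambda>b. f b + g b) b = pd i f b + pd i g b"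
proof -
  have *: "((\<lambda>b. f b + g b) has_derivative (\<lambda>v. \<Sum>i\<in>UNIV. v $ i * (pd i f b + pd i g b))) (at b)"
    if "b \<in> U" for b
    using has_derivative_add[OF holo_on_has_derivative[OF assms(1) that] holo_on_has_derivative[OF assms(2) that]]
    by (simp add: distrib_left sum.distrib)
  show "holo_on U (\<lambda>b. f b + g b)" "b \<in> U \<Longrightarrow> pd i (\<lambda>b. f b + g b) b = pd i f b + pd i g b"
    using holo_onI[of U "\<lambda>b. f b + g b", OF *] by auto
qed

lemma holo_on_mult:
  assumes "holo_on U f" "holo_on U g"
  shows "holo_on U (\<lambda>b. f b * g b)"
    "b \<in> U \<Longrightarrow> pd i (\<lambda>b. f b * g b) b = f b * pd i g b + pd i f b * g b"
proof -
  have *: "((\<lambda>b. f b * g b) has_derivative (\<lambda>v. \<Sum>i\<in>UNIV. v $ i * (f b * pd i g b + pd i f b * g b))) (at b)"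
    if "b \<in> U" for b
    using has_derivative_mult[OF holo_on_has_derivative[OF assms(1) that] holo_on_has_derivative[OF assms(2) that]]
    by (simp add: distrib_left sum.distrib sum_distrib_left sum_distrib_right mult_ac)
  show "holo_on U (\<lambda>b. f b * g b)" "b \<in> U \<Longrightarrow> pd i (\<lambda>b. f b * g b) b = f b * pd i g b + pd i f b * g b"
    using holo_onI[of U "\<lambda>b. f b * g b", OF *] by auto
qed

lemma holo_on_const: "holo_on U (\<lambda>_. c)" and pd_const [simp]: "pd i (\<lambda>_. c) b = 0"
proof -
  have *: "((\<lambda>_. c) has_derivative (\<lambda>v. \<Sum>i\<in>UNIV. v $ i * 0)) (at b)" for b :: "complex ^ 'i" by simp
  show "holo_on U (\<lambda>_. c)" using holo_onI(1)[of U "\<lambda>_. c", OF *] .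
  show "pd i (\<lambda>_. c) b = 0" using holo_onI(2)[of UNIV "\<lambda>_. c", OF *] by simp
qed

lemma holo_on_coord: "holo_on U (\<lambda>b :: complex ^ 'i::finite. b $ j)"
  and pd_coord: "pd i (\<lambda>b :: complex ^ 'i. b $ j) b = (if i = j then 1 else 0)"
proof -
  have *: "((\<lambda>b. b $ j) has_derivative (\<lambda>v. \<Sum>i\<in>UNIV. v $ i * (if i = j then 1 else 0))) (at b)"
    for b :: "complex ^ 'i"
    using bounded_linear_imp_has_derivative[OF bounded_linear_vec_nth[of j]]
    by (simp add: if_distrib cong: if_cong)
  show "holo_on U (\<lambda>b. b $ j)" using holo_onI(1)[of U "\<lambda>b. b $ j", OF *] .
  show "pd i (\<lambda>b. b $ j) b = (if i = j then 1 else 0)" using holo_onI(2)[of UNIV "\<lambda>b. b $ j", OF *] by simp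
qed

lemma holo_on_sum:
  assumes "\<And>x. x \<in> X \<Longrightarrow> holo_on U (f x)"
  shows "holo_on U (\<lambda>b. \<Sum>x\<in>X. f x b)"
    "b \<in> U \<Longrightarrow> pd i (\<lambda>b. \<Sum>x\<in>X. f x b) b = (\<Sum>x\<in>X. pd i (f x) b)"
proof -
  have "holo_on U (\<lambda>b. \<Sum>x\<in>X. f x b) \<and> (b \<in> U \<longrightarrow> pd i (\<lambda>b. \<Sum>x\<in>X. f x b) b = (\<Sum>x\<in>X. pd i (f x) b))"
    using assms
  proof (induction X rule: infinite_finite_induct)
    case (insert x F)
    then have "holo_on U (f x)" "holo_on U (\<lambda>b. \<Sum>x\<in>F. f x b)" by auto
    from holo_on_add[OF this] show ?case using insert by simp
  qed (simp_all add: holo_on_const)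
  then show "holo_on U (\<lambda>b. \<Sum>x\<in>X. f x b)"
    "b \<in> U \<Longrightarrow> pd i (\<lambda>b. \<Sum>x\<in>X. f x b) b = (\<Sum>x\<in>X. pd i (f x) b)" by auto
qed

section \<open>Iterated derivatives and differential operators\<close>

definition pd_list :: "'i::finite list \<Rightarrow> ('i \<Rightarrow>\<^sub>0 nat) \<Rightarrow> (complex ^ 'i \<Rightarrow> complex) \<Rightarrow> complex ^ 'i \<Rightarrow> complex" where
  "pd_list is \<alpha> s = foldr (\<lambda>i. pd i ^^ Poly_Mapping.lookup \<alpha> i) is s"

lemma holo_on_pd_funpow: "open U \<Longrightarrow> holo_on U s \<Longrightarrow> holo_on U ((pd i ^^ k) s)"
  by (induction k) (auto intro: holo_on_pd)

lemma holo_on_pd_list: "open U \<Longrightarrow> holo_on U s \<Longrightarrow> holo_on U (pd_list is \<alpha> s)"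
  by (induction "is") (auto simp: pd_list_def intro: holo_on_pd_funpow)

lemma pd_funpow_cong:
  "open U \<Longrightarrow> (\<And>x. x \<in> U \<Longrightarrow> s x = s' x) \<Longrightarrow> b \<in> U \<Longrightarrow> (pd i ^^ k) s b = (pd i ^^ k) s' b"
proof (induction k arbitrary: b)
  case (Suc k)
  show ?case using pd_cong[OF Suc.prems(1,3), of "(pd i ^^ k) s" "(pd i ^^ k) s'" i] Suc by simp
qed simp

lemma pd_funpow_commute:
  "open U \<Longrightarrow> holo_on U s \<Longrightarrow> b \<in> U \<Longrightarrow> (pd i ^^ k) (pd j s) b = pd j ((pd i ^^ k) s) b"
proof (induction k arbitrary: b)
  case (Suc k)
  have "(pd i ^^ Suc k) (pd j s) b = pd i (pd j ((pd i ^^ k) s)) b"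
    using pd_cong[OF Suc.prems(1,3), of "(pd i ^^ k) (pd j s)" "pd j ((pd i ^^ k) s)" i] Suc by simp
  also have "\<dots> = pd j (pd i ((pd i ^^ k) s)) b"
    by (rule pd_commute[OF holo_on_pd_funpow[OF Suc.prems(1,2)] Suc.prems(1,3)])
  finally show ?case by simp
qed simp

lemma pd_list_cong_expo:
  "(\<And>i. i \<in> set is \<Longrightarrow> Poly_Mapping.lookup \<alpha> i = Poly_Mapping.lookup \<beta> i) \<Longrightarrow> pd_list is \<alpha> s = pd_list is \<beta> s"
  by (induction "is") (auto simp: pd_list_def)

text \<open>\<open>pd_mon\<close> leaves the order of the coordinates to a choice; in any order the
  additional derivative is commuted outwards past the coordinates preceding
  \<open>j\<close>.\<close>

lemma pd_list_add:
  assumes U: "open U" "holo_on U s"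
  shows "distinct is \<Longrightarrow> j \<in> set is \<Longrightarrow> b \<in> U \<Longrightarrow>
    pd_list is (Poly_Mapping.single j 1 + \<alpha>) s b = pd j (pd_list is \<alpha> s) b"
proof (induction "is" arbitrary: b)
  case (Cons i "is")
  let ?\<beta> = "Poly_Mapping.single j 1 + \<alpha>"
  have step: "pd_list (i # is) \<gamma> s = (pd i ^^ Poly_Mapping.lookup \<gamma> i) (pd_list is \<gamma> s)" for \<gamma>
    by (simp add: pd_list_def)
  show ?case
  proof (cases "i = j")
    case True
    then have "pd_list is ?\<beta> s = pd_list is \<alpha> s"
      using Cons.prems(1) by (intro pd_list_cong_expo) (auto simp: lookup_add lookup_single when_def)
    then show ?thesis unfolding step using True by (simp add: lookup_add)
  next
    case False
    then have c: "Poly_Mapping.lookup ?\<beta> i = Poly_Mapping.lookup \<alpha> i" by (simp add: lookup_add lookup_single)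
    have "(pd i ^^ Poly_Mapping.lookup \<alpha> i) (pd_list is ?\<beta> s) b =
        (pd i ^^ Poly_Mapping.lookup \<alpha> i) (pd j (pd_list is \<alpha> s)) b"
      by (rule pd_funpow_cong[OF U(1) _ Cons.prems(3)]) (use Cons False in auto)
    also have "\<dots> = pd j ((pd i ^^ Poly_Mapping.lookup \<alpha> i) (pd_list is \<alpha> s)) b"
      by (rule pd_funpow_commute[OF U(1) holo_on_pd_list[OF U] Cons.prems(3)])
    finally show ?thesis unfolding step c .
  qed
qed simp

lemma pd_mon_pd_list:
  obtains "is" :: "'i::finite list" where "distinct is" "set is = UNIV"
    "\<And>\<alpha> s. pd_mon \<alpha> s = pd_list is \<alpha> s"
proof -
  have "\<exists>is. distinct is \<and> set is = (UNIV :: 'i set)"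
    using finite_distinct_list[OF finite_class.finite_UNIV] by blast
  then have "distinct (SOME is. distinct is \<and> set is = (UNIV :: 'i set)) \<and>
      set (SOME is. distinct is \<and> set is = (UNIV :: 'i set)) = UNIV" by (rule someI_ex)
  then show thesis by (intro that) (auto simp: pd_mon_def pd_list_def)
qed

lemma holo_on_pd_mon: "open U \<Longrightarrow> holo_on U s \<Longrightarrow> holo_on U (pd_mon \<alpha> s)"
  by (metis pd_mon_pd_list holo_on_pd_list)

lemma pd_mon_add:
  assumes "open U" "holo_on U s" "b \<in> U"
  shows "pd_mon (Poly_Mapping.single j 1 + \<alpha>) s b = pd j (pd_mon \<alpha> s) b"
proof -
  obtain "is" :: "'a list" where i: "distinct is" "set is = UNIV" "\<And>\<alpha> s. pd_mon \<alpha> s = pd_list is \<alpha> s"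
    by (rule pd_mon_pd_list) blast
  show ?thesis unfolding i(3) by (rule pd_list_add[OF assms(1,2) i(1) _ assms(3)]) (simp add: i(2))
qed

lemma pd_mon_0: "pd_mon 0 s = s"
proof -
  obtain "is" :: "'a list" where i: "\<And>\<alpha> s. pd_mon \<alpha> s = pd_list is \<alpha> s"
    by (rule pd_mon_pd_list) blast
  have "pd_list is 0 s = s" for "is" :: "'a list" by (induction "is") (auto simp: pd_list_def)
  then show ?thesis unfolding i .
qed

lemma diffop_superset:
  assumes "finite K" "Poly_Mapping.keys p \<subseteq> K"
  shows "diffop p s b = (\<Sum>\<alpha>\<in>K. coef p \<alpha> * pd_mon \<alpha> s b)"
  unfolding diffop_def by (rule sum.mono_neutral_left) (use assms in \<open>auto simp: in_keys_iff\<close>)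

lemma diffop_add: "diffop (p + q) s b = diffop p s b + diffop q s b"
proof -
  let ?K = "Poly_Mapping.keys p \<union> Poly_Mapping.keys q"
  have "Poly_Mapping.keys (p + q) \<subseteq> ?K" by (rule Poly_Mapping.keys_add)
  then show ?thesis
    using diffop_superset[of ?K p] diffop_superset[of ?K q] diffop_superset[of ?K "p + q"]
    by (simp add: lookup_add distrib_right sum.distrib)
qed

lemma diffop_single: "diffop (Poly_Mapping.single \<alpha> c) s b = c * pd_mon \<alpha> s b"
  by (cases "c = 0") (simp_all add: diffop_def)

lemma diffop_Cst: "diffop (Cst c) s b = c * s b"
  by (simp add: Cst_def diffop_single pd_mon_0)

lemma diffop_Cst_mult: "diffop (Cst c * p) s b = c * diffop p s b"
proof (induction p rule: mpol_single_induct)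
  case (single \<alpha> d)
  then show ?case by (simp add: Cst_def Poly_Mapping.mult_single diffop_single)
qed (simp add: distrib_left diffop_add)

lemma holo_on_diffop:
  assumes "open U" "holo_on U s"
  shows "holo_on U (diffop p s)"
  unfolding diffop_def[abs_def]
  by (intro holo_on_sum(1) holo_on_mult(1) holo_on_const holo_on_pd_mon assms)

lemma diffop_Var_mult:
  assumes "open U" "holo_on U s" "b \<in> U"
  shows "diffop (Var j * p) s b = pd j (diffop p s) b"
proof (induction p rule: mpol_single_induct)
  case (single \<alpha> c)
  have "diffop (Poly_Mapping.single \<alpha> c) s = (\<lambda>b. c * pd_mon \<alpha> s b)"
    by (rule ext) (rule diffop_single)
  then show ?case
    unfolding Var_single diffop_single pd_mon_add[OF assms]
    using holo_on_mult(2)[OF holo_on_const holo_on_pd_mon[OF assms(1,2)] assms(3), of j c \<alpha>] by simp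
next
  case (add p q)
  have "diffop (p + q) s = (\<lambda>b. diffop p s b + diffop q s b)" by (rule ext) (rule diffop_add)
  then show ?case
    using holo_on_add(2)[OF holo_on_diffop[OF assms(1,2)] holo_on_diffop[OF assms(1,2)] assms(3), of j p q] add
    by (simp add: distrib_left diffop_add)
qed

section \<open>Solutions annihilate the twisted image\<close>

lemma R_eq_range_to_R: "R = range to_R"
proof
  have "to_R P \<in> R" for P :: "('a dmon, complex) mpol"
    by (induction P rule: mpol_Var_induct) (simp_all add: to_R_add to_R_mult R.intros)
  then show "range to_R \<subseteq> (R :: ('a, complex) mpol set)" by blast
  show "R \<subseteq> range (to_R :: _ \<Rightarrow> ('a, complex) mpol)"
  proof
    fix r :: "('a, complex) mpol" assume "r \<in> R"
    then show "r \<in> range to_R"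
    proof induction
      case (const c)
      then show ?case using to_R_Cst[of c] by (metis rangeI)
    next
      case (gen i)
      then show ?case using to_R_Var[of i] by (metis rangeI)
    next
      case (add p q)
      then obtain P Q where "p = to_R P" "q = to_R Q" by blast
      then show ?case by (simp flip: to_R_add)
    next
      case (mult p q)
      then obtain P Q where "p = to_R P" "q = to_R Q" by blast
      then show ?case by (simp flip: to_R_mult)
    qed
  qed
qed

lemma avee_expand:
  fixes p :: "('n::finite, complex) mpol"
  assumes "degs {CARD('n)} p"
  shows "p = (\<Sum>i\<in>UNIV. Cst (coef p (expo i)) * avee i)"
proof (rule poly_mapping_eqI)
  fix \<alpha>
  have *: "coef (\<Sum>i\<in>UNIV. Cst (coef p (expo i)) * avee i) \<alpha> =
      (\<Sum>i\<in>UNIV. if expo i = \<alpha> then coef p (expo i) else 0)"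
    unfolding lookup_sum coef_Cst_mult avee_def by (intro sum.cong) (auto simp: lookup_single when_def)
  show "coef p \<alpha> = coef (\<Sum>i\<in>UNIV. Cst (coef p (expo i)) * avee i) \<alpha>"
  proof (cases "mdeg \<alpha> = CARD('n)")
    case True
    then have e: "expo (Abs_dmon \<alpha>) = \<alpha>" by (simp add: Abs_dmon_inverse)
    have "(\<Sum>i\<in>UNIV. if expo i = \<alpha> then coef p (expo i) else 0) =
        (\<Sum>i\<in>UNIV. if i = Abs_dmon \<alpha> then coef p \<alpha> else 0)"
      by (intro sum.cong) (use e in \<open>auto simp: expo_inverse\<close>)
    then show ?thesis unfolding * by simp
  next
    case False
    then have "coef p \<alpha> = 0" using assms by (auto simp: degs_def)
    moreover have "(\<Sum>i\<in>UNIV. if expo i = \<alpha> then coef p (expo i) else 0) = 0"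
      by (intro sum.neutral) (use False expo in auto)
    ultimately show ?thesis unfolding * by simp
  qed
qed

lemma R_closed:
  fixes r :: "('n::finite, complex) mpol"
  assumes "r \<in> R"
  shows "zth x r \<in> R" "- r \<in> R" "avee i * r \<in> R" "Cst c * r \<in> R" "zth x (avee i) * r \<in> R" "Zb b x r \<in> R"
proof -
  have m: "p \<in> R \<Longrightarrow> q \<in> R \<Longrightarrow> p * q \<in> R" and a: "p \<in> R \<Longrightarrow> q \<in> R \<Longrightarrow> p + q \<in> R" for p q :: "('n, complex) mpol"
    by (rule R.mult R.add; assumption)+
  have z: "zth x p \<in> R" if "p \<in> R" for p using that by (simp add: R_iff_degs degs_zth)
  show "zth x r \<in> R" using z assms by simp
  have n: "- r \<in> R" if "r \<in> R" for r :: "('n, complex) mpol" using that by (simp add: R_iff_degs degs_minus)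
  then show "- r \<in> R" using assms by simp
  show "avee i * r \<in> R" "Cst c * r \<in> R" "zth x (avee i) * r \<in> R"
    using assms by (auto intro: m z R.gen R.const)
  have "form b \<in> R" by (simp add: R_iff_degs) (rule degs_mono[OF degs_form], auto intro: image_eqI[of _ _ 1])
  then have "zth x r + zth x (form b) * r + - (Cst (snd x) * r) \<in> R"
    by (intro a m z n R.const assms)
  then show "Zb b x r \<in> R" by (simp add: Zb_def)
qed

lemma R_sum: "(\<And>x. x \<in> X \<Longrightarrow> g x \<in> R) \<Longrightarrow> (\<Sum>x\<in>X. g x) \<in> R"
  using R.const[of 0] by (induction X rule: infinite_finite_induct) (auto intro: R.add)

lemma R_1: "1 \<in> R"
  using R.const[of 1] by simp

text \<open>The action of \<open>r(\<partial>)\<close>; on solutions it does not depend on the chosen lift of \<open>r\<close>.\<close>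

definition sr :: "(complex ^ ('n::finite dmon) \<Rightarrow> complex) \<Rightarrow> ('n, complex) mpol
    \<Rightarrow> complex ^ ('n dmon) \<Rightarrow> complex" where
  "sr s r = diffop (SOME P. to_R P = r) s"

context
  fixes U :: "(complex ^ ('n::finite dmon)) set" and s
  assumes U: "open U" and s: "s \<in> sol U"
begin

lemma sol_holo: "holo_on U s"
  using s by (simp add: sol_def)

lemma sr_to_R:
  assumes "b \<in> U"
  shows "sr s (to_R P) b = diffop P s b"
proof -
  define Q where "Q = (SOME Q. to_R Q = to_R P)"
  have Q: "to_R Q = to_R P" unfolding Q_def by (rule someI) (rule refl)
  have "to_R (Q + Cst (- 1) * P) = to_R Q + Cst (- 1) * to_R P"
    by (simp only: to_R_add to_R_mult to_R_Cst)
  also have "\<dots> = 0" by (simp add: Q Cst_minus)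
  finally have "diffop (Q + Cst (- 1) * P) s b = 0" using s assms by (simp add: sol_def)
  then show ?thesis
    unfolding sr_def Q_def[symmetric] diffop_add diffop_Cst_mult by simp
qed

lemma to_R_surj: "r \<in> R \<Longrightarrow> \<exists>P. to_R P = (r :: ('n, complex) mpol)"
  unfolding R_eq_range_to_R by blast

lemma sr_add:
  assumes "p \<in> R" "q \<in> R" "b \<in> U"
  shows "sr s (p + q) b = sr s p b + sr s q b"
proof -
  obtain P Q where "to_R P = p" "to_R Q = q" using assms to_R_surj by blast
  then show ?thesis using sr_to_R[OF assms(3), of "P + Q"] sr_to_R[OF assms(3)]
    by (auto simp: to_R_add diffop_add)
qed

lemma sr_Cst_mult:
  assumes "p \<in> R" "b \<in> U"
  shows "sr s (Cst c * p) b = c * sr s p b"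
proof -
  obtain P where "to_R P = p" using assms to_R_surj by blast
  then show ?thesis using sr_to_R[OF assms(2), of "Cst c * P"] sr_to_R[OF assms(2)]
    by (auto simp: to_R_mult diffop_Cst_mult)
qed

lemma sr_0: "b \<in> U \<Longrightarrow> sr s 0 b = 0"
  using sr_Cst_mult[of 0 b 0] R.const[of 0] by simp

lemma sr_sum:
  assumes "b \<in> U" "\<And>x. x \<in> X \<Longrightarrow> g x \<in> R"
  shows "sr s (\<Sum>x\<in>X. g x) b = (\<Sum>x\<in>X. sr s (g x) b)"
proof -
  have "(\<Sum>x\<in>X. g x) \<in> R \<and> sr s (\<Sum>x\<in>X. g x) b = (\<Sum>x\<in>X. sr s (g x) b)"
    using assms(2)
  proof (induction X rule: infinite_finite_induct)
    case (insert x F)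
    then show ?case using sr_add[of "g x" "sum g F" b] assms(1) by (simp add: R.add)
  qed (use sr_0[OF assms(1)] R.const[of 0] in auto)
  then show ?thesis ..
qed

lemma sr_pd:
  assumes "r \<in> R" "b \<in> U"
  shows "pd j (sr s r) b = sr s (avee j * r) b"
proof -
  obtain P where P: "to_R P = r" using assms to_R_surj by blast
  have "pd j (sr s r) b = pd j (diffop P s) b"
    using sr_to_R P by (intro pd_cong[OF U assms(2)]) blast
  also have "\<dots> = diffop (Var j * P) s b" by (rule diffop_Var_mult[OF U sol_holo assms(2), symmetric])
  also have "\<dots> = sr s (avee j * r) b"
    using sr_to_R[OF assms(2), of "Var j * P"] P by (simp add: to_R_mult)
  finally show ?thesis .
qed

lemma holo_on_sr:
  assumes "r \<in> R"
  shows "holo_on U (sr s r)"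
proof -
  obtain P where P: "to_R P = r" using assms to_R_surj by blast
  show ?thesis
    by (rule holo_on_cong[OF U _ holo_on_diffop[OF U sol_holo, of P]]) (use sr_to_R P in auto)
qed

lemma sr_1: "b \<in> U \<Longrightarrow> sr s 1 b = s b"
  using sr_to_R[of b "Cst 1"] unfolding to_R_Cst diffop_Cst by simp

lemma sr_avee: "b \<in> U \<Longrightarrow> sr s (avee i) b = pd i s b"
  using sr_pd[OF R_1, of b i] pd_cong[OF U, of b "sr s 1" s i] sr_1 by simp

text \<open>For \<open>r = 1\<close> this is the system itself; multiplication of \<open>r\<close> by a generator \<open>a\<^sub>j\<^sup>\<or>\<close> is differentiation of the resulting identity.\<close>

lemma sr_Zb:
  assumes x: "x \<in> ghat" and r: "r \<in> R" and b: "b \<in> U"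
  shows "sr s (Zb b x r) b = 0"
proof -
  \<comment> \<open>An expansion of \<open>sr s (Zb b x r) b\<close> in which \<open>b\<close>
    enters only through explicit coordinates and the evaluation point, so that it can be
    differentiated in \<open>b\<close>.\<close>
  define E where "E r b = (\<Sum>i\<in>UNIV. b $ i * sr s (zth x (avee i) * r) b) + sr s (zth x r + - (Cst (snd x) * r)) b"
    for r b
  have E_eq: "sr s (Zb b x r) b = E r b" if "r \<in> R" "b \<in> U" for r b
  proof -
    have eq: "Zb b x r = (\<Sum>i\<in>UNIV. Cst (b $ i) * (zth x (avee i) * r)) + (zth x r + - (Cst (snd x) * r))"
      by (simp add: Zb_def zth_form sum_distrib_right mult.assoc)
    have 1: "(\<Sum>i\<in>UNIV. Cst (b $ i) * (zth x (avee i) * r)) \<in> R"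
      by (intro R_sum R_closed that)
    show ?thesis
      unfolding eq E_def sr_add[OF 1 R.add[OF R_closed(1)[OF that(1)] R_closed(2)[OF R_closed(4)[OF that(1)]]] that(2)]
      using that by (simp add: sr_sum sr_Cst_mult R_closed)
  qed
  have "\<forall>b\<in>U. E (to_R P) b = 0" for P
  proof (induction P rule: mpol_Var_induct)
    case (Cst c)
    show ?case
    proof
      fix b assume b: "b \<in> U"
      obtain A t where xA: "x = (A, t)" "A \<in> sl" using x by (auto simp: ghat_def)
      have dl: "degs {CARD('n)} (lin_vf A (form b))"
        using degs_zth[OF degs_form, of "(A, 0)" b] by (simp add: zth_eq)
      have lin: "sr s (lin_vf A (form b)) b = 0"
      proof -
        have "sr s (lin_vf A (form b)) b = sr s (\<Sum>i\<in>UNIV. Cst (coef (lin_vf A (form b)) (expo i)) * avee i) b"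
          using avee_expand[OF dl] by simp
        also have "\<dots> = (\<Sum>i\<in>UNIV. coef (lin_vf A (form b)) (expo i) * pd i s b)"
          using b by (simp add: sr_sum sr_Cst_mult R_closed R.gen sr_avee R.mult R.const)
        also have "\<dots> = 0" using s xA(2) b by (simp add: sol_def)
        finally show ?thesis .
      qed
      have eu: "sr s (form b) b = - s b"
      proof -
        have "sr s (form b) b = (\<Sum>i\<in>UNIV. b $ i * pd i s b)"
          unfolding form_def using b by (simp add: sr_sum sr_Cst_mult R.gen sr_avee R.mult R.const)
        moreover have "(\<Sum>i\<in>UNIV. b $ i * pd i s b) + s b = 0" using s b by (simp add: sol_def)
        ultimately show ?thesis by (simp add: add_eq_0_iff2)
      qed
      have ef: "euler (form b) = form b"
        unfolding euler_def euler_identity[OF degs_form] Cst_of_nat[symmetric]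
        by (simp flip: mult.assoc Cst_mult)
      have R1: "lin_vf A (form b) \<in> R" "form b \<in> R"
        using dl degs_form[of b] by (auto simp: R_iff_degs intro: degs_mono image_eqI[of _ _ 1])
      \<comment> \<open>The contribution of the part \<open>- t (E + 1)\<close> on the constant
        \<open>1\<close>; the homogeneity equation of the system makes it act as zero.\<close>
      define w where "w = Cst (- t) * form b + Cst (- t) * (1 :: ('n, complex) mpol)"
      have w: "w \<in> R" "sr s w b = - t * (- s b) + - t * s b"
        unfolding w_def using b R1
        by (simp_all only: R.add R.mult R.const R_1 sr_add sr_Cst_mult eu sr_1)
      have "Zb b x (Cst c) = Cst c * (lin_vf A (form b) + w)"
        by (simp add: Zb_def xA(1) zth_eq[of A t "form b"] ef Cst_minus w_def algebra_simps)
      then have "sr s (Zb b x (Cst c)) b = c * (0 + (- t * (- s b) + - t * s b))"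
        using b R1 w by (simp only: sr_Cst_mult sr_add R.add lin)
      then show "E (to_R (Cst c)) b = 0" using E_eq[OF R.const b, of c] by simp
    qed
  next
    case (add P Q)
    have R: "to_R P \<in> R" "to_R Q \<in> R" unfolding R_eq_range_to_R by blast+
    show ?case
    proof
      fix b assume b: "b \<in> U"
      have "sr s (Zb b x (to_R P + to_R Q)) b = 0"
        using E_eq[OF R(1) b] E_eq[OF R(2) b] add b R by (simp add: Zb_add sr_add R_closed)
      then show "E (to_R (P + Q)) b = 0" using E_eq[OF _ b, of "to_R P + to_R Q"] R by (simp add: to_R_add R.add)
    qed
  next
    case (Var P j)
    define r where "r = to_R P"
    have R: "r \<in> R" unfolding r_def R_eq_range_to_R by blast
    show ?case
    proof
      fix b assume b: "b \<in> U"
      have q: "zth x r + - (Cst (snd x) * r) \<in> R" using R by (intro R.add R_closed)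
      have "pd j (E r) b = 0"
        using pd_cong[OF U b, of "E r" "\<lambda>_. 0" j] Var by (simp add: r_def)
      moreover have "pd j (E r) b =
          (\<Sum>i\<in>UNIV. b $ i * sr s (zth x (avee i) * (avee j * r)) b) + sr s (zth x (avee j) * r) b
          + sr s (avee j * (zth x r + - (Cst (snd x) * r))) b"
      proof -
        have h: "holo_on U (\<lambda>b. b $ i * sr s (zth x (avee i) * r) b)" for i
          by (intro holo_on_mult(1) holo_on_coord holo_on_sr R_closed R)
        have sp: "pd j (sr s (zth x (avee i) * r)) b = sr s (zth x (avee i) * (avee j * r)) b" for i
          using sr_pd[OF R_closed(5)[OF R] b, of j x i] by (simp add: mult.left_commute)
        have p: "pd j (\<lambda>b. b $ i * sr s (zth x (avee i) * r) b) b =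
            b $ i * sr s (zth x (avee i) * (avee j * r)) b + (if i = j then sr s (zth x (avee j) * r) b else 0)" for i
          using holo_on_mult(2)[OF holo_on_coord holo_on_sr[OF R_closed(5)[OF R]] b, of j i x i]
          unfolding sp pd_coord by auto
        have "pd j (E r) b = pd j (\<lambda>b. \<Sum>i\<in>UNIV. b $ i * sr s (zth x (avee i) * r) b) b
            + pd j (sr s (zth x r + - (Cst (snd x) * r))) b"
          unfolding E_def by (rule holo_on_add(2)[OF holo_on_sum(1)[OF h] holo_on_sr[OF q] b])
        also have "\<dots> = (\<Sum>i\<in>UNIV. b $ i * sr s (zth x (avee i) * (avee j * r)) b + (if i = j then sr s (zth x (avee j) * r) b else 0))
            + sr s (avee j * (zth x r + - (Cst (snd x) * r))) b"
          unfolding holo_on_sum(2)[OF h b] p sr_pd[OF q b] ..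
        finally show ?thesis by (simp add: sum.distrib)
      qed
      \<comment> \<open>Differentiating the coordinate \<open>b $ j\<close> has produced the extra
        term \<open>zth x (avee j) * r\<close>, which is the one that the product rule requires
        here.\<close>
      moreover have "zth x (avee j * r) + - (Cst (snd x) * (avee j * r)) =
          zth x (avee j) * r + avee j * (zth x r + - (Cst (snd x) * r))"
        unfolding zth_mult by (simp add: algebra_simps)
      then have "sr s (zth x (avee j * r) + - (Cst (snd x) * (avee j * r))) b =
          sr s (zth x (avee j) * r) b + sr s (avee j * (zth x r + - (Cst (snd x) * r))) b"
        using sr_add[OF R_closed(5)[OF R] R_closed(3)[OF q] b] by (simp only:)
      ultimately have "E (avee j * r) b = 0" unfolding E_def by (simp only: add.assoc)
      then show "E (to_R (Var j * P)) b = 0" by (simp add: to_R_mult r_def)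
    qed
  qed
  moreover obtain P where P: "to_R P = r" using r to_R_surj by blast
  ultimately have "E r b = 0" using b by blast
  then show ?thesis using E_eq[OF r b] by simp
qed

lemma sr_twisted_image:
  assumes b: "b \<in> U" and h: "h \<in> twisted_image d b"
  shows "sr s h b = 0"
proof -
  obtain g where g: "\<And>u. degs (odeg TYPE('n) d) (g u)" "h = (\<Sum>u\<in>UNIV. dtw b u (g u))"
    using h unfolding twisted_image_def by blast
  have *: "dtw b u p \<in> R \<and> sr s (dtw b u p) b = 0" if "degs (odeg TYPE('n) d) p" for u p
    using that
  proof (induction p rule: degs_induct)
    case zero
    then show ?case using R.const[of 0] sr_0[OF b] by simp
  next
    case (single \<alpha> c)
    then obtain v \<gamma> where v: "mdeg \<gamma> \<in> edeg TYPE('n) d"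
      "Poly_Mapping.single \<alpha> c = Var v * Poly_Mapping.single \<gamma> c"
      by (rule odeg_mono_split) blast
    have r: "Poly_Mapping.single \<gamma> c \<in> R"
      unfolding R_iff_degs by (rule degs_single) (use v(1) in \<open>auto simp: edeg_def\<close>)
    have "dtw b u (Poly_Mapping.single \<alpha> c) = Cst (- 1) * Zb b (gunit u v) (Poly_Mapping.single \<gamma> c)"
      unfolding v(2) dtw_eq_Zb by (simp add: Cst_minus)
    then show ?case
      using sr_Zb[OF gunit_ghat r b] sr_Cst_mult[OF R_closed(6)[OF r] b] by (simp add: R_closed r)
  next
    case (add p q)
    then show ?case using sr_add b by (simp add: dtw_add R.add)
  qed
  show ?thesis unfolding g(2) using * g(1) b by (simp add: sr_sum)
qed

end

lemma twisted_image_imp_diffop_zero: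
  assumes "open U" "s \<in> sol U" "b \<in> U" "to_R \<delta> \<in> twisted_image d b"
  shows "diffop \<delta> s b = 0"
  using sr_to_R[OF assms(1-3), of \<delta>] sr_twisted_image[OF assms] by simp

section \<open>From functionals to solutions\<close>

text \<open>The sum norm of the coefficients: it is submultiplicative, and a functional bounded on
  monomials is bounded with respect to it.\<close>

definition norm1 :: "('i, complex) mpol \<Rightarrow> real" where
  "norm1 p = (\<Sum>\<alpha>\<in>Poly_Mapping.keys p. norm (coef p \<alpha>))"

lemma norm1_superset:
  assumes "finite K" "Poly_Mapping.keys p \<subseteq> K"
  shows "norm1 p = (\<Sum>\<alpha>\<in>K. norm (coef p \<alpha>))"
  unfolding norm1_def by (rule sum.mono_neutral_left) (use assms in \<open>auto simp: in_keys_iff\<close>)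

lemma norm1_nonneg [simp]: "0 \<le> norm1 p"
  by (simp add: norm1_def sum_nonneg)

lemma norm1_0 [simp]: "norm1 0 = 0"
  by (simp add: norm1_def)

lemma norm1_add: "norm1 (p + q) \<le> norm1 p + norm1 q"
proof -
  let ?K = "Poly_Mapping.keys p \<union> Poly_Mapping.keys q"
  have "Poly_Mapping.keys (p + q) \<subseteq> ?K" by (rule Poly_Mapping.keys_add)
  then have "norm1 (p + q) = (\<Sum>\<alpha>\<in>?K. norm (coef (p + q) \<alpha>))" by (intro norm1_superset) auto
  also have "\<dots> \<le> (\<Sum>\<alpha>\<in>?K. norm (coef p \<alpha>) + norm (coef q \<alpha>))"
    unfolding lookup_add by (intro sum_mono norm_triangle_ineq)
  also have "\<dots> = norm1 p + norm1 q"
    using norm1_superset[of ?K p] norm1_superset[of ?K q] by (simp add: sum.distrib)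
  finally show ?thesis .
qed

lemma norm1_sum: "norm1 (sum g A) \<le> (\<Sum>x\<in>A. norm1 (g x))"
proof (induction A rule: infinite_finite_induct)
  case (insert x F)
  then show ?case using norm1_add[of "g x" "sum g F"] by simp
qed auto

lemma norm1_single: "norm1 (Poly_Mapping.single \<alpha> c) = norm c"
  by (cases "c = 0") (simp_all add: norm1_def)

lemma norm1_mult: "norm1 (p * q) \<le> norm1 p * norm1 q"
proof -
  have "p * q = (\<Sum>\<alpha>\<in>Poly_Mapping.keys p. Poly_Mapping.single \<alpha> (coef p \<alpha>)) *
      (\<Sum>\<beta>\<in>Poly_Mapping.keys q. Poly_Mapping.single \<beta> (coef q \<beta>))"
    by (simp only: mpol_expand[symmetric])
  also have "\<dots> = (\<Sum>\<alpha>\<in>Poly_Mapping.keys p. \<Sum>\<beta>\<in>Poly_Mapping.keys q.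
      Poly_Mapping.single (\<alpha> + \<beta>) (coef p \<alpha> * coef q \<beta>))"
    by (simp add: sum_product Poly_Mapping.mult_single)
  finally have eq: "p * q = (\<Sum>\<alpha>\<in>Poly_Mapping.keys p. \<Sum>\<beta>\<in>Poly_Mapping.keys q.
      Poly_Mapping.single (\<alpha> + \<beta>) (coef p \<alpha> * coef q \<beta>))" .
  have "norm1 (p * q) \<le> (\<Sum>\<alpha>\<in>Poly_Mapping.keys p. norm1 (\<Sum>\<beta>\<in>Poly_Mapping.keys q.
      Poly_Mapping.single (\<alpha> + \<beta>) (coef p \<alpha> * coef q \<beta>)))" unfolding eq by (rule norm1_sum)
  also have "\<dots> \<le> (\<Sum>\<alpha>\<in>Poly_Mapping.keys p. \<Sum>\<beta>\<in>Poly_Mapping.keys q.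
      norm1 (Poly_Mapping.single (\<alpha> + \<beta>) (coef p \<alpha> * coef q \<beta>)))"
    by (intro sum_mono norm1_sum)
  also have "\<dots> = norm1 p * norm1 q"
    unfolding norm1_single norm_mult by (simp add: norm1_def sum_product)
  finally show ?thesis .
qed

lemma norm1_power: "norm1 (p ^ k) \<le> norm1 p ^ k"
proof (induction k)
  case 0
  have "norm1 (1 :: ('a, complex) mpol) = 1"
    using norm1_single[of "0 :: 'a \<Rightarrow>\<^sub>0 nat" 1] by simp
  then show ?case by simp
next
  case (Suc k)
  then show ?case using norm1_mult[of p "p ^ k"] mult_left_mono[OF Suc, of "norm1 p"] by simp
qed

lemma norm1_pderivx:
  assumes "degs {..N} p"
  shows "norm1 (pderivx u p) \<le> real N * norm1 p"
proof -
  have "norm1 (pderivx u p) \<le> (\<Sum>\<alpha>\<in>Poly_Mapping.keys p. norm1 (Poly_Mapping.single (\<alpha> - ee u) (of_nat (coef \<alpha> u) * coef p \<alpha>)))"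
    unfolding pderivx_def by (rule norm1_sum)
  also have "\<dots> \<le> (\<Sum>\<alpha>\<in>Poly_Mapping.keys p. real N * norm (coef p \<alpha>))"
  proof (intro sum_mono)
    fix \<alpha> assume "\<alpha> \<in> Poly_Mapping.keys p"
    then have "mdeg \<alpha> \<le> N" using assms by (auto simp: degs_def in_keys_iff)
    moreover have "coef \<alpha> u \<le> mdeg \<alpha>" unfolding mdeg_def by (rule member_le_sum) auto
    ultimately have "real (coef \<alpha> u) \<le> real N" by simp
    then show "norm1 (Poly_Mapping.single (\<alpha> - ee u) (of_nat (coef \<alpha> u) * coef p \<alpha>)) \<le> real N * norm (coef p \<alpha>)"
      by (simp add: norm1_single norm_mult mult_right_mono)
  qed
  also have "\<dots> = real N * norm1 p" by (simp add: norm1_def sum_distrib_left)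
  finally show ?thesis .
qed

locale annihilator =
  fixes b :: "complex ^ ('n::finite dmon)" and \<phi> :: "('n, complex) mpol \<Rightarrow> complex"
  assumes smooth: "b \<in> smooth_forms"
    and phi_add: "\<And>p q. \<phi> (p + q) = \<phi> p + \<phi> q"
    and phi_Cst_mult: "\<And>c p. \<phi> (Cst c * p) = c * \<phi> p"
    and phi_dtw: "\<And>u k p. degs (odeg TYPE('n) k) p \<Longrightarrow> \<phi> (dtw b u p) = 0"
begin

lemma phi_0 [simp]: "\<phi> 0 = 0"
  using phi_Cst_mult[of 0 0] by simp

lemma phi_sum: "\<phi> (sum g A) = (\<Sum>x\<in>A. \<phi> (g x))"
  by (induction A rule: infinite_finite_induct) (auto simp: phi_add)

lemma phi_minus: "\<phi> (- p) = - \<phi> p"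
  using phi_Cst_mult[of "- 1" p] by (simp add: Cst_minus)

lemma phi_diff: "\<phi> (p - q) = \<phi> p - \<phi> q"
  using phi_add[of p "- q"] by (simp add: phi_minus)

lemma phi_bound:
  assumes "degs A p" "\<And>\<alpha>. mdeg \<alpha> \<in> A \<Longrightarrow> norm (\<phi> (xmon \<alpha>)) \<le> M"
  shows "norm (\<phi> p) \<le> M * norm1 p"
proof -
  have single: "\<phi> (Poly_Mapping.single \<alpha> c) = c * \<phi> (xmon \<alpha>)" for \<alpha> :: "'n \<Rightarrow>\<^sub>0 nat" and c
    using phi_Cst_mult[of c "xmon \<alpha>"] by (simp add: Cst_def Poly_Mapping.mult_single)
  have "\<phi> p = \<phi> (\<Sum>\<alpha>\<in>Poly_Mapping.keys p. Poly_Mapping.single \<alpha> (coef p \<alpha>))"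
    by (simp only: mpol_expand[symmetric])
  also have "\<dots> = (\<Sum>\<alpha>\<in>Poly_Mapping.keys p. coef p \<alpha> * \<phi> (xmon \<alpha>))"
    by (simp only: phi_sum) (rule sum.cong[OF refl single])
  also have "norm \<dots> \<le> (\<Sum>\<alpha>\<in>Poly_Mapping.keys p. M * norm (coef p \<alpha>))"
    using assms by (intro order_trans[OF norm_sum] sum_mono)
      (auto simp: norm_mult degs_def in_keys_iff mult.commute[of M] intro!: mult_left_mono)
  also have "\<dots> = M * norm1 p" by (simp add: norm1_def sum_distrib_left)
  finally show ?thesis .
qed

text \<open>A monomial of large degree is \<open>\<Sum>\<^sub>u s\<^sub>u \<partial>\<^sub>u f\<close>, so \<open>\<phi>\<close> takes on it the same value as on \<open>- \<Sum>\<^sub>u \<partial>\<^sub>u s\<^sub>u\<close>, whose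
  degree is one lower; each such step costs a factor proportional to the degree.\<close>

lemma phi_growth:
  obtains K C where "K \<ge> 1" "C \<ge> 1"
    "\<And>k \<alpha>. mdeg \<alpha> = CARD('n) * k \<Longrightarrow> norm (\<phi> (xmon \<alpha>)) \<le> K * C ^ k * fact k"
proof -
  let ?n = "CARD('n)"
  have n0: "?n > 0" by simp
  define f where "f u = pderivx u (form b)" for u
  have hom: "degs {?n - 1} (f u)" for u unfolding f_def by (rule degs_pderivx_form)
  obtain D0 where D0: "\<And>\<alpha>. D0 \<le> mdeg \<alpha> \<Longrightarrow> xmon \<alpha> \<in> ispan f"
    using monos_in_jacobian_ideal[OF smooth] unfolding f_def[abs_def] by blast
  \<comment> \<open>Large enough for every monomial of degree \<open>D\<close> to lie in the
    Jacobian ideal and for the cofactor degree \<open>D - (?n - 1)\<close> not to be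
    truncated.\<close>
  define D where "D = max D0 ?n"
  define G where "G = {\<gamma> :: 'n \<Rightarrow>\<^sub>0 nat. mdeg \<gamma> = D}"
  have finG: "finite G" unfolding G_def by (rule finite_subset[OF _ finite_mdeg[of D]]) auto
  have "\<forall>\<gamma>\<in>G. \<exists>c. xmon \<gamma> = (\<Sum>u\<in>UNIV. c u * f u)"
    using D0 by (auto simp: ispan_def G_def D_def)
  from bchoice[OF this] obtain c0 where c0: "\<And>\<gamma>. \<gamma> \<in> G \<Longrightarrow> xmon \<gamma> = (\<Sum>u\<in>UNIV. c0 \<gamma> u * f u)" by blast
  define c where "c \<gamma> u = hcomp (D - (?n - 1)) (c0 \<gamma> u)" for \<gamma> u
  have c: "xmon \<gamma> = (\<Sum>u\<in>UNIV. c \<gamma> u * f u)" if g: "\<gamma> \<in> G" for \<gamma>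
  proof -
    have "degs {D} (xmon \<gamma>)" using g by (intro degs_single) (simp add: G_def)
    then have "xmon \<gamma> = hcomp D (xmon \<gamma>)" by (rule hcomp_eq[symmetric])
    also have "\<dots> = (\<Sum>u\<in>UNIV. hcomp D (c0 \<gamma> u * f u))" by (subst c0[OF g]) (rule hcomp_sum)
    also have "\<dots> = (\<Sum>u\<in>UNIV. c \<gamma> u * f u)"
    proof -
      have "?n - 1 \<le> D" by (simp add: D_def)
      then show ?thesis unfolding hcomp_mult_homog[OF hom] c_def by (simp only: if_True)
    qed
    finally show ?thesis .
  qed
  \<comment> \<open>Only the finitely many monomials of degree \<open>D\<close> are ever decomposed,
    so one constant bounds all cofactors.\<close>
  define L where "L = (\<Sum>\<gamma>\<in>G. \<Sum>u\<in>UNIV. norm1 (c \<gamma> u))"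
  have L0: "L \<ge> 0" unfolding L_def by (intro sum_nonneg) simp
  have L: "(\<Sum>u\<in>UNIV. norm1 (c \<gamma> u)) \<le> L" if "\<gamma> \<in> G" for \<gamma>
    unfolding L_def using finG that by (intro member_le_sum sum_nonneg) simp_all
  define K where "K = 1 + (\<Sum>\<alpha> | mdeg \<alpha> \<le> D. norm (\<phi> (xmon \<alpha>)))"
  have K1: "K \<ge> 1" unfolding K_def by (simp add: sum_nonneg)
  have K: "norm (\<phi> (xmon \<alpha>)) \<le> K" if "mdeg \<alpha> \<le> D" for \<alpha>
  proof -
    have "norm (\<phi> (xmon \<alpha>)) \<le> (\<Sum>\<alpha> | mdeg \<alpha> \<le> D. norm (\<phi> (xmon \<alpha>)))"
      by (rule member_le_sum) (use that finite_mdeg in auto)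
    then show ?thesis by (simp add: K_def)
  qed
  \<comment> \<open>One step costs at most \<open>real (?n * Suc k) * L\<close>: the factor
    \<open>Suc k\<close> builds up the factorial, and the rest is at most \<open>C\<close>.\<close>
  define C where "C = 1 + real ?n * L"
  have C1: "C \<ge> 1" unfolding C_def using L0 by simp
  have "norm (\<phi> (xmon \<alpha>)) \<le> K * C ^ k * fact k" if "mdeg \<alpha> = ?n * k" for k \<alpha>
    using that
  proof (induction k arbitrary: \<alpha>)
    case 0
    then show ?case using K[of \<alpha>] by simp
  next
    case (Suc k)
    show ?case
    proof (cases "mdeg \<alpha> \<le> D")
      case True
      have "norm (\<phi> (xmon \<alpha>)) \<le> K * 1 * 1" using K[OF True] by simp
      also have "\<dots> \<le> K * C ^ Suc k * fact (Suc k)"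
        using K1 C1 by (intro mult_mono one_le_power fact_ge_1) auto
      finally show ?thesis .
    next
      case False
      then obtain \<gamma> \<beta> where gb: "\<alpha> = \<gamma> + \<beta>" "mdeg \<gamma> = D" using expo_decomp[of D \<alpha>] by auto
      then have g: "\<gamma> \<in> G" by (simp add: G_def)
      define s where "s u = c \<gamma> u * xmon \<beta>" for u
      have Dn: "D \<ge> ?n" by (simp add: D_def)
      have mb: "D + mdeg \<beta> = ?n * Suc k" using Suc.prems gb by (simp add: mdeg_add)
      have ds: "degs {1 + ?n * k} (s u)" for u
        unfolding s_def c_def
        by (rule degs_mult[OF degs_hcomp degs_single[of _ "{mdeg \<beta>}"]]) (use mb Dn n0 in auto)
      have ns: "norm1 (s u) \<le> norm1 (c \<gamma> u)" for u
        unfolding s_def using norm1_mult[of "c \<gamma> u" "xmon \<beta>"] by (simp add: norm1_single)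
      have "xmon \<alpha> = xmon \<gamma> * xmon \<beta>" by (simp add: gb(1) Poly_Mapping.mult_single)
      also have "\<dots> = (\<Sum>u\<in>UNIV. f u * s u)"
        unfolding c[OF g] s_def by (simp add: sum_distrib_left sum_distrib_right mult_ac)
      also have "\<dots> = (\<Sum>u\<in>UNIV. dtw b u (s u)) - (\<Sum>u\<in>UNIV. pderivx u (s u))"
        by (simp add: dtw_def sum.distrib flip: f_def)
      finally have "\<phi> (xmon \<alpha>) = (\<Sum>u\<in>UNIV. \<phi> (dtw b u (s u))) - (\<Sum>u\<in>UNIV. \<phi> (pderivx u (s u)))"
        by (simp only: phi_diff phi_sum)
      also have "(\<Sum>u\<in>UNIV. \<phi> (dtw b u (s u))) = 0"
        by (intro sum.neutral ballI phi_dtw[of "Suc k"] degs_mono[OF ds]) (auto simp: odeg_def)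
      finally have "norm (\<phi> (xmon \<alpha>)) \<le> (\<Sum>u\<in>UNIV. norm (\<phi> (pderivx u (s u))))"
        by (simp add: norm_sum)
      also have "\<dots> \<le> (\<Sum>u\<in>UNIV. (K * C ^ k * fact k) * (real (?n * Suc k) * norm1 (c \<gamma> u)))"
      proof (intro sum_mono)
        fix u
        have "norm (\<phi> (pderivx u (s u))) \<le> (K * C ^ k * fact k) * norm1 (pderivx u (s u))"
          by (rule phi_bound[of "{?n * k}"]) (use ds in \<open>auto intro!: degs_pderivx[OF ds] Suc.IH\<close>)
        also have "norm1 (pderivx u (s u)) \<le> real (?n * Suc k) * norm1 (s u)"
          by (rule norm1_pderivx, rule degs_mono[OF ds]) (use n0 in auto)
        also have "\<dots> \<le> real (?n * Suc k) * norm1 (c \<gamma> u)"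
          using ns by (intro mult_left_mono) auto
        finally show "norm (\<phi> (pderivx u (s u))) \<le> (K * C ^ k * fact k) * (real (?n * Suc k) * norm1 (c \<gamma> u))"
          using K1 C1 by (simp add: mult_left_mono)
      qed
      also have "\<dots> = (K * C ^ k * fact k) * (real (?n * Suc k) * (\<Sum>u\<in>UNIV. norm1 (c \<gamma> u)))"
        by (simp add: sum_distrib_left)
      also have "\<dots> \<le> (K * C ^ k * fact k) * (real (?n * Suc k) * L)"
        using K1 C1 L[OF g] by (intro mult_left_mono) auto
      also have "\<dots> = (K * C ^ k * fact (Suc k)) * (real ?n * L)" by (simp add: algebra_simps)
      also have "\<dots> \<le> (K * C ^ k * fact (Suc k)) * C"
        using K1 C1 by (intro mult_left_mono) (auto simp: C_def)
      finally show ?thesis by (simp add: mult_ac)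
    qed
  qed
  then show thesis using K1 C1 that by blast
qed

end

lemma form_add: "form (a + c) = form a + form c"
  by (simp add: form_def Cst_add distrib_right sum.distrib)

lemma form_0 [simp]: "form 0 = 0"
  by (simp add: form_def)

lemma norm1_form_le: "norm1 (form c :: ('n::finite, complex) mpol) \<le> CARD('n dmon) * norm c"
proof -
  have "norm1 (form c) \<le> (\<Sum>i\<in>UNIV. norm1 (Cst (c $ i) * avee i :: ('n, complex) mpol))"
    unfolding form_def by (rule norm1_sum)
  also have "\<dots> = (\<Sum>i\<in>UNIV. norm (c $ i))"
    by (simp add: Cst_def avee_def Poly_Mapping.mult_single norm1_single)
  also have "\<dots> \<le> (\<Sum>i\<in>(UNIV :: 'n dmon set). norm c)"
    by (intro sum_mono Finite_Cartesian_Product.norm_nth_le)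
  finally show ?thesis by simp
qed

context annihilator
begin

text \<open>The radius must not depend on \<open>r\<close>, since differentiating the series changes
  \<open>r\<close>. The degree of \<open>r\<close> only shifts the factorial, and for
  \<open>j \<le> N\<close> the number \<open>fact (j + k)\<close> is at most
  \<open>2 ^ (N + k) * fact N * fact k\<close>.\<close>

lemma phi_series_bound:
  "\<exists>\<rho>>0. \<forall>r\<in>R. \<exists>A. \<forall>k g. degs {CARD('n)} g \<longrightarrow> norm1 g \<le> \<rho> \<longrightarrow>
     norm (\<phi> (r * g ^ k) / fact k) \<le> A * (1 / 2) ^ k"
proof -
  let ?n = "CARD('n)"
  obtain K C where K: "K \<ge> 1" and C: "C \<ge> 1"
    and B: "\<And>k \<alpha>. mdeg \<alpha> = ?n * k \<Longrightarrow> norm (\<phi> (xmon \<alpha>)) \<le> K * C ^ k * fact k"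
    using phi_growth by blast
  \<comment> \<open>\<open>C\<close> compensates the growth of \<open>\<phi>\<close>, one factor 2
    the binomial coefficient, and the other one leaves the ratio \<open>1 / 2\<close>.\<close>
  define \<rho> where "\<rho> = 1 / (4 * C)"
  have "\<exists>A. \<forall>k g. degs {?n} g \<longrightarrow> norm1 g \<le> \<rho> \<longrightarrow> norm (\<phi> (r * g ^ k) / fact k) \<le> A * (1 / 2) ^ k"
    if r: "r \<in> R" for r
  proof -
    obtain N where N: "degs {..N} r" using degs_bound_exists by blast
    have dr: "degs {?n * j | j. j \<le> N} r"
      unfolding degs_def
    proof (intro allI impI)
      fix \<alpha> assume nz: "coef r \<alpha> \<noteq> 0"
      then obtain j where j: "mdeg \<alpha> = ?n * j" using r by (auto simp: R_iff_degs degs_def)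
      have "1 * j \<le> ?n * j" by (intro mult_right_mono) (simp_all add: Suc_le_eq)
      moreover have "?n * j \<le> N" using N nz unfolding degs_def j[symmetric] by blast
      ultimately have "j \<le> N" by linarith
      then show "mdeg \<alpha> \<in> {?n * j | j. j \<le> N}" using j by blast
    qed
    define A where "A = K * (2 * C) ^ N * fact N * norm1 r"
    have "norm (\<phi> (r * g ^ k) / fact k) \<le> A * (1 / 2) ^ k"
      if g: "degs {?n} g" "norm1 g \<le> \<rho>" for k g
    proof -
      have dg: "degs {?n * k} (g ^ k)"
      proof (induction k)
        case 0
        then show ?case using degs_Cst[of "{0}" "1::complex"] by simp
      next
        case (Suc k)
        show ?case unfolding power_Suc by (rule degs_mult[OF g(1) Suc]) auto
      qed
      have d: "degs {?n * (j + k) | j. j \<le> N} (r * g ^ k)"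
        by (rule degs_mult[OF dr dg]) (auto simp: distrib_left)
      have fct: "fact (j + k) \<le> (2::real) ^ (N + k) * fact N * fact k" if "j \<le> N" for j
      proof -
        have "(fact (j + k) :: real) \<le> fact (N + k)" using that by (intro fact_mono) simp
        also have "\<dots> = real (fact (N + k))" by (simp only: of_nat_fact)
        also have "\<dots> = real (fact k * fact N * ((N + k) choose k))"
          using binomial_fact_lemma[of k "N + k"] by simp
        also have "\<dots> = fact k * fact N * real ((N + k) choose k)" by (simp only: of_nat_mult of_nat_fact)
        also have "\<dots> \<le> fact k * fact N * real (2 ^ (N + k))"
          using binomial_le_pow2[of "N + k" k] by (intro mult_left_mono iffD2[OF of_nat_le_iff]) simp_all
        finally show ?thesis by (simp add: mult_ac)
      qed
      have "norm (\<phi> (r * g ^ k)) \<le> (K * C ^ (N + k) * (2 ^ (N + k) * fact N * fact k)) * norm1 (r * g ^ k)"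
      proof (rule phi_bound[OF d])
        fix \<alpha> :: "'n \<Rightarrow>\<^sub>0 nat" assume "mdeg \<alpha> \<in> {?n * (j + k) | j. j \<le> N}"
        then obtain j where j: "mdeg \<alpha> = ?n * (j + k)" "j \<le> N" by blast
        have "norm (\<phi> (xmon \<alpha>)) \<le> K * C ^ (j + k) * fact (j + k)" by (rule B[OF j(1)])
        also have "\<dots> \<le> K * C ^ (N + k) * (2 ^ (N + k) * fact N * fact k)"
          using K C j(2) by (intro mult_mono fct power_increasing) auto
        finally show "norm (\<phi> (xmon \<alpha>)) \<le> K * C ^ (N + k) * (2 ^ (N + k) * fact N * fact k)" .
      qed
      also have "norm1 (r * g ^ k) \<le> norm1 r * \<rho> ^ k"
        by (intro order_trans[OF norm1_mult] mult_left_mono order_trans[OF norm1_power] power_mono g(2)) simp_all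
      finally have "norm (\<phi> (r * g ^ k)) \<le> (K * C ^ (N + k) * (2 ^ (N + k) * fact N * fact k)) * (norm1 r * \<rho> ^ k)"
        using K C by (simp add: mult_left_mono)
      also have "\<dots> = (A * (2 * C * \<rho>) ^ k) * fact k"
        by (simp add: A_def power_add power_mult_distrib)
      also have "2 * C * \<rho> = 1 / 2" using C by (simp add: \<rho>_def)
      finally show ?thesis by (simp add: norm_divide field_simps)
    qed
    then show ?thesis by blast
  qed
  moreover have "\<rho> > 0" using C by (simp add: \<rho>_def)
  ultimately show ?thesis by blast
qed

definition rad :: real where
  "rad = (SOME \<rho>. \<rho> > 0 \<and> (\<forall>r\<in>R. \<exists>A. \<forall>k g. degs {CARD('n)} g \<longrightarrow> norm1 g \<le> \<rho> \<longrightarrow>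
     norm (\<phi> (r * g ^ k) / fact k) \<le> A * (1 / 2) ^ k))"

lemma rad: "rad > 0"
  and rad_bound: "r \<in> R \<Longrightarrow> \<exists>A. \<forall>k g. degs {CARD('n)} g \<longrightarrow> norm1 g \<le> rad \<longrightarrow>
     norm (\<phi> (r * g ^ k) / fact k) \<le> A * (1 / 2) ^ k"
  using someI_ex[OF phi_series_bound] unfolding rad_def[symmetric] by blast+

text \<open>By \<open>norm1_form_le\<close> the division by \<open>CARD('n dmon)\<close> ensures
  that \<open>norm1 (form (a - b))\<close> is at most \<open>rad\<close> on this ball.\<close>

definition cdom :: "(complex ^ 'n dmon) set" where
  "cdom = ball b (rad / CARD('n dmon))"

lemma cdom: "open cdom" "convex cdom" "b \<in> cdom"
  using rad by (auto simp: cdom_def)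

definition trm :: "('n, complex) mpol \<Rightarrow> nat \<Rightarrow> complex ^ 'n dmon \<Rightarrow> complex" where
  "trm r k a = \<phi> (r * form (a - b) ^ k) / fact k"

text \<open>Formally \<open>\<phi>\<close> of \<open>r\<close> times the exponential of
  \<open>form a - form b\<close>; so \<open>ser r\<close> is what the differential operator of
  \<open>r\<close> makes of \<open>ser 1\<close>.\<close>

definition ser :: "('n, complex) mpol \<Rightarrow> complex ^ 'n dmon \<Rightarrow> complex" where
  "ser r a = suminf (\<lambda>k. trm r k a)"

lemma trm_bound:
  assumes "r \<in> R"
  obtains A where "\<And>k a. a \<in> cdom \<Longrightarrow> norm (trm r k a) \<le> A * (1 / 2) ^ k"
proof -
  obtain A where A: "\<And>k g. degs {CARD('n)} g \<Longrightarrow> norm1 g \<le> rad \<Longrightarrow>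
     norm (\<phi> (r * g ^ k) / fact k) \<le> A * (1 / 2) ^ k" using rad_bound[OF assms] by blast
  have "norm1 (form (a - b)) \<le> rad" if "a \<in> cdom" for a
  proof -
    have "norm1 (form (a - b)) \<le> CARD('n dmon) * norm (a - b)" by (rule norm1_form_le)
    also have "norm (a - b) \<le> rad / CARD('n dmon)" using that by (simp add: cdom_def dist_norm norm_minus_commute)
    finally show ?thesis by (simp add: mult_left_mono)
  qed
  then show thesis using A[OF degs_form] that unfolding trm_def by blast
qed

lemma trm_summable:
  assumes "r \<in> R" "a \<in> cdom"
  shows "summable (\<lambda>k. trm r k a)"
proof -
  obtain A where A: "\<And>k a. a \<in> cdom \<Longrightarrow> norm (trm r k a) \<le> A * (1 / 2) ^ k" using trm_bound[OF assms(1)] by blast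
  have "summable (\<lambda>k. A * (1 / 2 :: real) ^ k)" by (intro summable_mult summable_geometric) simp
  then show ?thesis
    by (rule summable_comparison_test'[where N=0 and f="\<lambda>k. trm r k a"]) (rule A[OF assms(2)])
qed

lemma trm_uniform:
  assumes "r \<in> R"
  shows "uniform_limit cdom (\<lambda>n a. \<Sum>k<n. trm r k a) (ser r) sequentially"
proof -
  obtain A where A: "\<And>k a. a \<in> cdom \<Longrightarrow> norm (trm r k a) \<le> A * (1 / 2) ^ k" using trm_bound[OF assms(1)] by blast
  have "summable (\<lambda>k. A * (1 / 2 :: real) ^ k)" by (intro summable_mult summable_geometric) simp
  then show ?thesis
    unfolding ser_def[abs_def] by (rule Weierstrass_m_test[where f="trm r" and A=cdom, rotated]) (rule A)
qed

lemma ser_add: "p \<in> R \<Longrightarrow> q \<in> R \<Longrightarrow> a \<in> cdom \<Longrightarrow> ser (p + q) a = ser p a + ser q a"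
  using suminf_add[OF trm_summable trm_summable, of p a q a]
  by (simp add: ser_def trm_def distrib_right phi_add add_divide_distrib)

lemma ser_Cst_mult: "p \<in> R \<Longrightarrow> a \<in> cdom \<Longrightarrow> ser (Cst c * p) a = c * ser p a"
  using suminf_mult[OF trm_summable, of p a c]
  by (simp add: ser_def trm_def mult.assoc phi_Cst_mult)

lemma ser_0 [simp]: "ser 0 a = 0"
  by (simp add: ser_def trm_def)

lemma ser_sum:
  assumes "a \<in> cdom" "\<And>x. x \<in> X \<Longrightarrow> g x \<in> R"
  shows "ser (\<Sum>x\<in>X. g x) a = (\<Sum>x\<in>X. ser (g x) a)"
  using assms(2)
proof (induction X rule: infinite_finite_induct)
  case (insert x F)
  then show ?case using ser_add[of "g x" "sum g F" a] assms(1) by (simp add: R_sum)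
qed auto

text \<open>One factor \<open>form (a - b)\<close> is written out in coordinates and its monomials
  are absorbed into \<open>r\<close>; hence \<open>r\<close> is arbitrary in the induction.\<close>

lemma phi_power_holo:
  "holo_on UNIV (\<lambda>a. \<phi> (r * form (a - b) ^ k)) \<and>
   (\<forall>j a. pd j (\<lambda>a. \<phi> (r * form (a - b) ^ k)) a = of_nat k * \<phi> (r * avee j * form (a - b) ^ (k - 1)))"
proof (induction k arbitrary: r)
  case 0
  then show ?case by (simp add: holo_on_const)
next
  case (Suc k)
  have eq: "(\<lambda>a. \<phi> (r * form (a - b) ^ Suc k)) =
      (\<lambda>a. \<Sum>i\<in>UNIV. (a $ i + - (b $ i)) * \<phi> (r * avee i * form (a - b) ^ k))"
  proof
    fix a :: "complex ^ 'n dmon"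
    have "r * form (a - b) ^ Suc k = (\<Sum>i\<in>UNIV. Cst ((a - b) $ i) * (r * avee i * form (a - b) ^ k))"
      unfolding power_Suc by (subst (1) form_def) (simp add: sum_distrib_left sum_distrib_right mult_ac)
    then show "\<phi> (r * form (a - b) ^ Suc k) =
        (\<Sum>i\<in>UNIV. (a $ i + - (b $ i)) * \<phi> (r * avee i * form (a - b) ^ k))"
      by (simp add: phi_sum phi_Cst_mult)
  qed
  have c: "holo_on UNIV (\<lambda>a. a $ i + - (b $ i))"
    "pd j (\<lambda>a. a $ i + - (b $ i)) a = (if j = i then 1 else 0)" for i j a
    using holo_on_add[OF holo_on_coord[of UNIV i] holo_on_const[of UNIV "- (b $ i)"]]
    by (simp_all add: pd_coord)
  have h: "holo_on UNIV (\<lambda>a. (a $ i + - (b $ i)) * \<phi> (r * avee i * form (a - b) ^ k))" for i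
    by (intro holo_on_mult(1) c(1)) (use Suc in blast)
  have p: "pd j (\<lambda>a. (a $ i + - (b $ i)) * \<phi> (r * avee i * form (a - b) ^ k)) a =
      (a $ i + - (b $ i)) * (of_nat k * \<phi> (r * avee i * avee j * form (a - b) ^ (k - 1)))
      + (if j = i then \<phi> (r * avee j * form (a - b) ^ k) else 0)" for i j a
  proof -
    have "holo_on UNIV (\<lambda>a. \<phi> (r * avee i * form (a - b) ^ k))"
      and pp: "pd j (\<lambda>a. \<phi> (r * avee i * form (a - b) ^ k)) a =
        of_nat k * \<phi> (r * avee i * avee j * form (a - b) ^ (k - 1))"
      using Suc[of "r * avee i"] by blast+
    from holo_on_mult(2)[OF c(1) this(1), of a j] show ?thesis unfolding pp c(2) by auto
  qed
  \<comment> \<open>Reassembles the derivatives of the remaining \<open>k\<close> factors into the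
    full power; together with the derivative of the split factor this gives the coefficient
    \<open>Suc k\<close>.\<close>
  have last: "(\<Sum>i\<in>UNIV. (a $ i + - (b $ i)) * (of_nat k * \<phi> (r * avee i * avee j * form (a - b) ^ (k - 1)))) =
      of_nat k * \<phi> (r * avee j * form (a - b) ^ k)" for j a
  proof (cases k)
    case (Suc l)
    have "r * avee j * form (a - b) ^ Suc l = (\<Sum>i\<in>UNIV. Cst ((a - b) $ i) * (r * avee i * avee j * form (a - b) ^ l))"
      unfolding power_Suc by (subst (1) form_def) (simp add: sum_distrib_left sum_distrib_right mult_ac)
    then have "\<phi> (r * avee j * form (a - b) ^ Suc l) =
        (\<Sum>i\<in>UNIV. (a $ i + - (b $ i)) * \<phi> (r * avee i * avee j * form (a - b) ^ l))"
      by (simp only: phi_sum phi_Cst_mult) simp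
    then show ?thesis
      unfolding Suc by (simp add: sum_distrib_left mult.left_commute[of "of_nat _"] del: power_Suc of_nat_Suc)
  qed simp
  show ?case
    unfolding eq
  proof (intro conjI allI)
    show "holo_on UNIV (\<lambda>a. \<Sum>i\<in>UNIV. (a $ i + - (b $ i)) * \<phi> (r * avee i * form (a - b) ^ k))"
      by (rule holo_on_sum(1)[OF h])
    fix j a
    show "pd j (\<lambda>a. \<Sum>i\<in>UNIV. (a $ i + - (b $ i)) * \<phi> (r * avee i * form (a - b) ^ k)) a =
        of_nat (Suc k) * \<phi> (r * avee j * form (a - b) ^ (Suc k - 1))"
      unfolding holo_on_sum(2)[OF h UNIV_I] p sum.distrib last by (simp add: algebra_simps)
  qed
qed

lemma trm_has_derivative:
  "(trm r (Suc k) has_derivative (\<lambda>v. \<Sum>i\<in>UNIV. v $ i * trm (r * avee i) k a)) (at a)"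
proof -
  let ?p = "\<lambda>a. \<phi> (r * form (a - b) ^ Suc k)"
  have h: "holo_on UNIV ?p" and p: "pd j ?p a = of_nat (Suc k) * \<phi> (r * avee j * form (a - b) ^ k)" for j a
    using phi_power_holo[of r "Suc k"] by (simp_all only: diff_Suc_1)
  have t: "trm r (Suc k) = (\<lambda>a. (1 / fact (Suc k)) * ?p a)" by (simp add: fun_eq_iff trm_def)
  have "holo_on UNIV (trm r (Suc k))" unfolding t by (intro holo_on_mult(1) holo_on_const h)
  moreover have "pd j (trm r (Suc k)) a = trm (r * avee j) k a" for j
  proof -
    have "pd j (trm r (Suc k)) a = (1 / fact (Suc k)) * (of_nat (Suc k) * \<phi> (r * avee j * form (a - b) ^ k))"
      unfolding t using holo_on_mult(2)[OF holo_on_const h UNIV_I, of j "1 / fact (Suc k)" a] unfolding p pd_const by simp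
    also have "\<dots> = trm (r * avee j) k a"
      by (simp add: trm_def field_simps del: of_nat_Suc)
    finally show ?thesis .
  qed
  ultimately show ?thesis using holo_on_has_derivative[of UNIV "trm r (Suc k)" a] by simp
qed

text \<open>Termwise differentiation: the derived series are those of \<open>r * avee i\<close>,
  which converge uniformly on \<open>cdom\<close> because the radius serves all of
  \<open>R\<close>.\<close>

lemma ser_has_derivative:
  assumes r: "r \<in> R" and a: "a \<in> cdom"
  shows "(ser r has_derivative (\<lambda>v. \<Sum>i\<in>UNIV. v $ i * ser (r * avee i) a)) (at a)"
proof -
  have rR: "r * avee i \<in> R" for i using r by (intro R.mult R.gen)
  define g' where "g' x h = (\<Sum>i\<in>UNIV. h $ i * ser (r * avee i) x)" for x h
  \<comment> \<open>The series is started at \<open>Suc k\<close>, so that the derived series starts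
    at \<open>k = 0\<close>; the omitted first term is the constant \<open>\<phi> r\<close> and is
    added back below.\<close>
  have "\<exists>g. \<forall>x\<in>cdom. (\<lambda>k. trm r (Suc k) x) sums (g x) \<and> (g has_derivative g' x) (at x within cdom)"
  proof (rule has_derivative_series[OF cdom(2)])
    show "(trm r (Suc k) has_derivative (\<lambda>v. \<Sum>i\<in>UNIV. v $ i * trm (r * avee i) k x)) (at x within cdom)" for k x
      by (rule has_derivative_at_withinI[OF trm_has_derivative])
    show "a \<in> cdom" by fact
    show "(\<lambda>k. trm r (Suc k) a) sums suminf (\<lambda>k. trm r (Suc k) a)"
      by (rule summable_sums) (rule iffD2[OF summable_Suc_iff[of "\<lambda>k. trm r k a"] trm_summable[OF r a]])
    fix e :: real assume e: "e > 0"
    define e' where "e' = e / CARD('n dmon)"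
    have e': "e' > 0" using e by (simp add: e'_def)
    have "\<forall>\<^sub>F n in sequentially. \<forall>x\<in>cdom. dist (\<Sum>k<n. trm (r * avee i) k x) (ser (r * avee i) x) < e'" for i
      using trm_uniform[OF rR] e' unfolding uniform_limit_iff by blast
    then have "\<forall>\<^sub>F n in sequentially. \<forall>i. \<forall>x\<in>cdom. dist (\<Sum>k<n. trm (r * avee i) k x) (ser (r * avee i) x) < e'"
      by (rule eventually_all_finite)
    then show "\<forall>\<^sub>F n in sequentially. \<forall>x\<in>cdom. \<forall>h.
        norm ((\<Sum>k<n. \<Sum>i\<in>UNIV. h $ i * trm (r * avee i) k x) - g' x h) \<le> e * norm h"
    proof eventually_elim
      case (elim n)
      show ?case
      proof (intro ballI allI)
        fix x h assume x: "x \<in> cdom"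
        have "(\<Sum>k<n. \<Sum>i\<in>UNIV. h $ i * trm (r * avee i) k x) - g' x h =
            (\<Sum>i\<in>UNIV. h $ i * ((\<Sum>k<n. trm (r * avee i) k x) - ser (r * avee i) x))"
          unfolding g'_def by (subst sum.swap) (simp add: right_diff_distrib sum_subtractf sum_distrib_left)
        also have "norm \<dots> \<le> (\<Sum>i\<in>(UNIV :: 'n dmon set). norm h * e')"
        proof (intro order_trans[OF norm_sum] sum_mono)
          fix i
          have "norm ((\<Sum>k<n. trm (r * avee i) k x) - ser (r * avee i) x) \<le> e'"
            using elim x by (simp add: dist_norm less_imp_le)
          then show "norm (h $ i * ((\<Sum>k<n. trm (r * avee i) k x) - ser (r * avee i) x)) \<le> norm h * e'"
            unfolding norm_mult by (intro mult_mono Finite_Cartesian_Product.norm_nth_le) simp_all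
        qed
        also have "\<dots> = e * norm h" by (simp add: e'_def)
        finally show "norm ((\<Sum>k<n. \<Sum>i\<in>UNIV. h $ i * trm (r * avee i) k x) - g' x h) \<le> e * norm h" .
      qed
    qed
  qed
  then obtain g where g: "\<forall>x\<in>cdom. (\<lambda>k. trm r (Suc k) x) sums (g x) \<and> (g has_derivative g' x) (at x within cdom)"
    by (rule exE)
  have "(g has_derivative g' a) (at a within cdom)" using bspec[OF g a] by (rule conjunct2)
  then have "(g has_derivative g' a) (at a)" unfolding at_within_open[OF a cdom(1)] .
  from has_derivative_add[OF this has_derivative_const[of "\<phi> r"]]
  have ga: "((\<lambda>x. g x + \<phi> r) has_derivative g' a) (at a)" by simp
  have eq: "g x + \<phi> r = ser r x" if x: "x \<in> cdom" for x
  proof -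
    have "(\<lambda>k. trm r (Suc k) x) sums (g x)" using bspec[OF g x] by (rule conjunct1)
    then have "(\<lambda>k. trm r k x) sums (g x + trm r 0 x)" by (rule sums_Suc)
    then have "g x + trm r 0 x = ser r x" unfolding ser_def by (rule sums_unique)
    then show ?thesis by (simp add: trm_def)
  qed
  have "(ser r has_derivative g' a) (at a)"
    by (rule has_derivative_transform_within_open[OF ga cdom(1) a eq])
  then show ?thesis unfolding g'_def .
qed

lemma holo_on_ser: "r \<in> R \<Longrightarrow> holo_on cdom (ser r)"
  and pd_ser: "r \<in> R \<Longrightarrow> a \<in> cdom \<Longrightarrow> pd i (ser r) a = ser (r * avee i) a"
  using holo_onI[of cdom "ser r", OF ser_has_derivative] by blast+

text \<open>Differentiating the series is multiplication in its argument, so operators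
  \<open>P\<close> with \<open>to_R P = 0\<close> annihilate \<open>ser 1\<close>.\<close>

lemma diffop_ser:
  assumes "a \<in> cdom"
  shows "diffop P (ser 1) a = ser (to_R P) a"
proof -
  have "\<forall>a\<in>cdom. diffop P (ser 1) a = ser (to_R P) a"
  proof (induction P rule: mpol_Var_induct)
    case (Cst c)
    then show ?case using ser_Cst_mult[OF R_1, of _ c] by (simp add: diffop_Cst)
  next
    case (add P Q)
    have "to_R P \<in> R" "to_R Q \<in> R" unfolding R_eq_range_to_R by blast+
    then show ?case using add by (simp add: diffop_add to_R_add ser_add)
  next
    case (Var P j)
    have R: "to_R P \<in> R" unfolding R_eq_range_to_R by blast
    show ?case
    proof
      fix a assume a: "a \<in> cdom"
      have "diffop (Var j * P) (ser 1) a = pd j (diffop P (ser 1)) a"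
        by (rule diffop_Var_mult[OF cdom(1) holo_on_ser[OF R_1] a])
      also have "\<dots> = pd j (ser (to_R P)) a" by (rule pd_cong[OF cdom(1) a]) (use Var in blast)
      also have "\<dots> = ser (to_R (Var j * P)) a" using pd_ser[OF R a] by (simp add: to_R_mult mult.commute)
      finally show "diffop (Var j * P) (ser 1) a = ser (to_R (Var j * P)) a" .
    qed
  qed
  then show ?thesis using assms by blast
qed

lemma phi_Zb:
  assumes "x \<in> ghat" "r \<in> R"
  shows "\<phi> (Zb b x r) = 0"
proof -
  obtain N where N: "degs {..N} r" using degs_bound_exists by blast
  have "degs (odeg TYPE('n) (Suc N)) (Var v * r)" for v
    unfolding degs_def
  proof (intro allI impI)
    fix \<alpha> assume nz: "coef (Var v * r) \<alpha> \<noteq> 0"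
    have V: "degs {1} (Var v :: ('n, complex) mpol)" by (auto simp: Var_def intro: degs_single)
    have "degs {1 + CARD('n) * i | i. True} (Var v * r)"
      by (rule degs_mult[OF V assms(2)[unfolded R_iff_degs]]) auto
    then obtain i where i: "mdeg \<alpha> = 1 + CARD('n) * i" using nz by (auto simp: degs_def)
    have "degs {..Suc N} (Var v * r)" by (rule degs_mult[OF V N]) auto
    then have "CARD('n) * i \<le> N" using nz i by (auto simp: degs_def)
    moreover have "1 * i \<le> CARD('n) * i" by (intro mult_right_mono) (simp_all add: Suc_le_eq)
    ultimately have "i < Suc N" by linarith
    then show "mdeg \<alpha> \<in> odeg TYPE('n) (Suc N)" using i by (auto simp: odeg_def)
  qed
  then have "\<phi> (dtw b u (Var v * r)) = 0" for u v by (rule phi_dtw)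
  then show ?thesis unfolding Zb_eq_dtw[OF assms(1)] by (simp add: phi_minus phi_sum phi_Cst_mult)
qed

text \<open>With \<open>g = f(a) - f(b)\<close> the \<open>k\<close>-th summand is \<open>w\<^sub>k - w\<^sub>k\<^sub>-\<^sub>1\<close> for \<open>w\<^sub>k = \<phi>(\<theta>(g) g\<^sup>k) / k!\<close>, so the series telescopes.\<close>

lemma ser_Z:
  assumes x: "x \<in> ghat" and a: "a \<in> cdom"
  shows "ser (zth x (form a)) a = snd x * ser 1 a"
proof -
  define g where "g = form (a - b)"
  have fR: "form c \<in> R" for c
    using degs_form[of c] by (auto simp: R_iff_degs intro: degs_mono image_eqI[of _ _ 1])
  have fa: "form a = form b + g" using form_add[of b "a - b"] by (simp add: g_def)
  have gk: "g ^ k \<in> R" for k by (induction k) (auto intro: R_1 R.mult fR simp: g_def)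
  define w where "w k = trm (zth x g) k a" for k
  have wR: "zth x g \<in> R" by (intro R_closed) (simp add: g_def fR)
  have pw: "zth x (g ^ k) = of_nat k * (zth x g * g ^ (k - 1))" for k
  proof (induction k)
    case 0
    then show ?case using zth_Cst[of x 1] by simp
  next
    case (Suc k)
    then show ?case by (cases k) (simp_all add: zth_mult algebra_simps)
  qed
  have t: "trm (zth x (form a)) k a - snd x * trm 1 k a = w k - (if k = 0 then 0 else w (k - 1))" for k
  proof -
    have "zth x (form a) * g ^ k = zth x (form b) * g ^ k + zth x g * g ^ k"
      by (simp add: fa zth_add distrib_right)
    also have "zth x (form b) * g ^ k = Zb b x (g ^ k) - zth x (g ^ k) + Cst (snd x) * g ^ k"
      by (simp add: Zb_def)
    finally have "\<phi> (zth x (form a) * g ^ k) =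
        \<phi> (Zb b x (g ^ k)) - \<phi> (zth x (g ^ k)) + snd x * \<phi> (g ^ k) + \<phi> (zth x g * g ^ k)"
      by (simp only: phi_add phi_diff phi_Cst_mult)
    also have "\<phi> (Zb b x (g ^ k)) = 0" by (rule phi_Zb[OF x gk])
    also have "\<phi> (zth x (g ^ k)) = of_nat k * \<phi> (zth x g * g ^ (k - 1))"
      unfolding pw by (metis Cst_of_nat phi_Cst_mult)
    finally have "\<phi> (zth x (form a) * g ^ k) =
        snd x * \<phi> (g ^ k) + \<phi> (zth x g * g ^ k) - of_nat k * \<phi> (zth x g * g ^ (k - 1))" by simp
    then show ?thesis
      by (cases k) (simp_all add: trm_def w_def field_simps flip: g_def del: of_nat_Suc)
  qed
  have w0: "w \<longlonglongrightarrow> 0" unfolding w_def by (rule summable_LIMSEQ_zero[OF trm_summable[OF wR a]])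
  have tele: "(\<Sum>k<Suc n. w k - (if k = 0 then 0 else w (k - 1))) = w n" for n
    by (induction n) auto
  have "(\<lambda>k. w k - (if k = 0 then 0 else w (k - 1))) sums 0"
    unfolding sums_def by (rule LIMSEQ_imp_Suc) (unfold tele, rule w0)
  then have "(\<lambda>k. trm (zth x (form a)) k a - snd x * trm 1 k a) sums 0" unfolding t .
  moreover have "(\<lambda>k. trm (zth x (form a)) k a - snd x * trm 1 k a) sums
      (ser (zth x (form a)) a - snd x * ser 1 a)"
    unfolding ser_def
    by (intro sums_diff sums_mult summable_sums trm_summable R_1 R_closed fR a)
  ultimately have "ser (zth x (form a)) a - snd x * ser 1 a = 0" by (rule sums_unique2[rotated])
  then show ?thesis by simp
qed

text \<open>\<open>ser_Z\<close> at \<open>(A, 0)\<close> is the invariance under \<open>sl\<close>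
  and at \<open>(0, 1)\<close> the homogeneity equation; \<open>form_ser\<close> rewrites values of
  \<open>ser\<close> at forms as combinations of first derivatives.\<close>

lemma ser_in_sol: "ser 1 \<in> sol cdom"
proof -
  have form_ser: "ser p a = (\<Sum>i\<in>UNIV. coef p (expo i) * pd i (ser 1) a)"
    if p: "degs {CARD('n)} p" and a: "a \<in> cdom" for p a
  proof -
    have "ser p a = ser (\<Sum>i\<in>UNIV. Cst (coef p (expo i)) * avee i) a" using avee_expand[OF p] by simp
    also have "\<dots> = (\<Sum>i\<in>UNIV. coef p (expo i) * ser (avee i) a)"
      using a by (simp add: ser_sum ser_Cst_mult R.gen R.mult R.const)
    also have "\<dots> = (\<Sum>i\<in>UNIV. coef p (expo i) * pd i (ser 1) a)"
      using pd_ser[OF R_1 a] by simp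
    finally show ?thesis .
  qed
  have lin: "(\<Sum>i\<in>UNIV. coef (lin_vf A (form a)) (expo i) * pd i (ser 1) a) = 0"
    if A: "A \<in> sl" and a: "a \<in> cdom" for A a
  proof -
    have x: "(A, 0) \<in> ghat" using A by (simp add: ghat_def)
    have z: "zth (A, 0) (form a) = lin_vf A (form a)" by (simp add: zth_eq)
    have "degs {CARD('n)} (lin_vf A (form a))" using degs_zth[OF degs_form, of "(A, 0)" a] by (simp add: z)
    then show ?thesis using form_ser[OF _ a] ser_Z[OF x a] by (simp add: z)
  qed
  have eul: "(\<Sum>i\<in>UNIV. a $ i * pd i (ser 1) a) + ser 1 a = 0" if a: "a \<in> cdom" for a
  proof -
    have x: "(0, 1) \<in> ghat" by (simp add: ghat_def sl_def trace_def)
    have ef: "euler (form a) = form a"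
      unfolding euler_def euler_identity[OF degs_form] Cst_of_nat[symmetric]
      by (simp flip: mult.assoc Cst_mult)
    have z: "zth (0, 1) (form a) = Cst (- 1) * form a"
      unfolding zth_eq ef by (simp add: lin_vf_def Cst_minus)
    have cf: "coef (form a) (expo i) = a $ i" for i
    proof -
      have "coef (form a) (expo i) = (\<Sum>j\<in>UNIV. if j = i then a $ j else 0)"
        unfolding form_def lookup_sum coef_Cst_mult avee_def
        by (intro sum.cong) (auto simp: lookup_single when_def expo_inject)
      then show ?thesis by simp
    qed
    have "form a \<in> R" using degs_form[of a] by (auto simp: R_iff_degs intro: degs_mono image_eqI[of _ _ 1])
    then have "ser (zth (0, 1) (form a)) a = - ser (form a) a" unfolding z using a by (simp add: ser_Cst_mult)
    then show ?thesis using ser_Z[OF x a] form_ser[OF degs_form a, of a] by (simp add: cf add_eq_0_iff2)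
  qed
  show ?thesis
    unfolding sol_def using holo_on_ser[OF R_1] diffop_ser lin eul by simp
qed

lemma ser_at_center: "ser r b = \<phi> r"
proof -
  have "trm r k b = (if k = 0 then \<phi> r else 0)" for k
    by (cases k) (simp_all add: trm_def)
  then show ?thesis unfolding ser_def using suminf_finite[of "{0}" "\<lambda>k. trm r k b"] by simp
qed

end

lemma diffop_zero_imp_twisted_image:
  fixes \<delta> :: "('n::finite dmon, complex) mpol"
  assumes b: "b \<in> smooth_forms" and d: "to_R \<delta> \<in> R_le (int d)"
    and z: "\<And>U s. open U \<Longrightarrow> b \<in> U \<Longrightarrow> s \<in> sol U \<Longrightarrow> diffop \<delta> s b = 0"
  shows "to_R \<delta> \<in> twisted_image d b"
proof (rule ccontr)
  assume neg: "to_R \<delta> \<notin> twisted_image d b"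
  let ?V = "{dtw b u p | u p k. degs (odeg TYPE('n) k) p}"
  have notin: "to_R \<delta> \<notin> sp.span ?V"
  proof
    assume mem: "to_R \<delta> \<in> sp.span ?V"
    have comb: "\<exists>s k. (\<forall>u. degs (odeg TYPE('n) k) (s u)) \<and> h = (\<Sum>u\<in>UNIV. dtw b u (s u))"
      if h: "h \<in> sp.span ?V" for h
      using h
    proof (induction rule: sp.span_induct_alt)
      case base
      show ?case by (rule exI[of _ "\<lambda>_. 0"], rule exI[of _ 0]) simp
    next
      case (step c v h)
      obtain u p k where v: "v = dtw b u p" "degs (odeg TYPE('n) k) p" using step(1) by blast
      obtain s k' where s0: "\<forall>u. degs (odeg TYPE('n) k') (s u)" and s2: "h = (\<Sum>u\<in>UNIV. dtw b u (s u))"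
        using step(2) by (elim exE conjE)
      note s = s0[rule_format] s2
      define s' where "s' w = (if w = u then Cst c * p else 0) + s w" for w
      have "degs (odeg TYPE('n) (max k k')) (s' w)" for w
      proof -
        have "odeg TYPE('n) k \<subseteq> odeg TYPE('n) (max k k')" "odeg TYPE('n) k' \<subseteq> odeg TYPE('n) (max k k')"
          by (auto simp: odeg_def)
        note degs_mono[OF v(2) this(1)] degs_mono[OF s(1) this(2)]
        then show ?thesis
          unfolding s'_def by (intro degs_add) (simp_all add: degs_Cst_mult)
      qed
      moreover have "scale_poly c v + h = (\<Sum>w\<in>UNIV. dtw b w (s' w))"
      proof -
        have "(\<Sum>w\<in>UNIV. dtw b w (if w = u then Cst c * p else 0)) =
            (\<Sum>w\<in>UNIV. if w = u then Cst c * dtw b w p else 0)"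
          by (intro sum.cong) (auto simp: dtw_Cst_mult)
        then show ?thesis by (simp add: s'_def dtw_add sum.distrib s(2) v(1) scale_poly_def)
      qed
      ultimately show ?case by (intro exI[of _ s'] exI[of _ "max k k'"] conjI allI)
    qed
    obtain s k where s: "\<forall>u. degs (odeg TYPE('n) k) (s u)" "to_R \<delta> = (\<Sum>u\<in>UNIV. dtw b u (s u))"
      using comb[OF mem] by (elim exE conjE)
    have "degs {..CARD('n) * d} (to_R \<delta>)"
      using d unfolding R_le_iff_degs' by (rule degs_mono) (auto simp: edeg_def)
    then have "degs {..CARD('n) * d} (\<Sum>u\<in>UNIV. dtw b u (s u))" by (simp only: s(2))
    from dtw_strict[of b k s d, OF b s(1)[rule_format] this] obtain s' where "\<forall>u. degs (odeg TYPE('n) d) (s' u)"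
      "(\<Sum>u\<in>UNIV. dtw b u (s' u)) = (\<Sum>u\<in>UNIV. dtw b u (s u))"
      by (elim exE conjE)
    then have "(\<Sum>u\<in>UNIV. dtw b u (s u)) \<in> twisted_image d b"
      unfolding twisted_image_def by (intro CollectI exI[of _ s']) simp
    then have "to_R \<delta> \<in> twisted_image d b" by (simp only: s(2))
    then show False using neg by blast
  qed
  \<comment> \<open>A basis of the span of \<open>?V\<close>, to which \<open>to_R \<delta>\<close>
    can be adjoined: the functional is prescribed as \<open>1\<close> there and \<open>0\<close> on
    \<open>B\<close>.\<close>
  obtain B where B: "B \<subseteq> ?V" "sp.independent B" "?V \<subseteq> sp.span B"
    using sp.maximal_independent_subset[of ?V] by blast
  have "sp.span B = sp.span ?V"
  proof
    show "sp.span B \<subseteq> sp.span ?V" by (rule sp.span_mono[OF B(1)])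
    show "sp.span ?V \<subseteq> sp.span B" by (rule sp.span_minimal[OF B(3) sp.subspace_span])
  qed
  then have hB: "to_R \<delta> \<notin> sp.span B" using notin by simp
  then have ind: "sp.independent (insert (to_R \<delta>) B)" using B(2) by (simp add: sp.independent_insert)
  interpret cx: vector_space "(*) :: complex \<Rightarrow> complex \<Rightarrow> complex"
    by unfold_locales (simp_all add: algebra_simps)
  interpret vp: vector_space_pair "scale_poly :: complex \<Rightarrow> ('n, complex) mpol \<Rightarrow> _" "(*) :: complex \<Rightarrow> complex \<Rightarrow> complex" ..
  obtain \<phi> where lin: "Vector_Spaces.linear scale_poly (*) \<phi>"
    and phi: "\<And>x. x \<in> insert (to_R \<delta>) B \<Longrightarrow> \<phi> x = (if x = to_R \<delta> then 1 else 0)"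
    using vp.linear_independent_extend[OF ind, of "\<lambda>x. if x = to_R \<delta> then 1 else 0"] by blast
  have zero: "\<phi> h = 0" if "h \<in> sp.span B" for h
    using that
  proof (induction rule: sp.span_induct_alt)
    case base
    show ?case using lin by (rule vp.linear_0)
  next
    case (step c x y)
    have "\<phi> x = 0" using phi[of x] step(1) hB sp.span_base[of x B] by auto
    then show ?case using step(2) by (simp add: vp.linear_add[OF lin] vp.linear_scale[OF lin])
  qed
  interpret annihilator b \<phi>
  proof
    show "b \<in> smooth_forms" by fact
    show "\<phi> (p + q) = \<phi> p + \<phi> q" for p q by (rule vp.linear_add[OF lin])
    show "\<phi> (Cst c * p) = c * \<phi> p" for c p using vp.linear_scale[OF lin, of c p] by (simp add: scale_poly_def)
    show "\<phi> (dtw b u p) = 0" if "degs (odeg TYPE('n) k) p" for u k p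
      using that B(3) by (intro zero) blast
  qed
  have "diffop \<delta> (ser 1) b = \<phi> (to_R \<delta>)"
    unfolding diffop_ser[OF cdom(3)] by (rule ser_at_center)
  also have "\<dots> = 1" using phi[of "to_R \<delta>"] by simp
  finally show False using z[OF cdom(1,3) ser_in_sol] by simp
qed

section \<open>The rank condition\<close>

lemma cols_augment:
  assumes "A \<in> carrier_mat nr nc" "v \<in> carrier_vec nr"
  shows "cols (augment A v) = cols A @ [v]"
  unfolding augment_def using assms by (intro cols_mat_of_cols) (auto simp: cols_def)

lemma augment_carrier:
  assumes "A \<in> carrier_mat nr nc"
  shows "augment A v \<in> carrier_mat nr (Suc nc)"
  using assms by (auto simp: augment_def)

text \<open>A vector outside the column span enlarges a maximal independent set of columns. The sum
  runs over the set of columns, so repeated columns count once.\<close>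

lemma rk_augment_iff:
  assumes A: "A \<in> carrier_mat nr nc" and v: "v \<in> carrier_vec nr"
  shows "rk A = rk (augment A v) \<longleftrightarrow>
    (\<exists>c. \<forall>i<nr. vec_index v i = (\<Sum>x\<in>set (cols A). c x * vec_index x i))"
proof -
  interpret V: vec_space "TYPE(complex)" nr .
  have rA: "rk A = V.rank A" and rB: "rk (augment A v) = V.rank (augment A v)"
    using A augment_carrier[OF A, of v] by (auto simp: rk_def)
  have C: "set (cols A) \<subseteq> carrier_vec nr" using A cols_dim[of A] by auto
  have cB: "set (cols (augment A v)) = set (cols A) \<union> {v}" by (simp add: cols_augment[OF A v])
  have "V.rank A = V.rank (augment A v) \<longleftrightarrow> v \<in> V.span (set (cols A))"
  proof
    assume "v \<in> V.span (set (cols A))"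
    then have "V.span (set (cols A)) = V.span (set (cols A) \<union> {v})" using C by (intro V.already_in_span) auto
    then show "V.rank A = V.rank (augment A v)" unfolding V.rank_def cB by simp
  next
    assume eq: "V.rank A = V.rank (augment A v)"
    show "v \<in> V.span (set (cols A))"
    proof (rule ccontr)
      assume nv: "v \<notin> V.span (set (cols A))"
      obtain S where S: "finite S" "maximal S (\<lambda>T. T \<subseteq> set (cols A) \<and> V.lin_indpt T)"
        using maximal_exists_superset[of "set (cols A)" "\<lambda>T. T \<subseteq> set (cols A) \<and> V.lin_indpt T" "{}"]
          V.finite_lin_indpt2[of "{}"] by auto
      then have S2: "S \<subseteq> set (cols A)" "V.lin_indpt S" by (auto simp: maximal_def)
      have rS: "V.rank A = card S" by (rule V.rank_card_indpt[OF A S(2)])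
      have vS: "v \<notin> V.span S" using nv V.span_is_monotone[OF S2(1)] by blast
      have SC: "S \<subseteq> carrier_vec nr" using S2(1) C by blast
      have "v \<notin> S" using vS V.span_mem[of S v] SC by auto
      then have "V.lin_indpt (S \<union> {v})"
        using V.lin_dep_iff_in_span[of S v] SC S2(2) v vS by auto
      then have "card (S \<union> {v}) \<le> V.rank (augment A v)"
        using S2(1) by (intro V.rank_ge_card_indpt[OF augment_carrier[OF A]]) (auto simp: cB)
      then show False using eq rS \<open>v \<notin> S\<close> S(1) by simp
    qed
  qed
  also have "v \<in> V.span (set (cols A)) \<longleftrightarrow> (\<exists>a. v = V.lincomb a (set (cols A)))"
    using V.finite_span[of "set (cols A)"] C by auto
  also have "\<dots> \<longleftrightarrow> (\<exists>c. \<forall>i<nr. vec_index v i = (\<Sum>x\<in>set (cols A). c x * vec_index x i))"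
  proof
    assume "\<exists>a. v = V.lincomb a (set (cols A))"
    then obtain a where "v = V.lincomb a (set (cols A))" by blast
    then show "\<exists>c. \<forall>i<nr. vec_index v i = (\<Sum>x\<in>set (cols A). c x * vec_index x i)"
      using V.lincomb_index[OF _ C, of _ a] by (intro exI[of _ a]) simp
  next
    assume "\<exists>c. \<forall>i<nr. vec_index v i = (\<Sum>x\<in>set (cols A). c x * vec_index x i)"
    then obtain c where c: "\<forall>i<nr. vec_index v i = (\<Sum>x\<in>set (cols A). c x * vec_index x i)" by blast
    have d: "dim_vec (V.lincomb c (set (cols A))) = nr" using V.lincomb_dim[of "set (cols A)" c] C by simp
    have "v = V.lincomb c (set (cols A))"
    proof (rule eq_vecI)
      show "dim_vec v = dim_vec (V.lincomb c (set (cols A)))" using v d by simp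
      show "vec_index v i = vec_index (V.lincomb c (set (cols A))) i" if "i < dim_vec (V.lincomb c (set (cols A)))" for i
        using that c V.lincomb_index[OF _ C, of i c] unfolding d by simp
    qed
    then show "\<exists>a. v = V.lincomb a (set (cols A))" by blast
  qed
  finally show ?thesis unfolding rA rB .
qed

text \<open>Translates the rank into \<open>indepf\<close>, for which \<open>indepf_open\<close>
  gives semicontinuity in \<open>b\<close>. The rank speaks of sets of columns, so indices are
  chosen for them; conversely, independence makes the columns distinct.\<close>

lemma rk_ge_iff:
  assumes A: "A \<in> carrier_mat nr nc"
  shows "k \<le> rk A \<longleftrightarrow> (\<exists>J\<subseteq>{..<nc}. card J = k \<and> indepf J (\<lambda>j i. A $$ (i, j)) {..<nr})"
proof -
  interpret V: vec_space "TYPE(complex)" nr .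
  have rA: "rk A = V.rank A" using A by (simp add: rk_def)
  have C: "set (cols A) \<subseteq> carrier_vec nr" using A cols_dim[of A] by auto
  have cA: "set (cols A) = col A ` {..<nc}" using A by (auto simp: cols_def)
  have idx: "vec_index (col A j) i = A $$ (i, j)" if "j < nc" "i < nr" for i j using A that by simp
  show ?thesis
  proof
    assume k: "k \<le> rk A"
    obtain S where S: "finite S" "maximal S (\<lambda>T. T \<subseteq> set (cols A) \<and> V.lin_indpt T)"
      using maximal_exists_superset[of "set (cols A)" "\<lambda>T. T \<subseteq> set (cols A) \<and> V.lin_indpt T" "{}"]
        V.finite_lin_indpt2[of "{}"] by auto
    then have S2: "S \<subseteq> set (cols A)" "V.lin_indpt S" by (auto simp: maximal_def)
    have rS: "V.rank A = card S" by (rule V.rank_card_indpt[OF A S(2)])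
    have SC: "S \<subseteq> carrier_vec nr" using S2(1) C by blast
    have "\<forall>x\<in>S. \<exists>j. j < nc \<and> col A j = x" using S2(1) unfolding cA by auto
    from bchoice[OF this] obtain ix where ix: "\<And>x. x \<in> S \<Longrightarrow> ix x < nc \<and> col A (ix x) = x" by blast
    have inj: "inj_on ix S" by (rule inj_onI) (metis ix)
    have indS: "indepf (ix ` S) (\<lambda>j i. A $$ (i, j)) {..<nr}"
      unfolding indepf_def
    proof (intro allI impI ballI)
      fix \<nu> j assume z: "\<forall>i\<in>{..<nr}. (\<Sum>j\<in>ix ` S. \<nu> j * A $$ (i, j)) = 0" and j: "j \<in> ix ` S"
      obtain x where x: "x \<in> S" "j = ix x" using j by blast
      define a where "a y = \<nu> (ix y)" for y
      have "V.lincomb a S = 0\<^sub>v nr"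
      proof (rule eq_vecI)
        show "dim_vec (V.lincomb a S) = dim_vec (0\<^sub>v nr)" using V.lincomb_dim[OF S(1) SC, of a] by simp
        fix i assume "i < dim_vec (0\<^sub>v nr)"
        then have i: "i < nr" by simp
        have "vec_index (V.lincomb a S) i = (\<Sum>y\<in>S. a y * vec_index y i)" by (rule V.lincomb_index[OF i SC])
        also have "\<dots> = (\<Sum>y\<in>S. \<nu> (ix y) * A $$ (i, ix y))"
        proof (rule sum.cong[OF refl])
          fix y assume "y \<in> S"
          then show "a y * vec_index y i = \<nu> (ix y) * A $$ (i, ix y)"
            using idx[of "ix y" i] ix[of y] i by (simp add: a_def)
        qed
        also have "\<dots> = (\<Sum>j\<in>ix ` S. \<nu> j * A $$ (i, j))" using inj by (simp add: sum.reindex)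
        finally show "vec_index (V.lincomb a S) i = vec_index (0\<^sub>v nr) i" using z i by simp
      qed
      then have "a x = 0" using S2(2) S(1) x(1) by (simp add: V.lin_dep_def) blast
      then show "\<nu> j = 0" by (simp add: a_def x(2))
    qed
    have cardS: "card (ix ` S) = rk A" using inj rS rA by (simp add: card_image)
    obtain J where J: "J \<subseteq> ix ` S" "card J = k"
      using k cardS obtain_subset_with_card_n[of k "ix ` S"] by auto
    have "indepf J (\<lambda>j i. A $$ (i, j)) {..<nr}"
      by (rule indepf_subset[OF indS J(1)]) (use S(1) in simp)
    moreover have "J \<subseteq> {..<nc}" using J(1) ix by auto
    ultimately show "\<exists>J\<subseteq>{..<nc}. card J = k \<and> indepf J (\<lambda>j i. A $$ (i, j)) {..<nr}" using J(2) by blast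
  next
    assume "\<exists>J\<subseteq>{..<nc}. card J = k \<and> indepf J (\<lambda>j i. A $$ (i, j)) {..<nr}"
    then obtain J where J: "J \<subseteq> {..<nc}" "card J = k" "indepf J (\<lambda>j i. A $$ (i, j)) {..<nr}" by blast
    have finJ: "finite J" using J(1) by (rule finite_subset) simp
    have inj: "inj_on (col A) J"
    proof (rule inj_onI, rule ccontr)
      fix j l assume jl: "j \<in> J" "l \<in> J" "col A j = col A l" "j \<noteq> l"
      define \<nu> where "\<nu> m = (if m = j then 1 else if m = l then - 1 else (0::complex))" for m
      have "(\<Sum>m\<in>J. \<nu> m * A $$ (i, m)) = 0" if "i \<in> {..<nr}" for i
      proof -
        have "(\<Sum>m\<in>J. \<nu> m * A $$ (i, m)) = (\<Sum>m\<in>{j, l}. \<nu> m * A $$ (i, m))"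
          using finJ jl by (intro sum.mono_neutral_right) (auto simp: \<nu>_def)
        also have "\<dots> = A $$ (i, j) - A $$ (i, l)" using jl(4) by (simp add: \<nu>_def)
        also have "\<dots> = 0"
        proof -
          have "j < nc" "l < nc" "i < nr" using jl(1,2) J(1) that by auto
          then show ?thesis using idx[of j i] idx[of l i] jl(3) by simp
        qed
        finally show ?thesis .
      qed
      then have "\<nu> j = 0" using indepfD[OF J(3), of \<nu> j] jl(1) by blast
      then show False by (simp add: \<nu>_def)
    qed
    have "V.lin_indpt (col A ` J)"
    proof
      assume "V.lin_dep (col A ` J)"
      then obtain T a v where T: "finite T" "T \<subseteq> col A ` J" "V.lincomb a T = 0\<^sub>v nr" "v \<in> T" "a v \<noteq> 0"
        unfolding V.lin_dep_def by auto
      define \<nu> where "\<nu> j = (if col A j \<in> T then a (col A j) else 0)" for j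
      have TC: "T \<subseteq> carrier_vec nr" using T(2) J(1) C cA by auto
      have "(\<Sum>j\<in>J. \<nu> j * A $$ (i, j)) = 0" if i: "i \<in> {..<nr}" for i
      proof -
        have "(\<Sum>j\<in>J. \<nu> j * A $$ (i, j)) = (\<Sum>j\<in>J. (if col A j \<in> T then a (col A j) * vec_index (col A j) i else 0))"
          using idx i J(1) by (intro sum.cong) (auto simp: \<nu>_def)
        also have "\<dots> = (\<Sum>x\<in>col A ` J. (if x \<in> T then a x * vec_index x i else 0))"
          using inj by (simp add: sum.reindex)
        also have "\<dots> = (\<Sum>x\<in>T. a x * vec_index x i)"
          using T(2) finJ by (intro sum.mono_neutral_cong_right) auto
        also have "\<dots> = vec_index (V.lincomb a T) i" using V.lincomb_index[OF _ TC, of i a] i by simp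
        finally show ?thesis using T(3) i by simp
      qed
      moreover obtain j where "j \<in> J" "v = col A j" using T(2,4) by blast
      ultimately show False using indepfD[OF J(3), of \<nu> j] T(4,5) by (auto simp: \<nu>_def)
    qed
    then have "card (col A ` J) \<le> V.rank A"
      using J(1) cA by (intro V.rank_ge_card_indpt[OF A]) auto
    then show "k \<le> rk A" using inj J(2) rA by (simp add: card_image)
  qed
qed

text \<open>Independence of \<open>k\<close> columns persists on a Zariski neighbourhood.\<close>

lemma rk_less_closed:
  fixes M :: "('i::finite, complex) mpol Matrix.mat"
  assumes M: "M \<in> carrier_mat nr nc"
  shows "zariski_closed {b. rk (map_mat (\<lambda>p. eval p b) M) < k}"
  unfolding zariski_closed_iff
proof (intro allI impI)
  fix b0 assume "b0 \<notin> {b. rk (map_mat (\<lambda>p. eval p b) M) < k}"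
  then have "k \<le> rk (map_mat (\<lambda>p. eval p b0) M)" by simp
  moreover have C: "map_mat (\<lambda>p. eval p b) M \<in> carrier_mat nr nc" for b using M by simp
  ultimately obtain J where J: "J \<subseteq> {..<nc}" "card J = k"
    "indepf J (\<lambda>j i. map_mat (\<lambda>p. eval p b0) M $$ (i, j)) {..<nr}"
    unfolding rk_ge_iff[OF C] by blast
  define a where "a b j i = eval (M $$ (i, j)) b" for b j i
  have a: "indepf J (a b) {..<nr} \<longleftrightarrow> indepf J (\<lambda>j i. map_mat (\<lambda>p. eval p b) M $$ (i, j)) {..<nr}" for b
  proof -
    have "(\<Sum>j\<in>J. \<nu> j * a b j i) = (\<Sum>j\<in>J. \<nu> j * map_mat (\<lambda>p. eval p b) M $$ (i, j))" if "i < nr" for \<nu> i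
      using J(1) M that by (intro sum.cong) (auto simp: a_def)
    then show ?thesis unfolding indepf_def by simp
  qed
  have "finite J" using J(1) by (rule finite_subset) simp
  moreover have "polyfun (\<lambda>b. a b j i)" for j i unfolding a_def by (rule polyfun_eval)
  moreover have "indepf J (a b0) {..<nr}" using J(3) a by blast
  ultimately obtain p where p: "eval p b0 \<noteq> 0" "\<And>b. eval p b \<noteq> 0 \<Longrightarrow> indepf J (a b) {..<nr}"
    using indepf_open[of J a b0 "{..<nr}"] by blast
  have "eval p c = 0" if "c \<in> {b. rk (map_mat (\<lambda>p. eval p b) M) < k}" for c
  proof (rule ccontr)
    assume "eval p c \<noteq> 0"
    then have "k \<le> rk (map_mat (\<lambda>p. eval p c) M)"
      unfolding rk_ge_iff[OF C] using p(2) J(1,2) a by blast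
    then show False using that by simp
  qed
  then show "\<exists>p. eval p b0 \<noteq> 0 \<and> (\<forall>c\<in>{b. rk (map_mat (\<lambda>p. eval p b) M) < k}. eval p c = 0)"
    using p(1) by blast
qed

section \<open>Specialization of the universal section\<close>

definition eva :: "complex ^ 'j::finite \<Rightarrow> ('j, ('n, complex) mpol) mpol \<Rightarrow> ('n, complex) mpol" where
  "eva b q = subst (\<lambda>r. r) (\<lambda>i. Cst (b $ i)) q"

lemma eva_add: "eva b (p + q) = eva b p + eva b q"
  and eva_mult: "eva b (p * q) = eva b p * eva b q"
  unfolding eva_def by (rule subst_add subst_mult; simp)+

lemma eva_Cst [simp]: "eva b (Cst r) = r"
  by (simp add: eva_def Cst_def subst_single)

lemma eva_minus: "eva b (- p) = - eva b p"
proof -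
  have "eva b p + eva b (- p) = 0" unfolding eva_add[symmetric] by (simp add: eva_def subst_def)
  then show ?thesis by (simp add: eq_neg_iff_add_eq_0 add.commute)
qed

lemma eva_diff: "eva b (p - q) = eva b p - eva b q"
  using eva_add[of b p "- q"] by (simp add: eva_minus)

lemma eva_sum: "eva b (sum f A) = (\<Sum>x\<in>A. eva b (f x))"
proof (induction A rule: infinite_finite_induct)
  case (insert x F)
  then show ?case by (simp add: eva_add)
qed (use eva_Cst[of b 0] in simp_all)

lemma eva_Var: "eva b (Var i) = Cst (b $ i)"
proof -
  have "(\<Prod>j\<in>UNIV. Cst (b $ j) ^ coef (ee i) j) = (\<Prod>j\<in>UNIV. if j = i then Cst (b $ j) else 1)"
    by (rule prod.cong) (auto simp: lookup_single when_def)
  then show ?thesis by (simp add: eva_def Var_def subst_single)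
qed

lemma coef_map: "\<phi> 0 = 0 \<Longrightarrow> coef (Poly_Mapping.map \<phi> q) \<alpha> = \<phi> (coef q \<alpha>)"
  by (simp add: Poly_Mapping.map.rep_eq when_def)

lemma eva_expand:
  "eva b q = (\<Sum>\<alpha>\<in>Poly_Mapping.keys q. Cst (\<Prod>i\<in>UNIV. (b $ i) ^ coef \<alpha> i) * coef q \<alpha>)"
proof -
  have "(\<Prod>i\<in>A. Cst (b $ i) ^ coef \<alpha> i) = (Cst (\<Prod>i\<in>A. (b $ i) ^ coef \<alpha> i) :: ('a, complex) mpol)" for \<alpha> A
    by (induction A rule: infinite_finite_induct) (simp_all add: Cst_mult Cst_power)
  then show ?thesis by (simp add: eva_def subst_def mult.commute)
qed

text \<open>\<open>\<theta>\<close> acts on the coefficients only, so by linearity it commutes with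
  inserting complex values for \<open>a\<close>.\<close>

lemma eva_map:
  assumes "\<And>p q. \<theta> (p + q) = \<theta> p + \<theta> q" "\<And>c p. \<theta> (Cst c * p) = Cst c * \<theta> p"
  shows "eva b (Poly_Mapping.map \<theta> q) = \<theta> (eva b q)"
proof -
  have 0: "\<theta> 0 = 0" using assms(2)[of 0 0] by simp
  have sum: "\<theta> (sum g A) = (\<Sum>x\<in>A. \<theta> (g x))" for g :: "_ \<Rightarrow> _" and A
    by (induction A rule: infinite_finite_induct) (auto simp: 0 assms(1))
  let ?m = "\<lambda>\<alpha>. \<Prod>i\<in>UNIV. (b $ i) ^ coef \<alpha> i"
  have "eva b (Poly_Mapping.map \<theta> q) = (\<Sum>\<alpha>\<in>Poly_Mapping.keys q. Cst (?m \<alpha>) * coef (Poly_Mapping.map \<theta> q) \<alpha>)"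
    unfolding eva_expand by (rule sum.mono_neutral_left) (auto simp: in_keys_iff coef_map 0)
  also have "\<dots> = \<theta> (eva b q)"
    unfolding eva_expand sum assms(2) by (simp add: coef_map 0)
  finally show ?thesis .
qed

lemma lin_vf_linear: "lin_vf A (p + q) = lin_vf A p + lin_vf A q" "lin_vf A (Cst c * p) = Cst c * lin_vf A p"
  using zth_add[of "(A, 0)" p q] zth_Cst_mult[of "(A, 0)" c p] by (simp_all add: zth_eq)

lemma euler_linear: "euler (p + q) = euler p + euler q" "euler (Cst c * p) = Cst c * euler p"
proof -
  have e: "euler r = - zth (0, 1) r" for r :: "('a, complex) mpol"
    by (simp add: zth_eq lin_vf_def)
  show "euler (p + q) = euler p + euler q" "euler (Cst c * p) = Cst c * euler p"
    unfolding e zth_add zth_Cst_mult by simp_all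
qed

lemma eva_univ_section: "eva b univ_section = form b"
  by (simp add: univ_section_def form_def eva_sum eva_mult eva_Var)

lemma eva_Zvee: "eva b (Zvee x (Cst e)) = Zb b x e"
proof -
  obtain A t where x: "x = (A, t)" by (cases x)
  have tw: "eva b (twist \<theta> (Cst e)) = \<theta> e + \<theta> (form b) * e"
    if "\<And>p q. \<theta> (p + q) = \<theta> p + \<theta> q" "\<And>c p. \<theta> (Cst c * p) = Cst c * \<theta> p" for \<theta>
    by (simp add: twist_def eva_add eva_mult eva_map[OF that] eva_univ_section)
  have "eva b (Zvee x (Cst e)) =
      eva b (twist (lin_vf A) (Cst e)) - Cst t * (eva b (twist euler (Cst e)) + e)"
    by (simp add: x Zvee_def eva_diff eva_add eva_mult)
  also have "\<dots> = (lin_vf A e + lin_vf A (form b) * e) - Cst t * ((euler e + euler (form b) * e) + e)"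
    by (simp only: tw[of "lin_vf A", OF lin_vf_linear] tw[of euler, OF euler_linear])
  also have "\<dots> = Zb b x e"
    unfolding Zb_def x zth_eq snd_conv by (simp only: algebra_simps)
  finally show ?thesis .
qed

text \<open>Coordinates with respect to a basis are linear only on its span and zero by default
  outside, so every coefficient in \<open>a\<close> must lie in \<open>R_le d\<close> before
  coordinates can be exchanged with evaluation at \<open>b\<close>.\<close>

lemma degs_coef_Zvee:
  fixes e :: "('n::finite, complex) mpol"
  assumes e: "degs (edeg TYPE('n) d) e"
  shows "degs (edeg TYPE('n) (Suc d)) (coef (Zvee x (Cst e)) \<alpha>)"
proof -
  let ?E = "edeg TYPE('n) (Suc d)"
  obtain A t where x: "x = (A, t)" by (cases x)
  have up: "degs ?E p" if "degs (edeg TYPE('n) d) p" for p :: "('n, complex) mpol"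
    by (rule degs_mono[OF that]) (auto simp: edeg_def intro: less_SucI)
  have univ: "degs {CARD('n)} (coef univ_section \<alpha>)" for \<alpha> :: "'n dmon \<Rightarrow>\<^sub>0 nat"
  proof -
    have "coef (Var i * Cst (avee i)) \<alpha> = avee i * coef (Var i) \<alpha>" for i :: "'n dmon"
      by (subst mult.commute) (rule coef_Cst_mult)
    moreover have "coef (Var i :: ('n dmon, ('n, complex) mpol) mpol) \<alpha> = (if \<alpha> = ee i then 1 else 0)" for i
      by (auto simp: Var_def lookup_single when_def)
    ultimately have "coef (univ_section :: ('n dmon, ('n, complex) mpol) mpol) \<alpha> =
        (\<Sum>i\<in>UNIV. if \<alpha> = ee i then avee i else 0)"
      unfolding univ_section_def lookup_sum by (intro sum.cong) auto
    moreover have "degs {CARD('n)} (if \<alpha> = ee i then avee i else 0)" for i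
      by (simp add: degs_avee)
    ultimately show ?thesis by (simp add: degs_sum)
  qed
  have tw: "degs ?E (coef (twist \<theta> (Cst e)) \<alpha>)"
    if th: "\<theta> 0 = 0" "\<And>A p. degs A p \<Longrightarrow> degs A (\<theta> p)" for \<theta> \<alpha>
  proof -
    have "degs ?E (coef (Poly_Mapping.map \<theta> univ_section) \<alpha> * e)"
    proof (rule degs_mult[OF _ e])
      show "degs {CARD('n)} (coef (Poly_Mapping.map \<theta> univ_section) \<alpha>)"
        using th(2)[OF univ] by (simp add: coef_map th(1))
      fix k l assume kl: "k \<in> {CARD('n)}" "l \<in> edeg TYPE('n) d"
      then obtain i where i: "l = CARD('n) * i" "i < d" by (auto simp: edeg_def)
      then have "k + l = CARD('n) * Suc i" "Suc i < Suc d" using kl by auto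
      then show "k + l \<in> ?E" unfolding edeg_def by blast
    qed
    moreover have "coef (Poly_Mapping.map \<theta> univ_section * Cst e) \<alpha> = coef (Poly_Mapping.map \<theta> univ_section) \<alpha> * e"
      by (subst (1 2) mult.commute) (rule coef_Cst_mult)
    moreover have "degs ?E (coef (Poly_Mapping.map \<theta> (Cst e)) \<alpha>)"
      using th up[OF e] by (simp add: coef_map Cst_def lookup_single when_def)
    ultimately show ?thesis unfolding twist_def lookup_add by (simp add: degs_add)
  qed
  have l: "degs B (lin_vf A p)" if "degs B p" for B and p :: "('n, complex) mpol"
    using degs_zth[OF that, of "(A, 0)"] by (simp add: zth_eq)
  have u: "degs B (euler p)" if "degs B p" for B and p :: "('n, complex) mpol"
    using degs_minus[OF degs_zth[OF that, of "(0, 1)"]] by (simp add: zth_eq lin_vf_def)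
  have l0: "lin_vf A 0 = 0" and u0: "euler 0 = (0 :: ('n, complex) mpol)"
    using lin_vf_linear(2)[of A 0 0] euler_linear(2)[of 0 0] by simp_all
  have "coef (Zvee x (Cst e)) \<alpha> = coef (twist (lin_vf A) (Cst e)) \<alpha> -
      Cst t * (coef (twist euler (Cst e)) \<alpha> + coef (Cst e) \<alpha>)"
    by (simp only: x Zvee_def case_prod_conv lookup_minus lookup_add coef_Cst_mult)
  moreover have "degs ?E (coef (Cst e) \<alpha>)" using up[OF e] by (simp add: Cst_def lookup_single when_def)
  ultimately show ?thesis using tw[of "lin_vf A", OF l0 l] tw[of euler, OF u0 u] by (simp add: degs_diff degs_Cst_mult degs_add)
qed

lemma to_R_in_R_le:
  assumes "tdeg \<delta> = d"
  shows "to_R \<delta> \<in> R_le (int d)"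
proof -
  have "degs {..d} \<delta>"
    unfolding assms[symmetric] tdeg_def degs_def by (auto simp: in_keys_iff intro!: Max_ge)
  then show ?thesis
    unfolding R_le_iff_degs'
  proof (induction \<delta> rule: degs_induct)
    case zero
    have "to_R (0 :: ('a dmon, complex) mpol) = 0" by (simp add: to_R_def subst_def)
    then show ?case by simp
  next
    case (single \<alpha> c)
    have pw: "degs {CARD('a) * k} (avee i ^ k :: ('a, complex) mpol)" for k i
    proof (induction k)
      case 0
      then show ?case using degs_Cst[of "{0}" "1::complex"] by simp
    next
      case (Suc k)
      show ?case unfolding power_Suc by (rule degs_mult[OF degs_avee Suc]) auto
    qed
    have "degs {CARD('a) * (\<Sum>i\<in>A. coef \<alpha> i)} (\<Prod>i\<in>A. avee i ^ coef \<alpha> i :: ('a, complex) mpol)" for A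
    proof (induction A rule: infinite_finite_induct)
      case (insert x F)
      then show ?case
        by (simp, intro degs_mult[OF pw insert.IH]) (auto simp: distrib_left)
    qed (use degs_Cst[of "{0}" "1::complex"] in simp_all)
    from degs_Cst_mult[OF this[of UNIV], of c]
    have "degs {CARD('a) * mdeg \<alpha>} (to_R (Poly_Mapping.single \<alpha> c))"
      by (simp add: to_R_def subst_single mdeg_def)
    then show ?case by (rule degs_mono) (use single in \<open>auto simp: edeg_def less_Suc_eq_le\<close>)
  next
    case (add p q)
    then show ?case by (simp add: to_R_add degs_add)
  qed
qed

lemma M_at_carrier: "M_at xs es' es b \<in> carrier_mat (length es) (length xs * length es')"
  and M_mat_carrier: "M_mat xs es' es \<in> carrier_mat (length es) (length xs * length es')"
proof -
  have "length (concat (map (\<lambda>x. map (h x) es') xs)) = length xs * length es'" for h :: "_ \<Rightarrow> _ \<Rightarrow> 'z"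
    by (induction xs) auto
  then show "M_mat xs es' es \<in> carrier_mat (length es) (length xs * length es')"
    unfolding M_mat_def by (intro carrier_matI) auto
  then show "M_at xs es' es b \<in> carrier_mat (length es) (length xs * length es')"
    by (simp add: M_at_def)
qed

lemma rank_condition_iff:
  fixes xs :: "((complex ^ 'n ^ 'n::finite) \<times> complex) list"
  assumes xs: "is_basis scale_ghat ghat xs" and es': "is_basis scale_poly (R_le (int d - 1)) es'"
    and es: "is_basis scale_poly (R_le (int d)) es" and d: "tdeg \<delta> = d"
  shows "rk (M_at xs es' es b) = rk (augment (M_at xs es' es b) (Theta es \<delta>)) \<longleftrightarrow> to_R \<delta> \<in> twisted_image d b"
proof -
  let ?W = "R_le (int d) :: ('n, complex) mpol set" and ?m = "length es"
  define rep where "rep = sp.representation (set es)"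
  have ind: "sp.independent (set es)" and spn: "sp.span (set es) = ?W" and dist: "distinct es"
    using es by (simp_all add: is_basis_def)
  have W: "r \<in> ?W \<longleftrightarrow> r \<in> sp.span (set es)" for r using spn by simp
  define \<kappa> where "\<kappa> r = Matrix.vec ?m (\<lambda>j. rep r (es ! j))" for r
  have kidx: "vec_index (\<kappa> r) i = rep r (es ! i)" if "i < ?m" for r i
    using that by (simp add: \<kappa>_def)
  have rep_sum: "rep (\<Sum>x\<in>A. Cst (c x) * g x) e = (\<Sum>x\<in>A. c x * rep (g x) e)"
    if "finite A" "\<And>x. x \<in> A \<Longrightarrow> g x \<in> ?W" for A and c :: "'z \<Rightarrow> complex" and g e
    using that
  proof (induction A rule: finite_induct)
    case empty
    then show ?case by (simp add: rep_def sp.representation_zero)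
  next
    case (insert x F)
    have "(\<Sum>x\<in>F. Cst (c x) * g x) \<in> sp.span (set es)"
      using insert.prems by (intro sp.span_sum) (auto simp: W simp flip: scale_poly_def intro: sp.span_scale)
    moreover have "Cst (c x) * g x = scale_poly (c x) (g x)" by (simp add: scale_poly_def)
    moreover have "g x \<in> sp.span (set es)" using insert.prems W by simp
    ultimately show ?case
      using insert by (simp add: rep_def sp.representation_add[OF ind] sp.representation_scale[OF ind] sp.span_scale)
  qed
  \<comment> \<open>Injectivity identifies the set of columns with the generating set
    \<open>G\<close>, so that sums over the two agree.\<close>
  have inj: "inj_on \<kappa> ?W"
  proof (rule inj_onI)
    fix p q assume pq: "p \<in> ?W" "q \<in> ?W" "\<kappa> p = \<kappa> q"
    have "rep p e = rep q e" if e: "e \<in> set es" for e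
    proof -
      obtain j where j: "j < ?m" "e = es ! j" using e by (auto simp: in_set_conv_nth)
      have "vec_index (\<kappa> p) j = vec_index (\<kappa> q) j" using pq(3) by simp
      then show ?thesis using j by (simp add: \<kappa>_def)
    qed
    then have "(\<Sum>e\<in>set es. scale_poly (rep p e) e) = (\<Sum>e\<in>set es. scale_poly (rep q e) e)" by simp
    moreover have "(\<Sum>e\<in>set es. scale_poly (rep r e) e) = r" if r: "r \<in> ?W" for r
      unfolding rep_def by (rule sp.sum_representation_eq[OF ind r[unfolded W] finite_set order_refl])
    ultimately show "p = q" using pq(1,2) by simp
  qed
  define G where "G = {Zb b x e | x e. x \<in> set xs \<and> e \<in> set es'}"
  have finG: "finite G"
  proof -
    have "G = (\<lambda>(x, e). Zb b x e) ` (set xs \<times> set es')" unfolding G_def by auto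
    then show ?thesis by simp
  qed
  have de: "degs (edeg TYPE('n) d) e" if "e \<in> set es'" for e
  proof -
    have "e \<in> R_le (int d - 1)" using es' that sp.span_superset by (auto simp: is_basis_def)
    then show ?thesis by (simp add: R_le_iff_degs)
  qed
  have GW: "G \<subseteq> ?W"
  proof
    fix g assume "g \<in> G"
    then obtain x e where "g = Zb b x e" "e \<in> set es'" unfolding G_def by blast
    then show "g \<in> ?W" unfolding R_le_iff_degs' using degs_Zb[OF de] by simp
  qed
  have col: "map_vec (\<lambda>p. eval p b) (coords_a es (Zvee x (Cst e))) = \<kappa> (Zb b x e)" if e: "e \<in> set es'" for x e
  proof (rule eq_vecI)
    show "dim_vec (map_vec (\<lambda>p. eval p b) (coords_a es (Zvee x (Cst e)))) = dim_vec (\<kappa> (Zb b x e))"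
      by (simp add: coords_a_def \<kappa>_def)
    fix j assume "j < dim_vec (\<kappa> (Zb b x e))"
    then have j: "j < ?m" by (simp add: \<kappa>_def)
    define q where "q = Zvee x (Cst e)"
    let ?\<phi> = "\<lambda>r. rep r (es ! j)" and ?mm = "\<lambda>\<alpha>. \<Prod>i\<in>UNIV. (b $ i) ^ coef \<alpha> i"
    have 0: "?\<phi> 0 = 0" by (simp add: rep_def sp.representation_zero)
    have "eval (Poly_Mapping.map ?\<phi> q) b =
        (\<Sum>\<alpha>\<in>Poly_Mapping.keys q. coef (Poly_Mapping.map ?\<phi> q) \<alpha> * ?mm \<alpha>)"
      unfolding eval_def by (rule subst_superset) (auto simp: in_keys_iff coef_map 0)
    also have "\<dots> = (\<Sum>\<alpha>\<in>Poly_Mapping.keys q. ?mm \<alpha> * ?\<phi> (coef q \<alpha>))"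
      by (simp add: coef_map 0 mult.commute)
    also have "\<dots> = ?\<phi> (eva b q)"
      unfolding eva_expand
      by (rule rep_sum[symmetric]) (auto simp: R_le_iff_degs' q_def intro!: degs_coef_Zvee de e)
    finally have "eval (Poly_Mapping.map ?\<phi> q) b = rep (Zb b x e) (es ! j)" by (simp add: q_def eva_Zvee)
    then show "vec_index (map_vec (\<lambda>p. eval p b) (coords_a es (Zvee x (Cst e)))) j = vec_index (\<kappa> (Zb b x e)) j"
      using j by (simp add: coords_a_def \<kappa>_def rep_def q_def)
  qed
  have cols: "set (cols (M_at xs es' es b)) = \<kappa> ` G"
  proof -
    let ?cs = "[coords_a es (Zvee x (Cst e)). x \<leftarrow> xs, e \<leftarrow> es']"
    have "set ?cs \<subseteq> carrier_vec ?m" by (auto simp: coords_a_def)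
    then have c: "cols (M_mat xs es' es) = ?cs" unfolding M_mat_def by (rule cols_mat_of_cols)
    have "cols (M_at xs es' es b) = map (map_vec (\<lambda>p. eval p b)) (cols (M_mat xs es' es))"
      unfolding M_at_def by (rule nth_equalityI) (auto simp: cols_def)
    then have "set (cols (M_at xs es' es b)) = map_vec (\<lambda>p. eval p b) ` set ?cs" unfolding c by simp
    also have "set ?cs = (\<lambda>(x, e). coords_a es (Zvee x (Cst e))) ` (set xs \<times> set es')" by auto
    also have "map_vec (\<lambda>p. eval p b) ` \<dots> = \<kappa> ` (\<lambda>(x, e). Zb b x e) ` (set xs \<times> set es')"
      unfolding image_image by (rule image_cong) (auto simp: col)
    also have "(\<lambda>(x, e). Zb b x e) ` (set xs \<times> set es') = G" unfolding G_def by auto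
    finally show ?thesis .
  qed
  have h: "to_R \<delta> \<in> ?W" by (rule to_R_in_R_le[OF d])
  have Th: "Theta es \<delta> = \<kappa> (to_R \<delta>)" by (simp add: Theta_def \<kappa>_def rep_def)
  have Thc: "Theta es \<delta> \<in> carrier_vec ?m" by (simp add: Theta_def)
  have injG: "inj_on \<kappa> G" using inj GW by (rule inj_on_subset)
  have "rk (M_at xs es' es b) = rk (augment (M_at xs es' es b) (Theta es \<delta>)) \<longleftrightarrow>
      (\<exists>c. \<forall>i<?m. rep (to_R \<delta>) (es ! i) = (\<Sum>g\<in>G. c (\<kappa> g) * rep g (es ! i)))"
  proof -
    have "(\<Sum>x\<in>\<kappa> ` G. c x * vec_index x i) = (\<Sum>g\<in>G. c (\<kappa> g) * rep g (es ! i))" if i: "i < ?m" for c i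
      unfolding sum.reindex[OF injG] by (simp add: kidx[OF i])
    then show ?thesis
      unfolding rk_augment_iff[OF M_at_carrier Thc] unfolding cols Th by (simp add: kidx)
  qed
  also have "\<dots> \<longleftrightarrow> to_R \<delta> \<in> sp.span G"
  proof
    assume "\<exists>c. \<forall>i<?m. rep (to_R \<delta>) (es ! i) = (\<Sum>g\<in>G. c (\<kappa> g) * rep g (es ! i))"
    then obtain c where c: "\<And>i. i < ?m \<Longrightarrow> rep (to_R \<delta>) (es ! i) = (\<Sum>g\<in>G. c (\<kappa> g) * rep g (es ! i))" by blast
    define h' where "h' = (\<Sum>g\<in>G. Cst (c (\<kappa> g)) * g)"
    have h'G: "h' \<in> sp.span G"
      unfolding h'_def by (intro sp.span_sum) (auto simp flip: scale_poly_def intro: sp.span_scale sp.span_base)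
    have h'W: "h' \<in> ?W"
      unfolding h'_def W using GW W
      by (intro sp.span_sum) (auto simp flip: scale_poly_def intro!: sp.span_scale)
    have "\<kappa> (to_R \<delta>) = \<kappa> h'"
    proof (rule eq_vecI)
      show "dim_vec (\<kappa> (to_R \<delta>)) = dim_vec (\<kappa> h')" by (simp add: \<kappa>_def)
      fix i assume "i < dim_vec (\<kappa> h')"
      then have i: "i < ?m" by (simp add: \<kappa>_def)
      have "rep h' (es ! i) = (\<Sum>g\<in>G. c (\<kappa> g) * rep g (es ! i))"
        unfolding h'_def using finG GW by (intro rep_sum) auto
      then show "vec_index (\<kappa> (to_R \<delta>)) i = vec_index (\<kappa> h') i" using c[OF i] by (simp add: kidx[OF i])
    qed
    then have "to_R \<delta> = h'" using inj h h'W by (auto dest: inj_onD)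
    then show "to_R \<delta> \<in> sp.span G" using h'G by simp
  next
    assume "to_R \<delta> \<in> sp.span G"
    then obtain u where u: "to_R \<delta> = (\<Sum>g\<in>G. scale_poly (u g) g)" using sp.span_finite[OF finG] by auto
    have "rep (to_R \<delta>) e = (\<Sum>g\<in>G. u g * rep g e)" for e
      unfolding u scale_poly_def using finG GW by (intro rep_sum) auto
    \<comment> \<open>Coefficients indexed by generators are transported to columns through the
      inverse of \<open>\<kappa>\<close>.\<close>
    then show "\<exists>c. \<forall>i<?m. rep (to_R \<delta>) (es ! i) = (\<Sum>g\<in>G. c (\<kappa> g) * rep g (es ! i))"
      using injG by (intro exI[of _ "\<lambda>x. u (the_inv_into G \<kappa> x)"]) (simp add: the_inv_into_f_f)
  qed
  also have "sp.span G = twisted_image d b" unfolding G_def by (rule twisted_image_eq_span[OF xs es', symmetric])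
  finally show ?thesis .
qed

theorem theorem6p2:
  fixes \<delta> :: "('n::finite dmon, complex) mpol"
    and d :: nat
    and xs :: "((complex ^ 'n ^ 'n) \<times> complex) list"
    and es' es :: "('n, complex) mpol list"
  assumes "tdeg \<delta> = d"
    and "is_basis scale_ghat ghat xs"
    and "is_basis scale_poly (R_le (int d - 1)) es'"
    and "is_basis scale_poly (R_le (int d)) es"
  shows "NN \<delta> = {b \<in> smooth_forms.
             rk (M_at xs es' es b) = rk (augment (M_at xs es' es b) (Theta es \<delta>))}
       \<and> zariski_closed_in smooth_forms (NN \<delta>)
       \<and> quasi_affine_variety (NN \<delta>)
       \<and> stratification (NN \<delta>) (\<lambda>k. {b \<in> NN \<delta>. rk (M_at xs es' es b) = k})"
proof -
  \<comment> \<open>Membership in the twisted image mediates between the analytic definition and the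
    rank condition.\<close>
  have NN: "NN \<delta> = {b \<in> smooth_forms. to_R \<delta> \<in> twisted_image d b}"
  proof (rule equalityI; rule subsetI)
    fix b assume "b \<in> NN \<delta>"
    then have b: "b \<in> smooth_forms"
      and z: "\<And>U s. open U \<Longrightarrow> b \<in> U \<Longrightarrow> s \<in> sol U \<Longrightarrow> diffop \<delta> s b = 0"
      unfolding NN_def by blast+
    from diffop_zero_imp_twisted_image[OF b to_R_in_R_le[OF assms(1)] z] b
    show "b \<in> {b \<in> smooth_forms. to_R \<delta> \<in> twisted_image d b}" by simp
  next
    fix b assume "b \<in> {b \<in> smooth_forms. to_R \<delta> \<in> twisted_image d b}"
    then have b: "b \<in> smooth_forms" and I: "to_R \<delta> \<in> twisted_image d b" by simp_all
    show "b \<in> NN \<delta>" unfolding NN_def using b twisted_image_imp_diffop_zero[OF _ _ _ I] by blast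
  qed
  then have eq: "NN \<delta> = {b \<in> smooth_forms.
      rk (M_at xs es' es b) = rk (augment (M_at xs es' es b) (Theta es \<delta>))}"
    using rank_condition_iff[OF assms(2-4,1)] by simp
  have closed: "zariski_closed_in smooth_forms (NN \<delta>)"
  proof (rule zariski_closed_inI)
    show "NN \<delta> \<subseteq> smooth_forms" unfolding NN by blast
    fix b assume b: "b \<in> smooth_forms" "b \<notin> NN \<delta>"
    then obtain p where "eval p b \<noteq> 0" "\<forall>b. eval p b \<noteq> 0 \<longrightarrow> to_R \<delta> \<notin> twisted_image d b"
      using twisted_image_complement_open[of b "to_R \<delta>" d] unfolding NN by blast
    then show "\<exists>p. eval p b \<noteq> 0 \<and> (\<forall>c\<in>NN \<delta>. eval p c = 0)" unfolding NN by blast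
  qed
  then obtain C where C: "zariski_closed C" "NN \<delta> = smooth_forms \<inter> C" unfolding zariski_closed_in_def by blast
  let ?r = "\<lambda>b. rk (M_at xs es' es b)"
  have less: "zariski_closed {b. ?r b < k}" for k
    using rk_less_closed[OF M_mat_carrier, of xs es' es k] unfolding M_at_def by simp
  have quasi: "quasi_affine_variety (NN \<delta>)"
    unfolding quasi_affine_variety_def
    by (intro exI[of _ C] exI[of _ "- smooth_forms"]) (use C zariski_closed_singular in auto)
  have strat: "stratification (NN \<delta>) (\<lambda>k. {b \<in> NN \<delta>. ?r b = k})"
    unfolding stratification_def
  proof (intro conjI allI)
    have "?r b \<le> length xs * length es'" for b
      unfolding rk_def carrier_matD(1)[OF M_at_carrier] by (rule vec_space.rank_le_nc[OF M_at_carrier])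
    then show "finite {k. {b \<in> NN \<delta>. ?r b = k} \<noteq> {}}"
      by - (rule finite_subset[OF _ finite_atMost[of "length xs * length es'"]], auto)
    show "disjoint_family (\<lambda>k. {b \<in> NN \<delta>. ?r b = k})" by (auto simp: disjoint_family_on_def)
    show "(\<Union>k. {b \<in> NN \<delta>. ?r b = k}) = NN \<delta>" by blast
    show "quasi_affine_variety {b \<in> NN \<delta>. ?r b = k}" for k
      unfolding quasi_affine_variety_def
    proof (intro exI conjI)
      \<comment> \<open>Rank \<open>k\<close> means below \<open>Suc k\<close> but not below
        \<open>k\<close>; both bounds are Zariski closed, and the singular forms are removed
        together with the second.\<close>
      show "zariski_closed (C \<inter> {b. ?r b < Suc k})" by (intro zariski_closed_Int C less)
      show "zariski_closed (- smooth_forms \<union> {b. ?r b < k})"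
        by (intro zariski_closed_Un zariski_closed_singular less)
      show "{b \<in> NN \<delta>. ?r b = k} = C \<inter> {b. ?r b < Suc k} - (- smooth_forms \<union> {b. ?r b < k})"
        unfolding C(2) by auto
    qed
    show "zariski_closed_in (NN \<delta>) (\<Union>j\<le>k. {b \<in> NN \<delta>. ?r b = j})" for k
      unfolding zariski_closed_in_def
      by (intro exI[of _ "{b. ?r b < Suc k}"] conjI less) auto
  qed
  from eq closed quasi strat show ?thesis by (intro conjI)
qed

end
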